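(* Let $k\ge 2$, let $I_1,\dots,I_k$ be pairwise disjoint compact intervals in $[0,1)$ and let $L\subset[0,1)$ be a compact interval containing $I_1\cup\dots\cup I_k$. Then for each $M>0$ and $\alpha>0$ there exists $\varepsilon>0$ such that for every $S\in\mathcal A(M,\varepsilon,\alpha)$ the Cantor set $C_S$ is not $C^1$-minimal, i.e. there is no $C^1$ diffeomorphism $f:S^1\to S^1$ having $C_S$ as a minimal set.
   Context: Identify $S^1=\mathbb R/\mathbb Z$ with $[0,1)$; one normalizes so that $L=[0,1/2]$ and $(1/2,1)$ is a complementary interval of $C_S$ in $S^1$. Let $I=I_1\cup\dots\cup I_k$. For $r\ge 1$, $\mathcal S^r(I_1,\dots,I_k,L)$ is the set of $C^r$ maps $S:I\to L$ with $S(I_j)=L$ for each $j$ and $|S'|>1$ on $I$ ($C^{1+\alpha}$ means $C^1$ with $\alpha$-Hölder derivative). For such $S$, $C_S=\{x\in I: S^n(x)\in I \text{ for all } n\ge 1\}$, a Cantor set. The nonlinearity of $S$ is $\mathcal N(S)=\max_{j}\sup_{x,y\in I_j}\log\frac{|S'(x)|}{|S'(y)|}$. For $M,\varepsilon,\alpha>0$, $\mathcal A(M,\varepsilon,\alpha)$ is the set of $S\in\mathcal S^{1+\alpha}(I_1,\dots,I_k,L)$ with $\mathcal N(S)<\varepsilon$ and $\left|\log\frac{|S'(x)|}{|S'(y)|}\right|\le M|x-y|^\alpha$ for all $x,y$ in a common $I_j$. A closed set $K\subset S^1$ is a minimal set of a homeomorphism $f$ if it is nonempty, $f$-invariant, and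 every $f$-orbit in $K$ is dense in $K$. *)

theory Defs
  imports Complex_Main
begin

text \<open>The circle S^1 = R/Z is identified with [0,1). Intervals I_j = {a j..b j} (j < k),
  L = {c..d}.\<close>

definition interval_family :: "nat \<Rightarrow> (nat \<Rightarrow> real) \<Rightarrow> (nat \<Rightarrow> real) \<Rightarrow> real set" where
  "interval_family k a b = (\<Union>j<k. {a j..b j})"

definition nonlinearity :: "nat \<Rightarrow> (nat \<Rightarrow> real) \<Rightarrow> (nat \<Rightarrow> real) \<Rightarrow> (real \<Rightarrow> real) \<Rightarrow> real" where
  "nonlinearity k a b S' =
     Max ((\<lambda>j. Sup {ln (\<bar>S' x\<bar> / \<bar>S' y\<bar>) | x y. x \<in> {a j..b j} \<and> y \<in> {a j..b j}}) ` {..<k})"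

definition in_A :: "nat \<Rightarrow> (nat \<Rightarrow> real) \<Rightarrow> (nat \<Rightarrow> real) \<Rightarrow> real \<Rightarrow> real \<Rightarrow>
    real \<Rightarrow> real \<Rightarrow> real \<Rightarrow> (real \<Rightarrow> real) \<Rightarrow> bool" where
  "in_A k a b c d M \<epsilon> \<alpha> S \<longleftrightarrow>
     (\<exists>S'.
        (\<forall>j<k. \<forall>x\<in>{a j..b j}. (S has_real_derivative S' x) (at x within {a j..b j}))
      \<and> (\<forall>j<k. \<exists>H. \<forall>x\<in>{a j..b j}. \<forall>y\<in>{a j..b j}. \<bar>S' x - S' y\<bar> \<le> H * \<bar>x - y\<bar> powr \<alpha>)
      \<and> (\<forall>j<k. S ` {a j..b j} = {c..d})
      \<and> (\<forall>x\<in>interval_family k a b. \<bar>S' x\<bar> > 1)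
      \<and> nonlinearity k a b S' < \<epsilon>
      \<and> (\<forall>j<k. \<forall>x\<in>{a j..b j}. \<forall>y\<in>{a j..b j}.
            \<bar>ln (\<bar>S' x\<bar> / \<bar>S' y\<bar>)\<bar> \<le> M * \<bar>x - y\<bar> powr \<alpha>))"

definition cantor_set :: "nat \<Rightarrow> (nat \<Rightarrow> real) \<Rightarrow> (nat \<Rightarrow> real) \<Rightarrow> (real \<Rightarrow> real) \<Rightarrow> real set" where
  "cantor_set k a b S = {x \<in> interval_family k a b. \<forall>n\<ge>1. (S ^^ n) x \<in> interval_family k a b}"

definition circ_dist :: "real \<Rightarrow> real \<Rightarrow> real" where
  "circ_dist x y = \<bar>x - y - real_of_int (round (x - y))\<bar>"

text \<open>f : [0,1) -> [0,1) is a C^1 diffeomorphism of the circle: it is induced by a C^1 lift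
  F : R -> R with nowhere vanishing derivative and F(x+1) = F(x) +- 1.\<close>
definition C1_circle_diffeo :: "(real \<Rightarrow> real) \<Rightarrow> bool" where
  "C1_circle_diffeo f \<longleftrightarrow>
     (\<exists>F F'. (\<forall>x. (F has_real_derivative F' x) (at x)) \<and> continuous_on UNIV F'
        \<and> (\<forall>x. F' x \<noteq> 0) \<and> (\<exists>e\<in>{-1, 1::real}. \<forall>x. F (x + 1) = F x + e)
        \<and> (\<forall>x\<in>{0..<1}. f x = frac (F x)))"

definition circle_orbit :: "(real \<Rightarrow> real) \<Rightarrow> real \<Rightarrow> real set" where
  "circle_orbit f x = {(f ^^ n) x | n. True} \<union> {(the_inv_into {0..<1} f ^^ n) x | n. True}"

definition circle_minimal_set :: "(real \<Rightarrow> real) \<Rightarrow> real set \<Rightarrow> bool" where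
  "circle_minimal_set f K \<longleftrightarrow>
     K \<subseteq> {0..<1} \<and> K \<noteq> {} \<and> closed {x. frac x \<in> K} \<and> f ` K = K
     \<and> (\<forall>x\<in>K. \<forall>y\<in>K. \<forall>e>0. \<exists>z\<in>circle_orbit f x. circ_dist z y < e)"

end

theory Submission
  imports Defs "HOL-Analysis.Analysis"
begin

text \<open>
  The gaps of \<open>C\<^sub>S\<close> are the images of finitely many primary gaps under the composites of the inverse
  branches of \<open>S\<close>. Small nonlinearity together with the Hoelder bound makes the distortion of all
  composites uniformly small, so \<open>S\<close> is compared with the affine model having the same branches
  and orientations: each gap has a combinatorial length, namely the length of the corresponding gap
  of the model, and the ratio of the lengths of two gaps of comparable size and position is close to
  the ratio of their combinatorial lengths, which ranges over a finite set.

  A \<open>C\<^sup>1\<close> diffeomorphism \<open>f\<close> preserving \<open>C\<^sub>S\<close> permutes the gaps and is nearly affine on small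
  scales, so it nearly preserves the ratios of nearby gaps, hence it preserves the ratios of their
  combinatorial lengths exactly. Therefore the logarithmic change of combinatorial length under
  \<open>f\<close> is constant on all cylinders of some fixed generation; in particular it has bounded
  variation. Denjoy's argument now applies to combinatorial instead of true lengths: along a sequence
  of return times \<open>q\<close> the product of the combinatorial lengths of \<open>f\<^sup>q J\<close> and \<open>f\<^sup>-\<^sup>q J\<close> stays
  bounded away from zero, although the gaps \<open>f\<^sup>n J\<close> are distinct, so that their combinatorial
  lengths tend to zero.
\<close>

section \<open>Iterated function systems and the coding of gaps\<close>

text \<open>Exact equality of ratios rests on the order of the choices. The contraction rate
  \<open>\<theta>\<close> is fixed from the intervals alone; it bounds how many generations can
  separate gaps of comparable size, so for each orientation pattern only finitely many logarithmic
  ratios occur, with a least distance \<open>\<kappa>\<close> between distinct ones. Only then is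
  the admissible distortion chosen, with the total measuring error below \<open>\<kappa>\<close>,
  and \<epsilon> comes last. The model depends on which branches reverse the orientation; there are
  finitely many patterns, so a minimum over them is taken. The obstacle is that gaps of very
  different sizes have infinitely many ratios and that the error grows with the number of
  generations compared. Hence a gap is compared only with gaps of the same word or of one more
  letter; equality, unlike approximation, survives an arbitrarily long chain of such comparisons.
  This turns the mere continuity of the logarithm of the derivative, for which Denjoy's argument
  fails, into local constancy.\<close>

definition nbrs :: "real set \<Rightarrow> real \<Rightarrow> real \<Rightarrow> bool" where
  "nbrs A x y \<longleftrightarrow> x \<in> A \<and> y \<in> A \<and> x \<noteq> y \<and> (\<forall>z\<in>A. \<not> (min x y < z \<and> z < max x y))"

lemma nbrs_sym: "nbrs A x y \<longleftrightarrow> nbrs A y x"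
  by (auto simp: nbrs_def min.commute max.commute)

text \<open>The logarithmic scaling factor of the composite \<open>g j\<^sub>1 \<circ> \<dots> \<circ> g j\<^sub>n\<close> on the pair \<open>x, y\<close>, where
  \<open>w = [j\<^sub>1, \<dots>, j\<^sub>n]\<close>.\<close>
definition logscale :: "(nat \<Rightarrow> real \<Rightarrow> real) \<Rightarrow> nat list \<Rightarrow> real \<Rightarrow> real \<Rightarrow> real" where
  "logscale g w x y = ln \<bar>foldr g w x - foldr g w y\<bar> - ln \<bar>x - y\<bar>"

lemma logscale_append:
  "logscale g (w @ s) x y = logscale g s x y + logscale g w (foldr g s x) (foldr g s y)"
  by (simp add: logscale_def)

lemma split_common_prefix:
  obtains p xs' ys' where "xs = p @ xs'" "ys = p @ ys'" "xs' = [] \<or> ys' = [] \<or> hd xs' \<noteq> hd ys'"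
proof -
  have "\<exists>p xs' ys'. xs = p @ xs' \<and> ys = p @ ys' \<and> (xs' = [] \<or> ys' = [] \<or> hd xs' \<noteq> hd ys')"
  proof (induction xs arbitrary: ys)
    case Nil
    show ?case by (rule exI[of _ "[]"]) simp
  next
    case (Cons x xs)
    show ?case
    proof (cases "\<exists>zs. ys = x # zs")
      case True
      then obtain zs where zs: "ys = x # zs" by blast
      obtain p xs' ys' where "xs = p @ xs'" "zs = p @ ys'"
        "xs' = [] \<or> ys' = [] \<or> hd xs' \<noteq> hd ys'" using Cons[of zs] by blast
      then have "x # xs = (x # p) @ xs'" "ys = (x # p) @ ys'"
        "xs' = [] \<or> ys' = [] \<or> hd xs' \<noteq> hd ys'" using zs by auto
      then show ?thesis by blast
    next
      case False
      then show ?thesis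
        by (intro exI[of _ "[]"] exI[of _ "x # xs"] exI[of _ ys]) (cases ys; auto)
    qed
  qed
  then show ?thesis using that by blast
qed

section \<open>Geometry of the interval configuration and its affine ratios\<close>

locale interval_config =
  fixes k :: nat and a b :: "nat \<Rightarrow> real" and c d :: real
  assumes k_ge: "2 \<le> k" and cd: "c < d"
    and ab: "\<And>j. j < k \<Longrightarrow> a j < b j"
    and ca: "\<And>j. j < k \<Longrightarrow> c \<le> a j"
    and bd: "\<And>j. j < k \<Longrightarrow> b j \<le> d"
    and disj: "\<And>i j. i < k \<Longrightarrow> j < k \<Longrightarrow> i \<noteq> j \<Longrightarrow> b i < a j \<or> b j < a i"
begin

definition rho :: "nat \<Rightarrow> real" where "rho j = (b j - a j) / (d - c)"

definition rhow :: "nat list \<Rightarrow> real" where "rhow w = prod_list (map rho w)"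

lemma rhow_simps [simp]: "rhow [] = 1" "rhow (j # w) = rho j * rhow w"
  "rhow (w @ s) = rhow w * rhow s"
  by (simp_all add: rhow_def)

lemma rho_pos: "j < k \<Longrightarrow> 0 < rho j"
  using ab cd by (simp add: rho_def)

lemma rhow_pos: "set w \<subseteq> {..<k} \<Longrightarrow> 0 < rhow w"
  by (induction w) (auto simp: rho_pos)

lemma other_index: obtains i where "i < k" "i \<noteq> j"
proof (cases "j = 0")
  case True
  then show ?thesis using that[of 1] k_ge by simp
next
  case False
  then show ?thesis using that[of 0] k_ge by simp
qed

lemma rho_less_1: assumes "j < k" shows "rho j < 1"
proof -
  obtain i where i: "i < k" "i \<noteq> j" using other_index .
  have "b j - a j < d - c"
    using disj[OF i(1) assms i(2)] ab[OF i(1)] ca[OF i(1)] bd[OF i(1)] ca[OF assms] bd[OF assms]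
    by linarith
  then show ?thesis using cd by (simp add: rho_def)
qed

lemma separation:
  obtains \<gamma> where "0 < \<gamma>"
    "\<And>i j x y. i < k \<Longrightarrow> j < k \<Longrightarrow> i \<noteq> j \<Longrightarrow> x \<in> {a i..b i} \<Longrightarrow> y \<in> {a j..b j} \<Longrightarrow> \<gamma> \<le> \<bar>x - y\<bar>"
proof -
  define A where "A = (\<lambda>(i,j). max (a i - b j) (a j - b i)) ` {(i,j). i < k \<and> j < k \<and> i \<noteq> j}"
  have "{(i,j). i < k \<and> j < k \<and> i \<noteq> j} \<subseteq> {..<k} \<times> {..<k}" by auto
  then have fin: "finite A" unfolding A_def by (meson finite_SigmaI finite_imageI finite_lessThan finite_subset)
  have pos: "0 < z" if "z \<in> A" for z
    using that disj unfolding A_def by fastforce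
  define \<gamma> where "\<gamma> = Min (insert 1 A)"
  have "0 < \<gamma>" unfolding \<gamma>_def using fin pos by (subst Min_gr_iff) auto
  moreover have "\<gamma> \<le> \<bar>x - y\<bar>"
    if "i < k" "j < k" "i \<noteq> j" "x \<in> {a i..b i}" "y \<in> {a j..b j}" for i j x y
  proof -
    have "max (a i - b j) (a j - b i) \<in> A" unfolding A_def using that by force
    then have "\<gamma> \<le> max (a i - b j) (a j - b i)" unfolding \<gamma>_def using fin by simp
    also have "\<dots> \<le> \<bar>x - y\<bar>" using that(4,5) by auto
    finally show ?thesis .
  qed
  ultimately show ?thesis using that by blast
qed

lemma rho_bounds:
  obtains r s where "0 < r" "s < 1" "0 < s" "\<And>j. j < k \<Longrightarrow> r \<le> rho j" "\<And>j. j < k \<Longrightarrow> rho j \<le> s"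
proof -
  let ?A = "rho ` {..<k}"
  have "0 < k" using k_ge by linarith
  then have ne: "?A \<noteq> {}" and fin: "finite ?A" by auto
  have *: "rho 0 \<le> Max ?A" using k_ge by (intro Max_ge) auto
  have "0 < rho 0" using rho_pos k_ge by auto
  with * have "0 < Max ?A" by linarith
  moreover have "0 < Min ?A" using ne fin rho_pos by auto
  moreover have "Max ?A < 1" using ne fin rho_less_1 by auto
  ultimately show ?thesis using that[of "Min ?A" "Max ?A"] fin by auto
qed

lemma lowest: obtains l where "l < k" "\<And>j. j < k \<Longrightarrow> j \<noteq> l \<Longrightarrow> b l < a j"
proof -
  define l where "l = arg_min_on a {..<k}"
  have ne: "{..<k} \<noteq> {}" using k_ge by (auto simp: lessThan_empty_iff)
  have l: "l < k" using arg_min_if_finite(1)[OF finite_lessThan ne, of a] by (simp add: l_def)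
  have le: "a l \<le> a j" if "j < k" for j
    using arg_min_least[OF finite_lessThan ne, of j a] that by (simp add: l_def)
  have "b l < a j" if "j < k" "j \<noteq> l" for j
    using disj[OF l that(1)] le[OF that(1)] ab[OF that(1)] that(2) by fastforce
  with l show ?thesis using that by blast
qed

lemma highest: obtains l where "l < k" "\<And>j. j < k \<Longrightarrow> j \<noteq> l \<Longrightarrow> b j < a l"
proof -
  define l where "l = arg_min_on (\<lambda>j. - b j) {..<k}"
  have ne: "{..<k} \<noteq> {}" using k_ge by (auto simp: lessThan_empty_iff)
  have l: "l < k" using arg_min_if_finite(1)[OF finite_lessThan ne, of "\<lambda>j. - b j"] by (simp add: l_def)
  have le: "b j \<le> b l" if "j < k" for j
    using arg_min_least[OF finite_lessThan ne, of j "\<lambda>j. - b j"] that by (simp add: l_def)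
  have "b j < a l" if "j < k" "j \<noteq> l" for j
    using disj[OF l that(1)] le[OF that(1)] ab[OF that(1)] that(2) ab[OF l] by fastforce
  with l show ?thesis using that by blast
qed

lemma index_unique: "i < k \<Longrightarrow> j < k \<Longrightarrow> x \<in> {a i..b i} \<Longrightarrow> x \<in> {a j..b j} \<Longrightarrow> i = j"
  using disj[of i j] by fastforce

end

text \<open>The maps \<open>g j\<close> are the inverse branches of \<open>S\<close>, with orientation \<open>\<sigma> j\<close>; all their composites
  distort length ratios by a factor of at most \<open>exp \<delta>\<close>.\<close>
locale ifs = interval_config +
  fixes \<sigma> :: "nat \<Rightarrow> bool" and g :: "nat \<Rightarrow> real \<Rightarrow> real" and C :: "real set" and \<delta> \<theta> :: real
  assumes g_less: "\<And>j x y. j < k \<Longrightarrow> x \<in> {c..d} \<Longrightarrow> y \<in> {c..d} \<Longrightarrow> x < y \<Longrightarrow>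
      if \<sigma> j then g j x < g j y else g j y < g j x"
    and g_c: "\<And>j. j < k \<Longrightarrow> g j c = (if \<sigma> j then a j else b j)"
    and g_d: "\<And>j. j < k \<Longrightarrow> g j d = (if \<sigma> j then b j else a j)"
    and C_sub: "C \<subseteq> {c..d}" and C_closed: "closed C" and C_ne: "C \<noteq> {}"
    and C_iff: "\<And>x. x \<in> C \<longleftrightarrow> (\<exists>j<k. \<exists>y\<in>C. x = g j y)"
    and distortion: "\<And>w x y u v. set w \<subseteq> {..<k} \<Longrightarrow> {x, y, u, v} \<subseteq> {c..d} \<Longrightarrow> x \<noteq> y \<Longrightarrow> u \<noteq> v
      \<Longrightarrow> \<bar>logscale g w x y - logscale g w u v\<bar> \<le> \<delta>"
    and \<delta>_pos: "0 < \<delta>"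
    and \<theta>: "0 < \<theta>" "\<theta> < 1" "\<And>j. j < k \<Longrightarrow> exp \<delta> * rho j \<le> \<theta>"
begin

lemma g_less_iff:
  "j < k \<Longrightarrow> x \<in> {c..d} \<Longrightarrow> y \<in> {c..d} \<Longrightarrow> g j x < g j y \<longleftrightarrow> (if \<sigma> j then x < y else y < x)"
  using g_less[of j x y] g_less[of j y x] by (cases x y rule: linorder_cases) auto

lemma g_eq_iff: "j < k \<Longrightarrow> x \<in> {c..d} \<Longrightarrow> y \<in> {c..d} \<Longrightarrow> g j x = g j y \<longleftrightarrow> x = y"
  using g_less_iff[of j x y] g_less_iff[of j y x] by (metis linorder_neq_iff)

lemma g_le_iff:
  "j < k \<Longrightarrow> x \<in> {c..d} \<Longrightarrow> y \<in> {c..d} \<Longrightarrow> g j x \<le> g j y \<longleftrightarrow> (if \<sigma> j then x \<le> y else y \<le> x)"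
  using g_less_iff[of j y x] by auto

lemma g_in: assumes "j < k" "x \<in> {c..d}" shows "g j x \<in> {a j..b j}"
proof -
  have cd': "c \<in> {c..d}" "d \<in> {c..d}" using cd by auto
  show ?thesis
    using g_le_iff[OF assms(1) cd'(1) assms(2)] g_le_iff[OF assms(1) assms(2) cd'(1)]
      g_le_iff[OF assms(1) cd'(2) assms(2)] g_le_iff[OF assms(1) assms(2) cd'(2)]
      g_c[OF assms(1)] g_d[OF assms(1)] assms(2)
    by (cases "\<sigma> j") auto
qed

lemma I_sub: "j < k \<Longrightarrow> {a j..b j} \<subseteq> {c..d}"
  using ca bd by fastforce

lemma G_in: "set w \<subseteq> {..<k} \<Longrightarrow> x \<in> {c..d} \<Longrightarrow> foldr g w x \<in> {c..d}"
proof (induction w)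
  case (Cons j w)
  then show ?case using g_in[of j "foldr g w x"] I_sub[of j] by auto
qed auto

lemma G_eq_iff:
  "set w \<subseteq> {..<k} \<Longrightarrow> x \<in> {c..d} \<Longrightarrow> y \<in> {c..d} \<Longrightarrow> foldr g w x = foldr g w y \<longleftrightarrow> x = y"
  by (induction w) (use G_in g_eq_iff in auto)

lemma C_g: "j < k \<Longrightarrow> x \<in> C \<Longrightarrow> g j x \<in> C"
  using C_iff by blast

lemma G_C: "set w \<subseteq> {..<k} \<Longrightarrow> x \<in> C \<Longrightarrow> foldr g w x \<in> C"
  by (induction w) (auto intro: C_g)

lemma C_in: "x \<in> C \<Longrightarrow> x \<in> {c..d}"
  using C_sub by auto

lemma C_branch: assumes "x \<in> C" obtains j y where "j < k" "y \<in> C" "x = g j y" "x \<in> {a j..b j}"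
  using assms C_iff[of x] g_in C_in by metis

lemma C_branch_at:
  assumes "x \<in> C" "j < k" "x \<in> {a j..b j}" obtains y where "y \<in> C" "x = g j y"
  using C_branch[OF assms(1)] index_unique[OF assms(2) _ assms(3)] by metis

text \<open>Disjointness of the intervals is what transports gaps: a point of \<open>C\<close>
  between two points of \<open>{a j..b j}\<close> lies in that interval itself, hence in the image
  of branch \<open>j\<close>, and can be pulled back monotonically.\<close>

lemma nbrs_g: assumes j: "j < k" and x: "x \<in> C" and y: "y \<in> C"
  shows "nbrs C (g j x) (g j y) \<longleftrightarrow> nbrs C x y"
proof -
  have betw: "min (g j x) (g j y) < g j z \<and> g j z < max (g j x) (g j y) \<longleftrightarrow> min x y < z \<and> z < max x y"
    if "z \<in> C" for z
    using g_less_iff[OF j C_in[OF x] C_in[OF that]] g_less_iff[OF j C_in[OF y] C_in[OF that]]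
     g_less_iff[OF j C_in[OF that] C_in[OF x]] g_less_iff[OF j C_in[OF that] C_in[OF y]]
    by (auto simp: min_less_iff_disj less_max_iff_disj)
  have gC: "g j z \<in> C" if "z \<in> C" for z using C_iff j that by blast
  have "\<exists>z'\<in>C. z = g j z'" if "z \<in> C" "min (g j x) (g j y) < z" "z < max (g j x) (g j y)" for z
  proof -
    have "z \<in> {a j..b j}"
      using that(2,3) g_in[OF j C_in[OF x]] g_in[OF j C_in[OF y]] by auto
    then show ?thesis using C_branch_at[OF that(1) j] by blast
  qed
  then show ?thesis
    unfolding nbrs_def using betw gC x y g_eq_iff[OF j C_in[OF x] C_in[OF y]] by metis
qed

section \<open>Scaling and contraction of the composites\<close>

lemma absG: assumes "set w \<subseteq> {..<k}" "x \<in> {c..d}" "y \<in> {c..d}" "x \<noteq> y"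
  shows "\<bar>foldr g w x - foldr g w y\<bar> = exp (logscale g w x y) * \<bar>x - y\<bar>"
proof -
  have "foldr g w x \<noteq> foldr g w y" using G_eq_iff[OF assms(1-3)] assms(4) by simp
  then show ?thesis using assms(4) by (simp add: logscale_def exp_diff)
qed

text \<open>A branch and its affine model agree at \<open>c\<close> and \<open>d\<close>, so these
  points give the exact ratio; \<open>distortion\<close> carries it to every other pair at the cost
  of \<open>\<delta>\<close>.\<close>

lemma logscale_single_cd: assumes "j < k" shows "logscale g [j] c d = ln (rho j)"
proof -
  have "\<bar>g j c - g j d\<bar> = b j - a j" using g_c[OF assms] g_d[OF assms] ab[OF assms] by auto
  then show ?thesis using cd ab[OF assms] by (simp add: logscale_def rho_def ln_div)
qed

lemma logscale_single_near:
  assumes "j < k" "x \<in> {c..d}" "y \<in> {c..d}" "x \<noteq> y"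
  shows "\<bar>logscale g [j] x y - ln (rho j)\<bar> \<le> \<delta>"
  using distortion[of "[j]" x y c d] assms cd logscale_single_cd[OF assms(1)] by simp

lemma g_contraction: assumes "j < k" "x \<in> {c..d}" "y \<in> {c..d}"
  shows "\<bar>g j x - g j y\<bar> \<le> \<theta> * \<bar>x - y\<bar>"
proof (cases "x = y")
  case False
  have "exp (logscale g [j] x y) \<le> exp (ln (rho j) + \<delta>)"
    using logscale_single_near[OF assms False] by simp
  also have "\<dots> = exp \<delta> * rho j" using rho_pos[OF assms(1)] by (simp add: exp_add)
  also have "\<dots> \<le> \<theta>" using \<theta>(3) assms(1) by simp
  finally show ?thesis
    using absG[of "[j]" x y] assms False by (simp add: mult_right_mono)
qed auto

lemma G_contraction: "set w \<subseteq> {..<k} \<Longrightarrow> x \<in> {c..d} \<Longrightarrow> y \<in> {c..d} \<Longrightarrow>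
  \<bar>foldr g w x - foldr g w y\<bar> \<le> \<theta> ^ length w * \<bar>x - y\<bar>"
proof (induction w)
  case (Cons j w)
  have "\<bar>g j (foldr g w x) - g j (foldr g w y)\<bar> \<le> \<theta> * \<bar>foldr g w x - foldr g w y\<bar>"
    using Cons.prems by (intro g_contraction G_in) auto
  also have "\<dots> \<le> \<theta> * (\<theta> ^ length w * \<bar>x - y\<bar>)"
    using Cons \<theta>(1) by (intro mult_left_mono) auto
  finally show ?case by simp
qed auto

text \<open>Comparison with the model loses \<open>\<delta>\<close> per letter, whereas
  \<open>distortion\<close> compares two pairs under the same word with a loss independent of its
  length. This estimate is therefore meant for short words, and long prefixes are left to
  \<open>distortion\<close>.\<close>

lemma logscale_near:
  assumes "set s \<subseteq> {..<k}" "x \<in> {c..d}" "y \<in> {c..d}" "x \<noteq> y"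
  shows "\<bar>logscale g s x y - ln (rhow s)\<bar> \<le> length s * \<delta>"
  using assms(1)
proof (induction s)
  case Nil
  then show ?case by (simp add: logscale_def)
next
  case (Cons j s)
  then have j: "j < k" and s: "set s \<subseteq> {..<k}" by auto
  have "logscale g (j # s) x y = logscale g s x y + logscale g [j] (foldr g s x) (foldr g s y)"
    using logscale_append[of g "[j]" s x y] by simp
  moreover have "\<bar>logscale g [j] (foldr g s x) (foldr g s y) - ln (rho j)\<bar> \<le> \<delta>"
    using j s assms G_eq_iff[OF s assms(2,3)] by (intro logscale_single_near G_in) auto
  moreover have "ln (rhow (j # s)) = ln (rho j) + ln (rhow s)"
    using rho_pos[OF j] rhow_pos[OF s] by (simp add: ln_mult)
  ultimately show ?case using Cons.IH[OF s] by (simp add: algebra_simps)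
qed

text \<open>Every gap of \<open>C\<close> is the image under a unique composite \<open>w\<close> of a primary gap, that is, one
  between neighbouring intervals \<open>I\<^sub>i\<close> and \<open>I\<^sub>j\<close>. Since branches may reverse the orientation, gaps
  are unordered pairs of neighbours.\<close>
definition coded :: "nat list \<Rightarrow> nat \<Rightarrow> nat \<Rightarrow> real \<Rightarrow> real \<Rightarrow> bool" where
  "coded w i j x y \<longleftrightarrow> set w \<subseteq> {..<k} \<and> i < k \<and> j < k \<and> i \<noteq> j \<and>
    (\<exists>x0 y0. nbrs C x0 y0 \<and> x0 \<in> {a i..b i} \<and> y0 \<in> {a j..b j} \<and> x = foldr g w x0 \<and> y = foldr g w y0)"

lemma coded_sym: "coded w i j x y \<Longrightarrow> coded w j i y x"
  unfolding coded_def using nbrs_sym by metis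

lemma coded_append: "set w \<subseteq> {..<k} \<Longrightarrow> coded s i j x y \<Longrightarrow> coded (w @ s) i j (foldr g w x) (foldr g w y)"
  unfolding coded_def by auto

lemma nbrs_G: "set w \<subseteq> {..<k} \<Longrightarrow> x \<in> C \<Longrightarrow> y \<in> C \<Longrightarrow> nbrs C (foldr g w x) (foldr g w y) \<longleftrightarrow> nbrs C x y"
  by (induction w) (use nbrs_g G_C in auto)

lemma coded_nbrs: "coded w i j x y \<Longrightarrow> nbrs C x y"
  unfolding coded_def using nbrs_G by (metis nbrs_def)

lemma coded_C: "coded w i j x y \<Longrightarrow> x \<in> C \<and> y \<in> C \<and> x \<noteq> y"
  using coded_nbrs nbrs_def by metis

text \<open>The ends of a primary gap lie in different intervals, those of a deeper gap in the
  interval of the first letter. So that letter, or its absence, can be read off from the pair, and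
  removing it by injectivity of the branch leaves a shorter word.\<close>

lemma coded_unique: "coded w i j x y \<Longrightarrow> coded w' i' j' x y \<Longrightarrow> w = w' \<and> i = i' \<and> j = j'"
proof (induction w arbitrary: w' x y)
  case Nil
  then have x: "x \<in> {a i..b i}" "y \<in> {a j..b j}" "i < k" "j < k" "i \<noteq> j" by (auto simp: coded_def)
  show ?case
  proof (cases w')
    case Nil
    then show ?thesis using Nil.prems x index_unique unfolding coded_def by auto
  next
    case (Cons m v)
    then have "m < k" "x \<in> {a m..b m}" "y \<in> {a m..b m}"
      using Nil.prems(2) g_in G_in C_in unfolding coded_def nbrs_def by auto
    then show ?thesis using x index_unique by metis
  qed
next
  case (Cons m v)
  obtain x0 y0 where 0: "nbrs C x0 y0" "x0 \<in> {a i..b i}" "y0 \<in> {a j..b j}"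
    "x = g m (foldr g v x0)" "y = g m (foldr g v y0)"
    and mv: "m < k" "set v \<subseteq> {..<k}" "i < k" "j < k" "i \<noteq> j"
    using Cons.prems(1) by (auto simp: coded_def)
  have 00: "x0 \<in> {c..d}" "y0 \<in> {c..d}" using 0 C_in by (auto simp: nbrs_def)
  then have xm: "x \<in> {a m..b m}" "y \<in> {a m..b m}" using 0 mv g_in G_in by metis+
  obtain m' v' where w': "w' = m' # v'"
    using Cons.prems(2) xm mv(1) index_unique by (cases w') (auto simp: coded_def, metis atLeastAtMost_iff)
  obtain x1 y1 where 1: "nbrs C x1 y1" "x1 \<in> {a i'..b i'}" "y1 \<in> {a j'..b j'}"
    "x = g m' (foldr g v' x1)" "y = g m' (foldr g v' y1)"
    and mv': "m' < k" "set v' \<subseteq> {..<k}" "i' < k" "j' < k" "i' \<noteq> j'"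
    using Cons.prems(2) w' by (auto simp: coded_def)
  have 11: "x1 \<in> {c..d}" "y1 \<in> {c..d}" using 1 C_in by (auto simp: nbrs_def)
  then have xm': "x \<in> {a m'..b m'}" using 1 mv' g_in G_in by metis
  have mm: "m' = m" using index_unique xm xm' mv mv' by metis
  have "foldr g v x0 = foldr g v' x1" "foldr g v y0 = foldr g v' y1"
    using g_eq_iff[OF mv(1)] G_in[OF mv(2)] G_in[OF mv'(2)] 00 11 0 1 mm by metis+
  then have "coded v i j (foldr g v x0) (foldr g v y0)" "coded v' i' j' (foldr g v x0) (foldr g v y0)"
    unfolding coded_def using 0 1 mv mv' by metis+
  then show ?case using Cons.IH mm w' by blast
qed

lemma nbrs_coded: assumes "nbrs C x y" shows "\<exists>w i j. coded w i j x y"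
proof -
  \<comment> \<open>Pulling a gap back by a branch stretches it by at least
    \<open>1 / \<theta>\<close>, and no gap is longer than \<open>d - c\<close>. The exponent
    \<open>n\<close> bounds the number of pull-backs possible before the ends fall into different
    intervals.\<close>
  have step: "nbrs C x y \<Longrightarrow> \<theta> ^ n * (d - c) < \<bar>x - y\<bar> \<Longrightarrow> \<exists>w i j. coded w i j x y" for n x y
  proof (induction n arbitrary: x y)
    case 0
    then have "x \<in> {c..d}" "y \<in> {c..d}" using C_in by (auto simp: nbrs_def)
    then show ?case using 0 by (auto simp: abs_if split: if_splits)
  next
    case (Suc n)
    have xy: "x \<in> C" "y \<in> C" using Suc.prems(1) by (auto simp: nbrs_def)
    obtain i x' where i: "i < k" "x' \<in> C" "x = g i x'" "x \<in> {a i..b i}" using C_branch[OF xy(1)] .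
    obtain j y' where j: "j < k" "y' \<in> C" "y = g j y'" "y \<in> {a j..b j}" using C_branch[OF xy(2)] .
    show ?case
    proof (cases "i = j")
      case True
      have "nbrs C x' y'" using Suc.prems(1) nbrs_g i j True by metis
      moreover have "\<bar>x - y\<bar> \<le> \<theta> * \<bar>x' - y'\<bar>" using g_contraction i j True C_in by metis
      then have "\<theta> * (\<theta> ^ n * (d - c)) < \<theta> * \<bar>x' - y'\<bar>" using Suc.prems(2) by (simp add: mult.assoc)
      then have "\<theta> ^ n * (d - c) < \<bar>x' - y'\<bar>" using \<theta>(1) by simp
      ultimately obtain w i' j' where "coded w i' j' x' y'" using Suc.IH by blast
      then have "coded ([i] @ w) i' j' (foldr g [i] x') (foldr g [i] y')" using i by (intro coded_append) auto
      then show ?thesis using i j True by auto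
    next
      case False
      then have "coded [] i j x y" unfolding coded_def using i j Suc.prems(1) by auto
      then show ?thesis by blast
    qed
  qed
  have "0 < \<bar>x - y\<bar> / (d - c)" using assms cd by (simp add: nbrs_def)
  then obtain n where "\<theta> ^ n < \<bar>x - y\<bar> / (d - c)"
    using real_arch_pow_inv[of "\<bar>x - y\<bar> / (d - c)" \<theta>] \<theta> by blast
  then have "\<theta> ^ n * (d - c) < \<bar>x - y\<bar>" using cd by (simp add: field_simps)
  then show ?thesis using step assms by blast
qed

lemma primary_gap_exists: obtains i j x y where "coded [] i j x y"
proof -
  obtain \<gamma> where \<gamma>: "0 < \<gamma>" "\<And>i j x y. i < k \<Longrightarrow> j < k \<Longrightarrow> i \<noteq> j \<Longrightarrow> x \<in> {a i..b i} \<Longrightarrow> y \<in> {a j..b j} \<Longrightarrow> \<gamma> \<le> \<bar>x - y\<bar>"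
    by (rule separation) blast
  obtain l where l: "l < k" "\<And>j. j < k \<Longrightarrow> j \<noteq> l \<Longrightarrow> b l < a j" by (rule lowest) blast
  obtain m where m: "m < k" "m \<noteq> l" using other_index .
  obtain z where z: "z \<in> C" using C_ne by blast
  define X where "X = C \<inter> {..b l}"
  \<comment> \<open>Starting at \<open>b l + \<gamma>\<close> rather than just after
    \<open>b l\<close> keeps \<open>Y\<close> closed, and by separation no point of \<open>C\<close>
    beyond \<open>b l\<close> is lost. So the infimum of \<open>Y\<close> is the right end of the
    gap.\<close>
  define Y where "Y = C \<inter> {b l + \<gamma>..}"
  have Yeq: "z \<in> Y" if zz: "z \<in> C" "b l < z" for z
  proof -
    obtain j where j: "j < k" "z \<in> {a j..b j}" using C_branch[OF zz(1)] by metis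
    then have "j \<noteq> l" using zz by auto
    then have "\<gamma> \<le> \<bar>b l - z\<bar>" using \<gamma>(2)[OF l(1) j(1) _ _ j(2), of "b l"] ab[OF l(1)] by auto
    then show ?thesis unfolding Y_def using zz by auto
  qed
  have "g l z \<in> X" unfolding X_def using C_g[OF l(1) z] g_in[OF l(1) C_in[OF z]] by auto
  moreover have "bdd_above X" unfolding X_def by (auto intro: bdd_aboveI[of _ "b l"])
  moreover have "closed X" unfolding X_def using C_closed by auto
  ultimately have SX: "Sup X \<in> X" "\<And>z. z \<in> X \<Longrightarrow> z \<le> Sup X"
    using closed_contains_Sup[of X] cSup_upper[of _ X] by auto
  have gm: "g m z \<in> C" using C_g[OF m(1) z] .
  have "b l < g m z" using l(2)[OF m] g_in[OF m(1) C_in[OF z]] by auto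
  then have "g m z \<in> Y" using Yeq gm by blast
  moreover have "bdd_below Y" unfolding Y_def by (auto intro: bdd_belowI[of _ "b l + \<gamma>"])
  moreover have "closed Y" unfolding Y_def using C_closed by auto
  ultimately have IY: "Inf Y \<in> Y" "\<And>z. z \<in> Y \<Longrightarrow> Inf Y \<le> z"
    using closed_contains_Inf[of Y] cInf_lower[of _ Y] by auto
  have xy: "Sup X \<in> C" "Inf Y \<in> C" "Sup X \<le> b l" "b l < Inf Y"
    using SX(1) IY(1) \<gamma>(1) by (auto simp: X_def Y_def)
  have "nbrs C (Sup X) (Inf Y)"
    unfolding nbrs_def
  proof (intro conjI ballI notI)
    fix z assume z: "z \<in> C" "min (Sup X) (Inf Y) < z \<and> z < max (Sup X) (Inf Y)"
    have "min (Sup X) (Inf Y) = Sup X" "max (Sup X) (Inf Y) = Inf Y" using xy by auto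
    then show False using z SX(2)[of z] IY(2)[of z] Yeq[of z] by (force simp: X_def)
  qed (use xy in auto)
  moreover obtain i where "i < k" "Sup X \<in> {a i..b i}" using C_branch[OF xy(1)] by metis
  moreover obtain j where j: "j < k" "Inf Y \<in> {a j..b j}" using C_branch[OF xy(2)] by metis
  moreover have "i \<noteq> j"
  proof
    assume ij: "i = j"
    have "i \<noteq> l" using ij j xy by auto
    then show False using l(2)[of i] calculation xy by auto
  qed
  ultimately have "coded [] i j (Sup X) (Inf Y)" unfolding coded_def by auto
  then show ?thesis using that by blast
qed

end

section \<open>Comparison with the affine model\<close>

lemma interval_fixpoint:
  fixes h :: "real \<Rightarrow> real"
  assumes "c \<le> d" "continuous_on {c..d} h" "\<And>x. x \<in> {c..d} \<Longrightarrow> h x \<in> {c..d}"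
  obtains x where "x \<in> {c..d}" "h x = x"
proof -
  have "\<exists>x\<ge>c. x \<le> d \<and> h x - x = 0"
    using assms by (intro IVT2' continuous_intros) auto
  then show ?thesis using that by auto
qed

lemma abs_ln_diff_le:
  fixes A B \<gamma> :: real
  assumes "0 < \<gamma>" "\<gamma> \<le> A" "\<gamma> \<le> B"
  shows "\<bar>ln A - ln B\<bar> \<le> \<bar>A - B\<bar> / \<gamma>"
proof -
  have *: "ln X - ln Y \<le> \<bar>X - Y\<bar> / \<gamma>" if "\<gamma> \<le> X" "\<gamma> \<le> Y" for X Y
  proof -
    have "ln X - ln Y \<le> (X - Y) / Y" using that assms(1) by (intro ln_diff_le) auto
    also have "\<dots> \<le> \<bar>X - Y\<bar> / \<gamma>" using that assms(1) by (intro frac_le) auto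
    finally show ?thesis .
  qed
  show ?thesis using *[of A B] *[of B A] assms by (auto simp: abs_le_iff abs_minus_commute)
qed

context interval_config
begin

definition aff :: "(nat \<Rightarrow> bool) \<Rightarrow> nat \<Rightarrow> real \<Rightarrow> real" where
  "aff \<sigma> j x = (if \<sigma> j then a j + rho j * (x - c) else b j - rho j * (x - c))"

lemma aff_in: assumes "j < k" "x \<in> {c..d}" shows "aff \<sigma> j x \<in> {a j..b j}"
proof -
  have "rho j * (x - c) \<le> rho j * (d - c)" "0 \<le> rho j * (x - c)"
    using assms rho_pos[OF assms(1)] by (auto intro!: mult_left_mono)
  moreover have "rho j * (d - c) = b j - a j" using cd by (simp add: rho_def)
  ultimately show ?thesis by (simp add: aff_def)
qed

lemma aff_diff: assumes "j < k" shows "\<bar>aff \<sigma> j x - aff \<sigma> j y\<bar> = rho j * \<bar>x - y\<bar>"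
proof -
  have "aff \<sigma> j x - aff \<sigma> j y = (if \<sigma> j then rho j * (x - y) else - (rho j * (x - y)))"
    by (simp add: aff_def algebra_simps)
  then show ?thesis using rho_pos[OF assms] by (auto simp: abs_mult)
qed

lemma aff_in_cd: "j < k \<Longrightarrow> x \<in> {c..d} \<Longrightarrow> aff \<sigma> j x \<in> {c..d}"
  using aff_in[of j x \<sigma>] ca[of j] bd[of j] by auto

lemma continuous_aff: "continuous_on S (aff \<sigma> j)"
  unfolding aff_def by (cases "\<sigma> j") (auto intro!: continuous_intros)

text \<open>The least point of the limit set of the model lies in the lowest interval and is the
  image of the least or the greatest point, according to the orientation there; likewise for the
  greatest point. Solving these two equations directly avoids constructing the limit set. An
  orientation-preserving end branch yields a fixed point of its own, two reversing ones a fixed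
  point of their composite.\<close>

lemma affine_hull_exists:
  assumes "l < k" "h < k"
  obtains p q where "p \<in> {c..d}" "q \<in> {c..d}"
    "p = aff \<sigma> l (if \<sigma> l then p else q)" "q = aff \<sigma> h (if \<sigma> h then q else p)"
proof -
  obtain p0 where p0: "p0 \<in> {c..d}" "aff \<sigma> l p0 = p0"
    by (rule interval_fixpoint[of c d "aff \<sigma> l"])
       (use cd assms aff_in_cd continuous_aff in \<open>auto simp del: atLeastAtMost_iff\<close>)
  obtain q0 where q0: "q0 \<in> {c..d}" "aff \<sigma> h q0 = q0"
    by (rule interval_fixpoint[of c d "aff \<sigma> h"])
       (use cd assms aff_in_cd continuous_aff in \<open>auto simp del: atLeastAtMost_iff\<close>)
  have "continuous_on {c..d} (\<lambda>x. aff \<sigma> l (aff \<sigma> h x))"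
    by (rule continuous_on_compose2[OF continuous_aff[of UNIV] continuous_aff]) auto
  then obtain r0 where r0: "r0 \<in> {c..d}" "aff \<sigma> l (aff \<sigma> h r0) = r0"
    by (rule interval_fixpoint[of c d "\<lambda>x. aff \<sigma> l (aff \<sigma> h x)", rotated 1])
       (use cd assms aff_in_cd in \<open>auto simp del: atLeastAtMost_iff\<close>)
  show ?thesis
  proof (cases "\<sigma> l"; cases "\<sigma> h")
    assume "\<sigma> l" "\<sigma> h"
    then show ?thesis using that[of p0 q0] p0 q0 by simp
  next
    assume "\<sigma> l" "\<not> \<sigma> h"
    then show ?thesis using that[of p0 "aff \<sigma> h p0"] p0 assms aff_in_cd[OF assms(2) p0(1)] by simp
  next
    assume "\<not> \<sigma> l" "\<sigma> h"
    then show ?thesis using that[of "aff \<sigma> l q0" q0] q0 assms aff_in_cd[OF assms(1) q0(1)] by simp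
  next
    assume "\<not> \<sigma> l" "\<not> \<sigma> h"
    then show ?thesis using that[of r0 "aff \<sigma> h r0"] r0 assms aff_in_cd[OF assms(2) r0(1)] by simp
  qed
qed

text \<open>If \<open>[p, q]\<close> is the hull of the limit set of the affine model, \<open>prim_lo\<close> and \<open>prim_hi\<close> are
  the ends of the hull of its part in \<open>I\<^sub>j\<close>, and \<open>prim_len\<close> is the length of the gap between
  \<open>I\<^sub>i\<close> and \<open>I\<^sub>j\<close>.\<close>
definition prim_lo :: "(nat \<Rightarrow> bool) \<Rightarrow> real \<Rightarrow> real \<Rightarrow> nat \<Rightarrow> real" where
  "prim_lo \<sigma> p q j = aff \<sigma> j (if \<sigma> j then p else q)"

definition prim_hi :: "(nat \<Rightarrow> bool) \<Rightarrow> real \<Rightarrow> real \<Rightarrow> nat \<Rightarrow> real" where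
  "prim_hi \<sigma> p q j = aff \<sigma> j (if \<sigma> j then q else p)"

definition prim_len :: "(nat \<Rightarrow> bool) \<Rightarrow> real \<Rightarrow> real \<Rightarrow> nat \<Rightarrow> nat \<Rightarrow> real" where
  "prim_len \<sigma> p q i j =
    (if b i < a j then prim_lo \<sigma> p q j - prim_hi \<sigma> p q i else prim_lo \<sigma> p q i - prim_hi \<sigma> p q j)"

lemma prim_in:
  assumes "j < k" "p \<in> {c..d}" "q \<in> {c..d}"
  shows "prim_lo \<sigma> p q j \<in> {a j..b j}" "prim_hi \<sigma> p q j \<in> {a j..b j}"
  unfolding prim_lo_def prim_hi_def using aff_in[OF assms(1)] assms by auto

lemma prim_len_sym: "i < k \<Longrightarrow> j < k \<Longrightarrow> i \<noteq> j \<Longrightarrow> prim_len \<sigma> p q i j = prim_len \<sigma> p q j i"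
  using disj[of i j] ab[of i] ab[of j] by (auto simp: prim_len_def)

lemma prim_len_pos:
  assumes "i < k" "j < k" "i \<noteq> j" "p \<in> {c..d}" "q \<in> {c..d}"
  shows "0 < prim_len \<sigma> p q i j"
  using disj[OF assms(1-3)] prim_in[OF assms(1,4,5), of \<sigma>] prim_in[OF assms(2,4,5), of \<sigma>]
  by (auto simp: prim_len_def)

end

section \<open>Primary gaps of the Cantor set compared with those of the model\<close>

context ifs
begin

lemma compact_C: "compact C"
  using C_closed C_sub by (meson bounded_closed_interval bounded_subset compact_eq_bounded_closed)

lemma Inf_C: "Inf C \<in> C" "x \<in> C \<Longrightarrow> Inf C \<le> x"
  using closed_contains_Inf[of C] cInf_lower[of x C] C_ne C_closed compact_C
  by (auto simp: compact_imp_bounded bounded_imp_bdd_below)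

lemma Sup_C: "Sup C \<in> C" "x \<in> C \<Longrightarrow> x \<le> Sup C"
  using closed_contains_Sup[of C] cSup_upper[of x C] C_ne C_closed compact_C
  by (auto simp: compact_imp_bounded bounded_imp_bdd_above)

lemma cylinder_min: assumes "j < k" "x \<in> C"
  shows "g j (if \<sigma> j then Inf C else Sup C) \<le> g j x"
  using g_le_iff[OF assms(1) C_in C_in[OF assms(2)]] Inf_C Sup_C assms by auto

lemma cylinder_max: assumes "j < k" "x \<in> C"
  shows "g j x \<le> g j (if \<sigma> j then Sup C else Inf C)"
  using g_le_iff[OF assms(1) C_in[OF assms(2)] C_in] Inf_C Sup_C assms by auto

text \<open>The same equation as the one defining \<open>p\<close> in the model, with
  \<open>g\<close> in place of \<open>aff\<close>; subtracting the two bounds the distance between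
  the hulls.\<close>

lemma hull_lo: assumes l: "l < k" "\<And>j. j < k \<Longrightarrow> j \<noteq> l \<Longrightarrow> b l < a j"
  shows "Inf C = g l (if \<sigma> l then Inf C else Sup C)" (is "_ = g l ?z")
proof -
  have z: "?z \<in> C" using Inf_C Sup_C by auto
  obtain j x where j: "j < k" "x \<in> C" "Inf C = g j x" "Inf C \<in> {a j..b j}"
    using C_branch[OF Inf_C(1)] .
  have le: "Inf C \<le> g l ?z" using Inf_C(2) C_g[OF l(1) z] by blast
  have "j = l"
    using l(2)[OF j(1)] le j(4) g_in[OF l(1) C_in[OF z]] by fastforce
  then show ?thesis using le cylinder_min[OF l(1) j(2)] j(3) by simp
qed

lemma hull_hi: assumes l: "l < k" "\<And>j. j < k \<Longrightarrow> j \<noteq> l \<Longrightarrow> b j < a l"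
  shows "Sup C = g l (if \<sigma> l then Sup C else Inf C)" (is "_ = g l ?z")
proof -
  have z: "?z \<in> C" using Inf_C Sup_C by auto
  obtain j x where j: "j < k" "x \<in> C" "Sup C = g j x" "Sup C \<in> {a j..b j}"
    using C_branch[OF Sup_C(1)] .
  have le: "g l ?z \<le> Sup C" using Sup_C(2) C_g[OF l(1) z] by blast
  have "j = l"
    using l(2)[OF j(1)] le j(4) g_in[OF l(1) C_in[OF z]] by fastforce
  then show ?thesis using le cylinder_max[OF l(1) j(2)] j(3) by simp
qed

lemma primary_ends:
  assumes "coded [] i j x y" "b i < a j"
  shows "x = g i (if \<sigma> i then Sup C else Inf C)" (is "_ = g i ?s")
    and "y = g j (if \<sigma> j then Inf C else Sup C)" (is "_ = g j ?t")
proof -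
  have h: "i < k" "j < k" "nbrs C x y" "x \<in> {a i..b i}" "y \<in> {a j..b j}"
    using assms(1) by (auto simp: coded_def)
  then have xy: "x \<in> C" "y \<in> C" "x < y" using assms(2) by (auto simp: nbrs_def)
  have no: "\<not> (x < z \<and> z < y)" if "z \<in> C" for z
    using h(3) that xy by (auto simp: nbrs_def)
  obtain x' where x': "x' \<in> C" "x = g i x'" using C_branch_at[OF xy(1) h(1,4)] .
  obtain y' where y': "y' \<in> C" "y = g j y'" using C_branch_at[OF xy(2) h(2,5)] .
  have st: "?s \<in> C" "?t \<in> C" using Inf_C Sup_C by auto
  show "x = g i ?s"
    using cylinder_max[OF h(1) x'(1)] x'(2) no[OF C_g[OF h(1) st(1)]] h(5) assms(2)
      g_in[OF h(1) C_in[OF st(1)]] by force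
  show "y = g j ?t"
    using cylinder_min[OF h(2) y'(1)] y'(2) no[OF C_g[OF h(2) st(2)]] h(4) assms(2)
      g_in[OF h(2) C_in[OF st(2)]] by force
qed

text \<open>Both maps send \<open>c\<close> to the same end of the interval. The distances
  \<open>t\<close> and \<open>t'\<close> from that end agree up to a factor
  \<open>exp \<delta>\<close> and are at most \<open>d - c\<close>.\<close>

lemma g_near_aff:
  assumes j: "j < k" and x: "x \<in> {c..d}"
  shows "\<bar>g j x - aff \<sigma> j x\<bar> \<le> (exp \<delta> - 1) * (d - c)"
proof (cases "x = c")
  case True
  then have "g j x = aff \<sigma> j x" using g_c[OF j] by (simp add: aff_def)
  then show ?thesis using \<delta>_pos cd by simp
next
  case False
  have cc: "c \<in> {c..d}" using cd by auto
  define t where "t = \<bar>g j x - g j c\<bar>"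
  define t' where "t' = rho j * (x - c)"
  have xc: "0 < x - c" using False x by auto
  have t_eq: "t = exp (logscale g [j] x c) * (x - c)"
    using absG[of "[j]" x c] j x cc False xc by (simp add: t_def)
  have t'_eq: "t' = exp (ln (rho j)) * (x - c)" using rho_pos[OF j] by (simp add: t'_def)
  have ls: "\<bar>logscale g [j] x c - ln (rho j)\<bar> \<le> \<delta>" by (rule logscale_single_near[OF j x cc False])
  have "exp (logscale g [j] x c) \<le> exp \<delta> * exp (ln (rho j))"
    unfolding exp_add[symmetric] using ls by simp
  then have 1: "t \<le> exp \<delta> * t'" unfolding t_eq t'_eq using xc by (simp add: mult_right_mono)
  have "exp (ln (rho j)) \<le> exp \<delta> * exp (logscale g [j] x c)"
    unfolding exp_add[symmetric] using ls by simp
  then have "exp (ln (rho j)) * (x - c) \<le> (exp \<delta> * exp (logscale g [j] x c)) * (x - c)"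
    using xc by (intro mult_right_mono) auto
  then have 2: "t' \<le> exp \<delta> * t" unfolding t_eq t'_eq by (simp only: mult.assoc)
  have td: "t \<le> d - c" unfolding t_def
    using g_in[OF j x] g_in[OF j cc] ca[OF j] bd[OF j] by auto
  have "t' \<le> 1 * (d - c)" unfolding t'_def
    using rho_less_1[OF j] x xc by (intro mult_mono) auto
  then have t'd: "t' \<le> d - c" by simp
  have e: "0 \<le> exp \<delta> - 1" using \<delta>_pos by simp
  have "t - t' \<le> (exp \<delta> - 1) * t'" "t' - t \<le> (exp \<delta> - 1) * t"
    using 1 2 by (simp_all add: algebra_simps)
  moreover have "(exp \<delta> - 1) * t' \<le> (exp \<delta> - 1) * (d - c)" "(exp \<delta> - 1) * t \<le> (exp \<delta> - 1) * (d - c)"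
    using td t'd e by (auto intro: mult_left_mono)
  ultimately have tt: "\<bar>t - t'\<bar> \<le> (exp \<delta> - 1) * (d - c)" by linarith
  show ?thesis
  proof (cases "\<sigma> j")
    case True
    then have "g j x = a j + t" using g_c[OF j] g_in[OF j x] by (simp add: t_def)
    then show ?thesis using tt True by (simp add: aff_def t'_def)
  next
    case False
    then have "g j x = b j - t" using g_c[OF j] g_in[OF j x] by (simp add: t_def)
    then show ?thesis using tt False by (simp add: aff_def t'_def abs_minus_commute)
  qed
qed

lemma primary_gap_length:
  assumes l: "l < k" "\<And>j. j < k \<Longrightarrow> j \<noteq> l \<Longrightarrow> b l < a j"
    and h: "h < k" "\<And>j. j < k \<Longrightarrow> j \<noteq> h \<Longrightarrow> b j < a h"
    and pq: "p \<in> {c..d}" "q \<in> {c..d}"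
      "p = aff \<sigma> l (if \<sigma> l then p else q)" "q = aff \<sigma> h (if \<sigma> h then q else p)"
    and s: "s < 1" "\<And>j. j < k \<Longrightarrow> rho j \<le> s"
    and cod: "coded [] i j x y"
  shows "\<bar>\<bar>x - y\<bar> - prim_len \<sigma> p q i j\<bar> \<le> 2 * ((exp \<delta> - 1) * (d - c)) / (1 - s)"
proof -
  define e where "e = (exp \<delta> - 1) * (d - c)"
  define m where "m = max \<bar>Inf C - p\<bar> \<bar>Sup C - q\<bar>"
  have near: "\<bar>g j X - aff \<sigma> j Y\<bar> \<le> e + s * m" if "j < k" "X \<in> C" "\<bar>X - Y\<bar> \<le> m" for j X Y
  proof -
    have "\<bar>g j X - aff \<sigma> j X\<bar> \<le> e" unfolding e_def using g_near_aff that C_in by blast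
    moreover have "\<bar>aff \<sigma> j X - aff \<sigma> j Y\<bar> \<le> s * m"
      unfolding aff_diff[OF that(1)] using that rho_pos[OF that(1)] s(2)[OF that(1)]
      by (intro mult_mono) auto
    ultimately show ?thesis by linarith
  qed
  have *: "\<bar>(if P then Inf C else Sup C) - (if P then p else q)\<bar> \<le> m"
    "\<bar>(if P then Sup C else Inf C) - (if P then q else p)\<bar> \<le> m" for P by (auto simp: m_def)
  have inC: "(if P then Inf C else Sup C) \<in> C" "(if P then Sup C else Inf C) \<in> C" for P
    using Inf_C Sup_C by auto
  have "\<bar>Inf C - p\<bar> \<le> e + s * m"
    using near[OF l(1) inC(1) *(1), of "\<sigma> l"] hull_lo[OF l] pq(3) by simp
  moreover have "\<bar>Sup C - q\<bar> \<le> e + s * m"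
    using near[OF h(1) inC(2) *(2), of "\<sigma> h"] hull_hi[OF h] pq(4) by simp
  \<comment> \<open>The hull error reproduces itself: passing it through a branch shrinks it by
    \<open>s < 1\<close> and adds \<open>e\<close>. Hence the error \<open>e + s * m\<close> of
    every cylinder end is at most \<open>e / (1 - s)\<close>, and the two ends of a gap double
    it.\<close>
  ultimately have "m \<le> e + s * m" by (simp add: m_def)
  then have "(1 - s) * (e + s * m) \<le> e"
  proof -
    have "0 \<le> s" using s(2)[OF l(1)] rho_pos[OF l(1)] by linarith
    then have "s * (m * (1 - s)) \<le> s * e" using \<open>m \<le> e + s * m\<close>
      by (intro mult_left_mono) (auto simp: algebra_simps)
    then show ?thesis by (simp add: algebra_simps)
  qed
  then have em: "e + s * m \<le> e / (1 - s)" using s(1) by (simp add: field_simps)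
  have main: "\<bar>\<bar>x - y\<bar> - prim_len \<sigma> p q i j\<bar> \<le> 2 * e / (1 - s)"
    if "coded [] i j x y" "b i < a j" for i j x y
  proof -
    have ij: "i < k" "j < k" "x \<in> {a i..b i}" "y \<in> {a j..b j}" using that(1) by (auto simp: coded_def)
    have "\<bar>x - prim_hi \<sigma> p q i\<bar> \<le> e + s * m"
      using near[OF ij(1) inC(2) *(2), of "\<sigma> i"] primary_ends(1)[OF that] by (simp add: prim_hi_def)
    moreover have "\<bar>y - prim_lo \<sigma> p q j\<bar> \<le> e + s * m"
      using near[OF ij(2) inC(1) *(1), of "\<sigma> j"] primary_ends(2)[OF that] by (simp add: prim_lo_def)
    moreover have "\<bar>x - y\<bar> = y - x" using ij that(2) by auto
    ultimately show ?thesis using em that(2) by (simp add: prim_len_def)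
  qed
  have ij: "i < k" "j < k" "i \<noteq> j" using cod by (auto simp: coded_def)
  show ?thesis
  proof (cases "b i < a j")
    case True
    then show ?thesis using main[OF cod] by (simp add: e_def)
  next
    case False
    then have "b j < a i" using disj[OF ij] by simp
    then show ?thesis using main[OF coded_sym[OF cod]] prim_len_sym[OF ij, of \<sigma> p q]
      by (simp add: e_def abs_minus_commute)
  qed
qed

end

section \<open>Rigidity of length ratios\<close>

lemma finite_separated:
  fixes Q :: "real set"
  assumes "finite Q"
  obtains \<kappa> where "0 < \<kappa>" "\<And>x y. x \<in> Q \<Longrightarrow> y \<in> Q \<Longrightarrow> \<bar>x - y\<bar> < \<kappa> \<Longrightarrow> x = y"
proof -
  define D where "D = (\<lambda>(x,y). \<bar>x - y\<bar>) ` {(x,y) \<in> Q \<times> Q. x \<noteq> y}"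
  have "finite {(x,y) \<in> Q \<times> Q. x \<noteq> y}" using assms
    by (rule_tac finite_subset[of _ "Q \<times> Q"]) auto
  then have fin: "finite D" unfolding D_def by blast
  have pos: "0 < z" if "z \<in> D" for z using that by (auto simp: D_def)
  have "0 < Min (insert 1 D)" using fin pos by (subst Min_gr_iff) auto
  moreover have "x = y" if "x \<in> Q" "y \<in> Q" "\<bar>x - y\<bar> < Min (insert 1 D)" for x y
  proof (rule ccontr)
    assume "x \<noteq> y"
    then have "\<bar>x - y\<bar> \<in> D" using that by (force simp: D_def)
    then have "Min (insert 1 D) \<le> \<bar>x - y\<bar>" using fin by simp
    then show False using that by simp
  qed
  ultimately show ?thesis using that by blast
qed

text \<open>Here \<open>v\<close> and \<open>w\<close> stand for the logarithmic scales of two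
  enclosing cylinders and \<open>m\<close> for the logarithm of a derivative. None of them is known,
  but each occurs in both members of a pair and cancels.\<close>

lemma abs_diff_combine:
  fixes e \<eta> :: real
  assumes "\<bar>a1 - A1 - v\<bar> \<le> e" "\<bar>a2 - A2 - v\<bar> \<le> e" "\<bar>b1 - B1 - w\<bar> \<le> e" "\<bar>b2 - B2 - w\<bar> \<le> e"
    "\<bar>a1 - b1 - m\<bar> \<le> \<eta>" "\<bar>a2 - b2 - m\<bar> \<le> \<eta>"
  shows "\<bar>(A1 - A2) - (B1 - B2)\<bar> \<le> 4 * e + 2 * \<eta>"
  using assms unfolding abs_le_iff by auto

context ifs
begin

text \<open>The error consists of \<open>\<delta>1\<close> for the primary gap, one
  \<open>\<delta>\<close> for each letter of \<open>s\<close>, and one more \<open>\<delta>\<close>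
  for the prefix \<open>w\<close>, whose length does not matter because it is only compared with its
  own scaling on \<open>c, d\<close>.\<close>

lemma coded_log_length:
  assumes prim: "\<And>i j x y. coded [] i j x y \<Longrightarrow> \<bar>ln \<bar>x - y\<bar> - ln (u i j)\<bar> \<le> \<delta>1"
    and upos: "\<And>i j. i < k \<Longrightarrow> j < k \<Longrightarrow> i \<noteq> j \<Longrightarrow> 0 < u i j"
    and cod: "coded (w @ s) i j x y"
  shows "\<bar>ln \<bar>x - y\<bar> - ln (rhow s * u i j) - logscale g w c d\<bar> \<le> (real (length s) + 1) * \<delta> + \<delta>1"
proof -
  obtain x0 y0 where 0: "nbrs C x0 y0" "x0 \<in> {a i..b i}" "y0 \<in> {a j..b j}"
     "x = foldr g (w @ s) x0" "y = foldr g (w @ s) y0"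
    and ij: "i < k" "j < k" "i \<noteq> j" and ws: "set w \<subseteq> {..<k}" "set s \<subseteq> {..<k}"
    using cod by (auto simp: coded_def)
  have 1: "x0 \<in> {c..d}" "y0 \<in> {c..d}" "x0 \<noteq> y0" using 0(1) C_in by (auto simp: nbrs_def)
  have 2: "foldr g s x0 \<in> {c..d}" "foldr g s y0 \<in> {c..d}" "foldr g s x0 \<noteq> foldr g s y0"
    using G_in[OF ws(2)] G_eq_iff[OF ws(2)] 1 by auto
  have "coded [] i j x0 y0" unfolding coded_def using ij 0 by auto
  then have a: "\<bar>ln \<bar>x0 - y0\<bar> - ln (u i j)\<bar> \<le> \<delta>1" by (rule prim)
  have b: "\<bar>logscale g s x0 y0 - ln (rhow s)\<bar> \<le> length s * \<delta>" by (rule logscale_near[OF ws(2) 1])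
  have c: "\<bar>logscale g w (foldr g s x0) (foldr g s y0) - logscale g w c d\<bar> \<le> \<delta>"
    using 2 cd by (intro distortion[OF ws(1)]) auto
  have e: "ln \<bar>x - y\<bar> = ln \<bar>x0 - y0\<bar> + logscale g s x0 y0 + logscale g w (foldr g s x0) (foldr g s y0)"
    using 0 by (simp add: logscale_def)
  have f: "ln (rhow s * u i j) = ln (rhow s) + ln (u i j)"
    using rhow_pos[OF ws(2)] upos[OF ij] by (simp add: ln_mult)
  show ?thesis using a b c unfolding e f by (simp add: algebra_simps abs_le_iff)
qed

lemma G_dist_lower:
  assumes "set w \<subseteq> {..<k}" "x \<in> {c..d}" "y \<in> {c..d}" "t \<le> \<bar>x - y\<bar>" "0 < t"
  shows "exp (logscale g w c d - \<delta>) * t \<le> \<bar>foldr g w x - foldr g w y\<bar>"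
proof -
  have ne: "x \<noteq> y" using assms by auto
  have "exp (logscale g w c d - \<delta>) \<le> exp (logscale g w x y)"
    using distortion[of w x y c d] assms cd ne by simp
  then show ?thesis unfolding absG[OF assms(1-3) ne] using assms by (intro mult_mono) auto
qed

lemma G_dist_upper:
  assumes "set w \<subseteq> {..<k}" "x \<in> {c..d}" "y \<in> {c..d}" "\<bar>x - y\<bar> \<le> t"
  shows "\<bar>foldr g w x - foldr g w y\<bar> \<le> exp (logscale g w c d + \<delta>) * t"
proof (cases "x = y")
  case False
  have "exp (logscale g w x y) \<le> exp (logscale g w c d + \<delta>)"
    using distortion[of w x y c d] assms cd False by simp
  then show ?thesis unfolding absG[OF assms(1-3) False] using assms by (intro mult_mono) auto
qed (use assms in auto)

text \<open>Two gaps whose distance and lengths are comparable lie in a common cylinder \<open>w\<close> only boundedly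
  many generations above them, because any two points separated at generation \<open>w\<close> are at a
  distance comparable to the length of that cylinder.\<close>
lemma coded_common_prefix:
  assumes sep: "0 < \<gamma>" "\<And>i j x y. i < k \<Longrightarrow> j < k \<Longrightarrow> i \<noteq> j \<Longrightarrow> x \<in> {a i..b i} \<Longrightarrow> y \<in> {a j..b j} \<Longrightarrow> \<gamma> \<le> \<bar>x - y\<bar>"
    and \<delta>1: "\<delta> \<le> 1"
    and cod: "coded w1 i1 j1 x1 y1" "coded w2 i2 j2 x2 y2"
    and T: "\<bar>x1 - y1\<bar> \<le> T" "\<bar>x2 - y2\<bar> \<le> T" "\<bar>x1 - x2\<bar> \<le> T"
    and K: "0 < K" "T \<le> K * \<bar>x1 - y1\<bar>" "T \<le> K * \<bar>x2 - y2\<bar>"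
    and N: "K * exp 2 * \<theta> ^ N * (d - c) < \<gamma>"
  obtains w s1 s2 where "w1 = w @ s1" "w2 = w @ s2" "length s1 \<le> N" "length s2 \<le> N"
proof -
  obtain w s1 s2 where ws: "w1 = w @ s1" "w2 = w @ s2" "s1 = [] \<or> s2 = [] \<or> hd s1 \<noteq> hd s2"
    using split_common_prefix .
  have sets: "set w \<subseteq> {..<k}" "set s1 \<subseteq> {..<k}" "set s2 \<subseteq> {..<k}"
    using cod ws by (auto simp: coded_def)
  obtain p1 q1 where 1: "p1 \<in> {c..d}" "q1 \<in> {c..d}" "p1 \<in> {a i1..b i1}" "q1 \<in> {a j1..b j1}"
     "x1 = foldr g w (foldr g s1 p1)" "y1 = foldr g w (foldr g s1 q1)" "i1 < k" "j1 < k" "i1 \<noteq> j1"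
    using cod(1) C_in unfolding coded_def nbrs_def ws(1) foldr_append comp_apply by metis
  obtain p2 q2 where 2: "p2 \<in> {c..d}" "q2 \<in> {c..d}" "p2 \<in> {a i2..b i2}" "q2 \<in> {a j2..b j2}"
     "x2 = foldr g w (foldr g s2 p2)" "y2 = foldr g w (foldr g s2 q2)" "i2 < k" "j2 < k" "i2 \<noteq> j2"
    using cod(2) C_in unfolding coded_def nbrs_def ws(2) foldr_append comp_apply by metis
  define E where "E = logscale g w c d"
  \<comment> \<open>At the end of the common prefix two of the points are separated: the ends of one
    gap if its word stops there, otherwise points of the two gaps in different branches. Their
    distance is at least \<open>\<gamma>\<close> before \<open>w\<close> is applied.\<close>
  have low: "exp (E - \<delta>) * \<gamma> \<le> T"
  proof -
    consider "s1 = []" | "s2 = []" | "s1 \<noteq> []" "s2 \<noteq> []" "hd s1 \<noteq> hd s2" using ws(3) by blast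
    then show ?thesis
    proof cases
      case 1
      have "exp (E - \<delta>) * \<gamma> \<le> \<bar>x1 - y1\<bar>"
        unfolding E_def using \<open>x1 = _\<close> \<open>y1 = _\<close> 1 sep \<open>p1 \<in> {c..d}\<close> \<open>q1 \<in> {c..d}\<close>
          sep(2)[OF \<open>i1 < k\<close> \<open>j1 < k\<close> \<open>i1 \<noteq> j1\<close> \<open>p1 \<in> {a i1..b i1}\<close> \<open>q1 \<in> {a j1..b j1}\<close>]
          G_dist_lower[OF sets(1), of p1 q1 \<gamma>] by simp
      then show ?thesis using T by simp
    next
      case 2
      have "exp (E - \<delta>) * \<gamma> \<le> \<bar>x2 - y2\<bar>"
        unfolding E_def using \<open>x2 = _\<close> \<open>y2 = _\<close> 2 sep \<open>p2 \<in> {c..d}\<close> \<open>q2 \<in> {c..d}\<close>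
          sep(2)[OF \<open>i2 < k\<close> \<open>j2 < k\<close> \<open>i2 \<noteq> j2\<close> \<open>p2 \<in> {a i2..b i2}\<close> \<open>q2 \<in> {a j2..b j2}\<close>]
          G_dist_lower[OF sets(1), of p2 q2 \<gamma>] by simp
      then show ?thesis using T by simp
    next
      case 3
      obtain m1 v1 where v1: "s1 = m1 # v1" using 3 by (cases s1) auto
      obtain m2 v2 where v2: "s2 = m2 # v2" using 3 by (cases s2) auto
      have m: "m1 < k" "m2 < k" "m1 \<noteq> m2" using v1 v2 3 sets by auto
      have "foldr g s1 p1 \<in> {a m1..b m1}" "foldr g s2 p2 \<in> {a m2..b m2}"
        using v1 v2 g_in G_in sets 1 2 by auto
      then have "\<gamma> \<le> \<bar>foldr g s1 p1 - foldr g s2 p2\<bar>" using sep(2) m by blast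
      then have "exp (E - \<delta>) * \<gamma> \<le> \<bar>x1 - x2\<bar>"
        unfolding E_def using \<open>x1 = _\<close> \<open>x2 = _\<close> sep G_in sets \<open>p1 \<in> {c..d}\<close> \<open>p2 \<in> {c..d}\<close>
        by (simp add: G_dist_lower)
      then show ?thesis using T by simp
    qed
  qed
  \<comment> \<open>Each letter beyond \<open>w\<close> contracts by \<open>\<theta>\<close>, so a
    longer word would make its gap too small to be comparable with \<open>T\<close>, which
    \<open>low\<close> bounds from below by the scale of \<open>w\<close>.\<close>
  have short: "length s \<le> N"
    if s: "set s \<subseteq> {..<k}" and pq: "p \<in> {c..d}" "q \<in> {c..d}"
      and TK: "T \<le> K * \<bar>foldr g w (foldr g s p) - foldr g w (foldr g s q)\<bar>" for s p q
  proof (rule ccontr)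
    assume n: "\<not> length s \<le> N"
    have "\<bar>foldr g s p - foldr g s q\<bar> \<le> \<theta> ^ length s * \<bar>p - q\<bar>" using G_contraction s pq by blast
    also have "\<dots> \<le> \<theta> ^ N * (d - c)"
      using n \<theta> pq by (intro mult_mono power_decreasing) auto
    finally have "\<bar>foldr g w (foldr g s p) - foldr g w (foldr g s q)\<bar> \<le> exp (E + \<delta>) * (\<theta> ^ N * (d - c))"
      unfolding E_def using G_in s pq sets by (intro G_dist_upper) auto
    then have "T \<le> K * (exp (E + \<delta>) * (\<theta> ^ N * (d - c)))"
      using TK K(1) by (meson mult_left_mono less_imp_le order_trans)
    with low have "exp (E - \<delta>) * \<gamma> \<le> K * (exp (E + \<delta>) * (\<theta> ^ N * (d - c)))" by linarith
    also have "exp (E + \<delta>) = exp (E - \<delta>) * exp (2 * \<delta>)" by (simp flip: exp_add)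
    also have "K * (exp (E - \<delta>) * exp (2 * \<delta>) * (\<theta> ^ N * (d - c))) = exp (E - \<delta>) * (K * exp (2 * \<delta>) * \<theta> ^ N * (d - c))"
      by (simp add: algebra_simps)
    finally have "\<gamma> \<le> K * exp (2 * \<delta>) * \<theta> ^ N * (d - c)" by simp
    also have "\<dots> \<le> K * exp 2 * \<theta> ^ N * (d - c)"
      using \<delta>1 K(1) \<theta> cd by (intro mult_right_mono mult_left_mono) auto
    finally show False using N by simp
  qed
  have "length s1 \<le> N" using short[OF sets(2) 1(1,2)] K 1 by simp
  moreover have "length s2 \<le> N" using short[OF sets(3) 2(1,2)] K 2 by simp
  ultimately show ?thesis using that ws by blast
qed

text \<open>The lower case gaps are a gap and one of its children or siblings, the upper case gaps are
  their images under a map that is nearly affine at this scale. Both ratios of combinatorial lengths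
  lie in the same finite set and are close to each other, hence equal.\<close>
lemma rigid_pair:
  assumes sep: "0 < \<gamma>" "\<And>i j x y. i < k \<Longrightarrow> j < k \<Longrightarrow> i \<noteq> j \<Longrightarrow> x \<in> {a i..b i} \<Longrightarrow> y \<in> {a j..b j} \<Longrightarrow> \<gamma> \<le> \<bar>x - y\<bar>"
    and r: "0 < r" "r \<le> 1" "\<And>j. j < k \<Longrightarrow> r \<le> rho j"
    and \<delta>1: "\<delta> \<le> 1" and \<eta>: "\<eta> \<le> 1"
    and prim: "\<And>i j x y. coded [] i j x y \<Longrightarrow> \<bar>ln \<bar>x - y\<bar> - ln (u i j)\<bar> \<le> \<delta>'"
    and upos: "\<And>i j. i < k \<Longrightarrow> j < k \<Longrightarrow> i \<noteq> j \<Longrightarrow> 0 < u i j"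
    and K: "K = exp 5 * (d - c) / (r * \<gamma>)"
    and N: "K * exp 2 * \<theta> ^ N * (d - c) < \<gamma>" "1 \<le> N"
    and V: "V = {ln (rhow s * u i j) | s i j. set s \<subseteq> {..<k} \<and> length s \<le> N \<and> i < k \<and> j < k}"
    and \<kappa>: "\<And>v1 v2 v3 v4. {v1, v2, v3, v4} \<subseteq> V \<Longrightarrow> \<bar>(v1 - v2) - (v3 - v4)\<bar> < \<kappa> \<Longrightarrow> v1 - v2 = v3 - v4"
    and small: "4 * ((real N + 1) * \<delta> + \<delta>') + 2 * \<eta> < \<kappa>"
    and cod: "coded w i1 j1 x1 y1" "coded (w @ s) i2 j2 x2 y2" "length s \<le> 1"
    and cod': "coded w1 I1 J1 X1 Y1" "coded w2 I2 J2 X2 Y2"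
    and m: "\<bar>ln \<bar>X1 - Y1\<bar> - ln \<bar>x1 - y1\<bar> - m\<bar> \<le> \<eta>" "\<bar>ln \<bar>X2 - Y2\<bar> - ln \<bar>x2 - y2\<bar> - m\<bar> \<le> \<eta>"
      "\<bar>X1 - X2\<bar> \<le> exp (m + \<eta>) * \<bar>x1 - x2\<bar>"
  shows "ln (rhow w1 * u I1 J1) - ln (rhow w * u i1 j1) = ln (rhow w2 * u I2 J2) - ln (rhow (w @ s) * u i2 j2)"
proof -
  define E where "E = logscale g w c d"
  have sets: "set w \<subseteq> {..<k}" "set s \<subseteq> {..<k}" using cod by (auto simp: coded_def)
  obtain p1 q1 where 1: "p1 \<in> {c..d}" "q1 \<in> {c..d}" "p1 \<in> {a i1..b i1}" "q1 \<in> {a j1..b j1}"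
     "x1 = foldr g w p1" "y1 = foldr g w q1" "i1 < k" "j1 < k" "i1 \<noteq> j1"
    using cod(1) C_in unfolding coded_def nbrs_def by metis
  obtain p2 q2 where 2: "p2 \<in> {c..d}" "q2 \<in> {c..d}" "p2 \<in> {a i2..b i2}" "q2 \<in> {a j2..b j2}"
     "x2 = foldr g w (foldr g s p2)" "y2 = foldr g w (foldr g s q2)" "i2 < k" "j2 < k" "i2 \<noteq> j2"
    using cod(2) C_in unfolding coded_def nbrs_def foldr_append comp_apply by metis
  have two: "foldr g s p2 \<in> {c..d}" "foldr g s q2 \<in> {c..d}" using G_in sets 2 by auto
  have g1: "\<gamma> \<le> \<bar>p1 - q1\<bar>" using sep(2)[OF 1(7-9) 1(3,4)] .
  have g2: "\<gamma> \<le> \<bar>p2 - q2\<bar>" using sep(2)[OF 2(7-9) 2(3,4)] .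
  have L1: "exp (E - \<delta>) * \<gamma> \<le> \<bar>x1 - y1\<bar>"
    unfolding E_def using G_dist_lower[OF sets(1) 1(1,2) g1 sep(1)] 1 by simp
  have rs: "r \<le> rhow s"
  proof (cases s)
    case (Cons j v)
    then have "s = [j]" "j < k" using cod(3) sets by auto
    then show ?thesis using r by simp
  qed (use r in auto)
  have ls: "exp (ln r - \<delta>) \<le> exp (logscale g s p2 q2)"
  proof -
    have ne: "p2 \<noteq> q2" using g2 sep by auto
    have "\<bar>logscale g s p2 q2 - ln (rhow s)\<bar> \<le> length s * \<delta>" by (rule logscale_near[OF sets(2) 2(1,2) ne])
    moreover have "length s * \<delta> \<le> 1 * \<delta>" using cod(3) \<delta>_pos by (intro mult_right_mono) auto
    moreover have "ln r \<le> ln (rhow s)" using rs r(1) by simp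
    ultimately show ?thesis by simp
  qed
  have "exp (ln r - \<delta>) * \<gamma> \<le> \<bar>foldr g s p2 - foldr g s q2\<bar>"
    using ls g2 sep(1) absG[OF sets(2) 2(1,2)] by (subst absG[OF sets(2) 2(1,2)]) (auto intro!: mult_mono)
  then have L2: "exp (E - \<delta>) * (exp (ln r - \<delta>) * \<gamma>) \<le> \<bar>x2 - y2\<bar>"
    unfolding E_def 2(5,6) using sep(1) by (intro G_dist_lower[OF sets(1) two]) auto
  \<comment> \<open>Both lower case gaps lie in the image of \<open>[c, d]\<close> under
    \<open>w\<close>, so \<open>t\<close> bounds their lengths and their distance. Multiplied by the
    nearly constant derivative it gives the size \<open>T\<close> for their images.\<close>
  define t where "t = exp (E + \<delta>) * (d - c)"
  have U: "\<bar>x1 - y1\<bar> \<le> t" "\<bar>x2 - y2\<bar> \<le> t" "\<bar>x1 - x2\<bar> \<le> t"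
    unfolding t_def E_def 1(5,6) 2(5,6)
    using 1(1,2) two by (auto intro!: G_dist_upper[OF sets(1)])
  define T where "T = exp (m + \<eta>) * t"
  have ne1: "x1 \<noteq> y1" "X1 \<noteq> Y1" "x2 \<noteq> y2" "X2 \<noteq> Y2" using cod cod' coded_C by blast+
  have up: "\<bar>X - Y\<bar> \<le> exp (m + \<eta>) * \<bar>x - y\<bar>" and lo: "exp (m - \<eta>) * \<bar>x - y\<bar> \<le> \<bar>X - Y\<bar>"
    if "\<bar>ln \<bar>X - Y\<bar> - ln \<bar>x - y\<bar> - m\<bar> \<le> \<eta>" "x \<noteq> y" "X \<noteq> Y" for x y X Y :: real
  proof -
    have "exp (ln \<bar>X - Y\<bar>) \<le> exp (m + \<eta> + ln \<bar>x - y\<bar>)" using that(1) by simp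
    then show "\<bar>X - Y\<bar> \<le> exp (m + \<eta>) * \<bar>x - y\<bar>" using that by (simp add: exp_add)
    have "exp (m - \<eta> + ln \<bar>x - y\<bar>) \<le> exp (ln \<bar>X - Y\<bar>)" using that(1) by simp
    then show "exp (m - \<eta>) * \<bar>x - y\<bar> \<le> \<bar>X - Y\<bar>" using that by (simp add: exp_add)
  qed
  have TT: "exp (m + \<eta>) * z \<le> T" if "z \<le> t" for z unfolding T_def using that by simp
  have T1: "\<bar>X1 - Y1\<bar> \<le> T" "\<bar>X2 - Y2\<bar> \<le> T" "\<bar>X1 - X2\<bar> \<le> T"
    using up[OF m(1) ne1(1,2)] up[OF m(2) ne1(3,4)] m(3) TT[OF U(1)] TT[OF U(2)] TT[OF U(3)] by linarith+
  \<comment> \<open>The quotient of \<open>T\<close> and the lower bound for the image gaps is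
    \<open>exp (2 * \<eta> + 3 * \<delta>) * (d - c) / (r * \<gamma>)\<close>. With
    \<open>\<delta>\<close> and \<open>\<eta>\<close> at most 1 the exponent is at most 5, which is
    the origin of \<open>K\<close>.\<close>
  have Tb: "T \<le> K * Z" if "exp (m - \<eta>) * (exp (E - \<delta>) * (exp (ln r - \<delta>) * \<gamma>)) \<le> Z" for Z
  proof -
    have "T = exp (2 * \<eta> + 3 * \<delta>) * exp (m - \<eta>) * exp (E - \<delta>) * exp (- \<delta>) * (d - c)"
      unfolding T_def t_def by (simp flip: exp_add add: algebra_simps)
    also have "\<dots> \<le> exp 5 * exp (m - \<eta>) * exp (E - \<delta>) * exp (- \<delta>) * (d - c)"
      using cd \<delta>1 \<eta> by (intro mult_right_mono) auto
    also have "\<dots> = K * (exp (m - \<eta>) * (exp (E - \<delta>) * (exp (ln r - \<delta>) * \<gamma>)))"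
      unfolding K exp_diff[of "ln r"] using r(1) sep(1) by (simp add: exp_minus field_simps)
    also have "\<dots> \<le> K * Z" using that K cd r sep(1) by (intro mult_left_mono) auto
    finally show ?thesis .
  qed
  have "exp (m - \<eta>) * (exp (E - \<delta>) * (exp (ln r - \<delta>) * \<gamma>)) \<le> \<bar>X2 - Y2\<bar>"
    using lo[OF m(2) ne1(3,4)] L2 by (meson exp_ge_zero mult_left_mono order_trans)
  then have K2: "T \<le> K * \<bar>X2 - Y2\<bar>" by (rule Tb)
  have "ln r \<le> 0" using r(1,2) by simp
  then have "exp (ln r - \<delta>) \<le> 1" using \<delta>_pos by simp
  then have "exp (ln r - \<delta>) * \<gamma> \<le> 1 * \<gamma>" using sep(1) by (intro mult_right_mono) auto
  then have "exp (E - \<delta>) * (exp (ln r - \<delta>) * \<gamma>) \<le> exp (E - \<delta>) * (1 * \<gamma>)"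
    by (rule mult_left_mono) simp
  then have "exp (E - \<delta>) * (exp (ln r - \<delta>) * \<gamma>) \<le> \<bar>x1 - y1\<bar>" using L1 by linarith
  then have "exp (m - \<eta>) * (exp (E - \<delta>) * (exp (ln r - \<delta>) * \<gamma>)) \<le> \<bar>X1 - Y1\<bar>"
    using lo[OF m(1) ne1(1,2)] by (meson exp_ge_zero mult_left_mono order_trans)
  then have K1: "T \<le> K * \<bar>X1 - Y1\<bar>" by (rule Tb)
  have Kpos: "0 < K" unfolding K using cd r sep(1) by simp
  obtain v s1 s2 where v: "w1 = v @ s1" "w2 = v @ s2" "length s1 \<le> N" "length s2 \<le> N"
    by (rule coded_common_prefix[OF sep \<delta>1 cod' T1 Kpos K1 K2 N(1)])
  have sv: "set s1 \<subseteq> {..<k}" "set s2 \<subseteq> {..<k}" "set v \<subseteq> {..<k}" and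
    IJ: "I1 < k" "J1 < k" "I2 < k" "J2 < k" "I1 \<noteq> J1" "I2 \<noteq> J2"
    using cod' v by (auto simp: coded_def)
  define A1 where "A1 = ln (rhow s1 * u I1 J1)"
  define A2 where "A2 = ln (rhow s2 * u I2 J2)"
  define B1 where "B1 = ln (rhow [] * u i1 j1)"
  define B2 where "B2 = ln (rhow s * u i2 j2)"
  \<comment> \<open>The suffixes have at most \<open>N\<close> letters: \<open>s1\<close> and
    \<open>s2\<close> by the choice of the common prefix, \<open>[]\<close> and \<open>s\<close>
    because \<open>1 \<le> N\<close>. The prefixes \<open>v\<close> and \<open>w\<close> drop out of
    the differences, so only these short words matter.\<close>
  have inV: "{A1, A2, B1, B2} \<subseteq> V"
    unfolding V A1_def A2_def B1_def B2_def using v sv sets IJ 1 2 cod(3) N(2)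
    by (auto simp del: rhow_simps; fastforce simp del: rhow_simps)
  have bound: "(real (length s') + 1) * \<delta> + \<delta>' \<le> (real N + 1) * \<delta> + \<delta>'" if "length s' \<le> N" for s' :: "nat list"
    using that \<delta>_pos by simp
  have "\<bar>ln \<bar>X1 - Y1\<bar> - A1 - logscale g v c d\<bar> \<le> (real N + 1) * \<delta> + \<delta>'"
    unfolding A1_def using coded_log_length[where u = u, OF prim upos cod'(1)[unfolded v(1)]] bound[OF v(3)] by linarith
  moreover have "\<bar>ln \<bar>X2 - Y2\<bar> - A2 - logscale g v c d\<bar> \<le> (real N + 1) * \<delta> + \<delta>'"
    unfolding A2_def using coded_log_length[where u = u, OF prim upos cod'(2)[unfolded v(2)]] bound[OF v(4)] by linarith
  moreover have "\<bar>ln \<bar>x1 - y1\<bar> - B1 - E\<bar> \<le> (real N + 1) * \<delta> + \<delta>'"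
    unfolding B1_def E_def using coded_log_length[where u = u, OF prim upos, of w "[]"] cod(1) bound[of "[]"] by fastforce
  moreover have "\<bar>ln \<bar>x2 - y2\<bar> - B2 - E\<bar> \<le> (real N + 1) * \<delta> + \<delta>'"
    unfolding B2_def E_def using coded_log_length[where u = u, OF prim upos cod(2)] bound[of s] cod(3) N(2) by linarith
  ultimately have "\<bar>(A1 - A2) - (B1 - B2)\<bar> \<le> 4 * ((real N + 1) * \<delta> + \<delta>') + 2 * \<eta>"
    using m(1,2) by (rule abs_diff_combine)
  then have "\<bar>(A1 - A2) - (B1 - B2)\<bar> < \<kappa>" using small by linarith
  then have "A1 - A2 = B1 - B2" by (rule \<kappa>[OF inV])
  moreover have ln_app: "ln (rhow (v @ s) * u i j) = ln (rhow v) + ln (rhow s * u i j)"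
    if "set v \<subseteq> {..<k}" "set s \<subseteq> {..<k}" "i < k" "j < k" "i \<noteq> j" for v s i j
  proof -
    have "ln (rhow v * (rhow s * u i j)) = ln (rhow v) + ln (rhow s * u i j)"
      by (rule ln_mult_pos) (use rhow_pos upos that in auto)
    then show ?thesis by (simp add: mult.assoc)
  qed
  moreover have "ln (rhow w1 * u I1 J1) = ln (rhow v) + A1" "ln (rhow w2 * u I2 J2) = ln (rhow v) + A2"
    unfolding A1_def A2_def v using sv IJ by (intro ln_app; simp)+
  moreover have "ln (rhow (w @ []) * u i1 j1) = ln (rhow w) + B1" "ln (rhow (w @ s) * u i2 j2) = ln (rhow w) + B2"
    unfolding B1_def B2_def using sets 1 2 by (intro ln_app; simp)+
  ultimately show ?thesis unfolding append_Nil2 by linarith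
qed

end

section \<open>Constants that do not depend on the maps\<close>

context interval_config
begin

text \<open>\<open>u\<close>, \<open>\<delta>0\<close> and \<open>\<eta>\<close> are fixed before
  \<open>g\<close>, \<open>C\<close> and \<open>\<delta>\<close> appear. This is possible because
  \<open>V\<close>, and with it \<open>\<kappa>\<close>, is built from the intervals, the
  orientations and \<open>\<theta>\<close> alone.\<close>

lemma rigidity_constants:
  fixes \<sigma> :: "nat \<Rightarrow> bool" and \<theta> :: real
  assumes \<theta>: "0 < \<theta>" "\<theta> < 1"
  obtains u \<delta>0 \<eta> where "0 < \<delta>0" "0 < \<eta>"
    "\<And>i j. i < k \<Longrightarrow> j < k \<Longrightarrow> i \<noteq> j \<Longrightarrow> 0 < u i j"
    "\<And>g C \<delta> w s i1 j1 x1 y1 i2 j2 x2 y2 w1 I1 J1 X1 Y1 w2 I2 J2 X2 Y2 m.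
      ifs k a b c d \<sigma> g C \<delta> \<theta> \<Longrightarrow> \<delta> \<le> \<delta>0 \<Longrightarrow>
      ifs.coded k a b g C w i1 j1 x1 y1 \<Longrightarrow> ifs.coded k a b g C (w @ s) i2 j2 x2 y2 \<Longrightarrow> length s \<le> 1 \<Longrightarrow>
      ifs.coded k a b g C w1 I1 J1 X1 Y1 \<Longrightarrow> ifs.coded k a b g C w2 I2 J2 X2 Y2 \<Longrightarrow>
      \<bar>ln \<bar>X1 - Y1\<bar> - ln \<bar>x1 - y1\<bar> - m\<bar> \<le> \<eta> \<Longrightarrow> \<bar>ln \<bar>X2 - Y2\<bar> - ln \<bar>x2 - y2\<bar> - m\<bar> \<le> \<eta> \<Longrightarrow>
      \<bar>X1 - X2\<bar> \<le> exp (m + \<eta>) * \<bar>x1 - x2\<bar> \<Longrightarrow>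
      ln (rhow w1 * u I1 J1) - ln (rhow w * u i1 j1) = ln (rhow w2 * u I2 J2) - ln (rhow (w @ s) * u i2 j2)"
proof -
  obtain \<gamma> where \<gamma>: "0 < \<gamma>" "\<And>i j x y. i < k \<Longrightarrow> j < k \<Longrightarrow> i \<noteq> j \<Longrightarrow> x \<in> {a i..b i} \<Longrightarrow> y \<in> {a j..b j} \<Longrightarrow> \<gamma> \<le> \<bar>x - y\<bar>"
    by (rule separation) blast
  obtain r t where rt: "0 < r" "t < 1" "0 < t" "\<And>j. j < k \<Longrightarrow> r \<le> rho j" "\<And>j. j < k \<Longrightarrow> rho j \<le> t"
    by (rule rho_bounds) blast
  have r1: "r \<le> 1" using rt(4)[of 0] rho_less_1[of 0] k_ge by auto
  obtain l where l: "l < k" "\<And>j. j < k \<Longrightarrow> j \<noteq> l \<Longrightarrow> b l < a j" by (rule lowest) blast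
  obtain h where h: "h < k" "\<And>j. j < k \<Longrightarrow> j \<noteq> h \<Longrightarrow> b j < a h" by (rule highest) blast
  obtain p q where pq: "p \<in> {c..d}" "q \<in> {c..d}"
    "p = aff \<sigma> l (if \<sigma> l then p else q)" "q = aff \<sigma> h (if \<sigma> h then q else p)"
    by (rule affine_hull_exists[OF l(1) h(1)])
  define u where "u = prim_len \<sigma> p q"
  have upos: "0 < u i j" if "i < k" "j < k" "i \<noteq> j" for i j
    unfolding u_def using prim_len_pos that pq by blast
  have u_ge: "\<gamma> \<le> u i j" if "i < k" "j < k" "i \<noteq> j" for i j
  proof -
    have "u i j = \<bar>prim_lo \<sigma> p q j - prim_hi \<sigma> p q i\<bar> \<or> u i j = \<bar>prim_lo \<sigma> p q i - prim_hi \<sigma> p q j\<bar>"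
      using upos[OF that] by (auto simp: u_def prim_len_def)
    then show ?thesis using \<gamma>(2) prim_in[OF _ pq(1,2)] that by metis
  qed
  define K where "K = exp 5 * (d - c) / (r * \<gamma>)"
  have Kpos: "0 < K * exp 2 * (d - c)" unfolding K_def using cd rt \<gamma>(1) by simp
  obtain N0 where N0: "\<theta> ^ N0 < \<gamma> / (K * exp 2 * (d - c))"
    using real_arch_pow_inv[of "\<gamma> / (K * exp 2 * (d - c))" \<theta>] \<theta> \<gamma>(1) Kpos by auto
  define N where "N = max 1 N0"
  have "\<theta> ^ N \<le> \<theta> ^ N0" using \<theta> by (intro power_decreasing) (auto simp: N_def)
  with N0 have "\<theta> ^ N < \<gamma> / (K * exp 2 * (d - c))" by linarith
  then have N: "K * exp 2 * \<theta> ^ N * (d - c) < \<gamma>" "1 \<le> N"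
    using Kpos by (simp_all add: N_def pos_less_divide_eq algebra_simps)
  define V where "V = {ln (rhow s * u i j) | s i j. set s \<subseteq> {..<k} \<and> length s \<le> N \<and> i < k \<and> j < k}"
  have "V \<subseteq> (\<lambda>(s, i, j). ln (rhow s * u i j)) ` ({s. set s \<subseteq> {..<k} \<and> length s \<le> N} \<times> {..<k} \<times> {..<k})"
  proof
    fix v assume "v \<in> V"
    then obtain s i j where "v = ln (rhow s * u i j)" "set s \<subseteq> {..<k}" "length s \<le> N" "i < k" "j < k"
      unfolding V_def by blast
    then show "v \<in> (\<lambda>(s, i, j). ln (rhow s * u i j)) ` ({s. set s \<subseteq> {..<k} \<and> length s \<le> N} \<times> {..<k} \<times> {..<k})"
      by (intro image_eqI[of _ _ "(s, i, j)"]) auto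
  qed
  moreover have "finite {s. set s \<subseteq> {..<k} \<and> length s \<le> N}" by (rule finite_lists_length_le) simp
  ultimately have finV: "finite V" by (meson finite_SigmaI finite_imageI finite_lessThan finite_subset)
  define Q where "Q = (\<lambda>(v1, v2). v1 - v2) ` (V \<times> V)"
  have "finite Q" unfolding Q_def using finV by simp
  then obtain \<kappa> where \<kappa>: "0 < \<kappa>" "\<And>x y. x \<in> Q \<Longrightarrow> y \<in> Q \<Longrightarrow> \<bar>x - y\<bar> < \<kappa> \<Longrightarrow> x = y"
    by (rule finite_separated) blast
  have \<kappa>': "v1 - v2 = v3 - v4" if "{v1, v2, v3, v4} \<subseteq> V" "\<bar>(v1 - v2) - (v3 - v4)\<bar> < \<kappa>" for v1 v2 v3 v4
  proof (rule \<kappa>(2)[OF _ _ that(2)])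
    show "v1 - v2 \<in> Q" unfolding Q_def using that(1) by (intro image_eqI[of _ _ "(v1, v2)"]) auto
    show "v3 - v4 \<in> Q" unfolding Q_def using that(1) by (intro image_eqI[of _ _ "(v3, v4)"]) auto
  qed
  \<comment> \<open>\<open>dd \<delta>\<close> bounds the logarithmic error of a primary gap and
    tends to 0 with \<open>\<delta>\<close>. Half of \<open>\<kappa>\<close> is spent on
    \<open>\<delta>\<close> and \<open>dd \<delta>\<close>; the other half covers
    \<open>2 * \<eta>\<close>, which explains \<open>\<kappa> / 4\<close>.\<close>
  define dd where "dd = (\<lambda>\<delta>::real. 2 * ((exp \<delta> - 1) * (d - c)) / (1 - t) / \<gamma>)"
  have "isCont (\<lambda>\<delta>::real. 4 * ((real N + 1) * \<delta> + dd \<delta>)) 0"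
    unfolding dd_def using rt \<gamma>(1) by (intro continuous_intros) auto
  then have "((\<lambda>\<delta>::real. 4 * ((real N + 1) * \<delta> + dd \<delta>)) \<longlongrightarrow> 0) (at 0)"
    by (auto dest!: isContD simp: dd_def)
  then have "\<forall>\<^sub>F x::real in at 0. dist (4 * ((real N + 1) * x + dd x)) 0 < \<kappa> / 2"
    using \<kappa>(1) by (intro tendstoD) auto
  then obtain e where e: "0 < e" "\<And>x. x \<noteq> 0 \<Longrightarrow> \<bar>x\<bar> < e \<Longrightarrow> \<bar>4 * ((real N + 1) * x + dd x)\<bar> < \<kappa> / 2"
    unfolding eventually_at by (auto simp: dist_real_def)
  define \<delta>0 where "\<delta>0 = min 1 (e / 2)"
  define \<eta> where "\<eta> = min 1 (\<kappa> / 4)"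
  show ?thesis
  proof (rule that[of \<delta>0 \<eta> u])
    show "0 < \<delta>0" "0 < \<eta>" using e \<kappa> by (auto simp: \<delta>0_def \<eta>_def)
    show "0 < u i j" if "i < k" "j < k" "i \<noteq> j" for i j using upos that .
  next
    fix g C \<delta> w s i1 j1 x1 y1 i2 j2 x2 y2 w1 I1 J1 X1 Y1 w2 I2 J2 X2 Y2 m
    assume ifs: "ifs k a b c d \<sigma> g C \<delta> \<theta>" and \<delta>: "\<delta> \<le> \<delta>0"
    interpret ifs k a b c d \<sigma> g C \<delta> \<theta> by (rule ifs)
    assume cod: "coded w i1 j1 x1 y1" "coded (w @ s) i2 j2 x2 y2" "length s \<le> 1"
      "coded w1 I1 J1 X1 Y1" "coded w2 I2 J2 X2 Y2"
      and m: "\<bar>ln \<bar>X1 - Y1\<bar> - ln \<bar>x1 - y1\<bar> - m\<bar> \<le> \<eta>" "\<bar>ln \<bar>X2 - Y2\<bar> - ln \<bar>x2 - y2\<bar> - m\<bar> \<le> \<eta>"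
      "\<bar>X1 - X2\<bar> \<le> exp (m + \<eta>) * \<bar>x1 - x2\<bar>"
    have prim: "\<bar>ln \<bar>x - y\<bar> - ln (u i j)\<bar> \<le> dd \<delta>" if c0: "coded [] i j x y" for i j x y
    proof -
      have ij: "i < k" "j < k" "i \<noteq> j" "x \<in> {a i..b i}" "y \<in> {a j..b j}" using c0 by (auto simp: coded_def)
      have "\<bar>ln \<bar>x - y\<bar> - ln (u i j)\<bar> \<le> \<bar>\<bar>x - y\<bar> - u i j\<bar> / \<gamma>"
        using \<gamma>(1) \<gamma>(2)[OF ij] u_ge[OF ij(1-3)] by (rule abs_ln_diff_le)
      also have "\<dots> \<le> dd \<delta>" unfolding dd_def u_def
        using primary_gap_length[OF l h pq rt(2,5) c0] \<gamma>(1) by (intro divide_right_mono) auto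
      finally show ?thesis .
    qed
    have "4 * ((real N + 1) * \<delta> + dd \<delta>) < \<kappa> / 2"
    proof -
      have "\<delta> \<noteq> 0" "\<bar>\<delta>\<bar> < e" using \<delta>_pos \<delta> e(1) by (auto simp: \<delta>0_def)
      then show ?thesis using e(2)[of \<delta>] by linarith
    qed
    then have small: "4 * ((real N + 1) * \<delta> + dd \<delta>) + 2 * \<eta> < \<kappa>" by (auto simp: \<eta>_def)
    have d1: "\<delta> \<le> 1" and e1: "\<eta> \<le> 1" using \<delta> by (auto simp: \<delta>0_def \<eta>_def)
    show "ln (rhow w1 * u I1 J1) - ln (rhow w * u i1 j1) = ln (rhow w2 * u I2 J2) - ln (rhow (w @ s) * u i2 j2)"
      by (rule rigid_pair[where u = u and \<delta>' = "dd \<delta>" and \<kappa> = \<kappa>, OF \<gamma> rt(1) r1 rt(4) d1 e1 prim upos K_def N V_def \<kappa>' small cod m])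
  qed
qed

end

section \<open>The Denjoy argument\<close>

definition zpow :: "(real \<Rightarrow> real) \<Rightarrow> int \<Rightarrow> real \<Rightarrow> real" where
  "zpow F t = (if 0 \<le> t then F ^^ nat t else inv F ^^ nat (- t))"

lemma zpow_0 [simp]: "zpow F 0 x = x"
  by (simp add: zpow_def)

lemma zpow_Suc: assumes "bij F" shows "zpow F (t + 1) x = F (zpow F t x)"
proof (cases "0 \<le> t")
  case True
  then have "nat (t + 1) = Suc (nat t)" by simp
  then show ?thesis using True by (simp add: zpow_def)
next
  case False
  then have n: "nat (- t) = Suc (nat (- (t + 1)))" by simp
  have "F (inv F y) = y" for y using assms by (simp add: bij_is_surj surj_f_inv_f)
  then have "F (zpow F t x) = (inv F ^^ nat (- (t + 1))) x" using False n by (simp add: zpow_def)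
  also have "\<dots> = zpow F (t + 1) x" using False by (cases "t + 1 = 0") (auto simp: zpow_def)
  finally show ?thesis ..
qed

lemma zpow_add: assumes "bij F" shows "zpow F (s + t) x = zpow F s (zpow F t x)"
proof (induction s rule: int_induct[where k = 0])
  case (step1 s)
  have "zpow F (s + 1 + t) x = F (zpow F (s + t) x)" using zpow_Suc[OF assms, of "s + t"] by (simp add: algebra_simps)
  then show ?case using step1 zpow_Suc[OF assms] by simp
next
  case (step2 s)
  have "F (zpow F (s - 1 + t) x) = zpow F (s + t) x" using zpow_Suc[OF assms, of "s - 1 + t" x] by (simp add: algebra_simps)
  moreover have "F (zpow F (s - 1) (zpow F t x)) = zpow F s (zpow F t x)"
    using zpow_Suc[OF assms, of "s - 1"] by simp
  ultimately have "F (zpow F (s - 1 + t) x) = F (zpow F (s - 1) (zpow F t x))" using step2 by simp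
  then show ?case using assms by (simp add: bij_is_inj inj_eq)
qed simp

lemma sum_telescope_int:
  fixes h :: "int \<Rightarrow> real"
  shows "(\<Sum>t\<in>{0..<int n}. h (t + s + 1) - h (t + s)) = h (int n + s) - h s"
proof (induction n)
  case (Suc n)
  have "{0..<int (Suc n)} = insert (int n) {0..<int n}" by auto
  then show ?case using Suc by (simp add: algebra_simps)
qed simp

locale circle_homeo =
  fixes F :: "real \<Rightarrow> real"
  assumes bijF: "bij F" and monoF: "strict_mono F" and F_1: "\<And>x. F (x + 1) = F x + 1"
begin

lemmas zadd = zpow_add[OF bijF] and zSuc = zpow_Suc[OF bijF]

lemma F_int: "F (x + of_int n) = F x + of_int n"
proof (induction n arbitrary: x rule: int_induct[where k = 0])
  case (step1 n)
  then show ?case using F_1[of "x + of_int n"] by (simp add: algebra_simps)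
next
  case (step2 n)
  then show ?case using F_1[of "x + of_int (n - 1)"] by (simp add: algebra_simps)
qed simp

lemma zpow_less: "zpow F t x < zpow F t y \<longleftrightarrow> x < y"
proof (induction t rule: int_induct[where k = 0])
  case (step1 t)
  then show ?case using zSuc monoF by (simp add: strict_mono_less)
next
  case (step2 t)
  then show ?case using zSuc[of "t - 1" x] zSuc[of "t - 1" y] monoF strict_mono_less by fastforce
qed simp

lemma zpow_le: "zpow F t x \<le> zpow F t y \<longleftrightarrow> x \<le> y"
  using zpow_less[of t y x] by auto

lemma zpow_int: "zpow F t (x + of_int n) = zpow F t x + of_int n"
proof (induction t rule: int_induct[where k = 0])
  case (step1 t)
  then show ?case using zSuc F_int by simp
next
  case (step2 t)
  have "F (zpow F (t - 1) (x + of_int n)) = F (zpow F (t - 1) x + of_int n)"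
    using zSuc[of "t - 1"] F_int step2 by simp
  then show ?case using bijF by (simp add: bij_is_inj inj_eq)
qed simp

lemma zpow_inv_less: "y < zpow F t x \<longleftrightarrow> zpow F (- t) y < x" "zpow F t x < y \<longleftrightarrow> x < zpow F (- t) y"
  "y \<le> zpow F t x \<longleftrightarrow> zpow F (- t) y \<le> x" "zpow F t x \<le> y \<longleftrightarrow> x \<le> zpow F (- t) y"
  using zpow_less[of "-t"] zpow_le[of "-t"] zadd[of "-t" t x] by (metis add.left_inverse zpow_0)+

text \<open>The arcs \<open>[F\<^sup>t x, F\<^sup>t y)\<close> are disjoint modulo 1 over \<open>q\<close> consecutive times, as otherwise
  some \<open>F\<^sup>s x\<close> with \<open>\<bar>s\<bar> < q\<close> would lie between \<open>x\<close> and \<open>y\<close>.\<close>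
lemma return_arcs_disjoint:
  assumes nonper: "\<And>t n. zpow F t x = x + of_int n \<Longrightarrow> t = 0"
    and ret: "\<And>s n. \<bar>s\<bar> < q \<Longrightarrow> \<not> (x < zpow F s x + of_int n \<and> zpow F s x + of_int n < y)"
    and st: "\<bar>s - t\<bar> < q"
    and z: "zpow F s x \<le> z + of_int n" "z + of_int n < zpow F s y"
    and z': "zpow F t x \<le> z + of_int n'" "z + of_int n' < zpow F t y"
  shows "s = t"
proof -
  have *: "s = t" if "\<bar>s - t\<bar> < q" "zpow F s x + of_int i \<le> zpow F t x" "zpow F t x < zpow F s y + of_int i" for s t i
  proof -
    have e: "zpow F (- s) (zpow F t x - of_int i) = zpow F (t - s) x + of_int (- i)"
      using zpow_int[of "-s" "zpow F t x" "-i"] zadd[of "-s" t x] by simp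
    have "zpow F s x \<le> zpow F t x - of_int i" "zpow F t x - of_int i < zpow F s y" using that by auto
    then have "x \<le> zpow F (t - s) x + of_int (- i)" "zpow F (t - s) x + of_int (- i) < y"
      unfolding zpow_inv_less e by auto
    moreover have "\<bar>t - s\<bar> < q" using that by simp
    ultimately have "x = zpow F (t - s) x + of_int (- i)" using ret[of "t - s" "- i"] by fastforce
    then have "zpow F (t - s) x = x + of_int i" by simp
    then show ?thesis using nonper by fastforce
  qed
  show ?thesis
  proof (cases "zpow F s x + of_int (n' - n) \<le> zpow F t x")
    case True
    then show ?thesis using z z' by (intro *[OF st True]) auto
  next
    case False
    then have "t = s" using z z' st by (intro *[of t s "n - n'"]) auto
    then show ?thesis ..
  qed
qed

text \<open>The value of \<open>\<psi>\<close> can differ at \<open>t - q\<close> and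
  \<open>t\<close> only if one of the two times is exceptional or the arc between the two orbit
  points contains a translate of a point of \<open>Z\<close>. The arcs are disjoint modulo 1, so
  every cut point is used at most once; every exceptional time spoils at most two differences. This
  gives the count \<open>2 * card E + card Z\<close>.\<close>

lemma denjoy_inequality:
  fixes \<psi> :: "int \<Rightarrow> real" and E :: "int set" and Z :: "real set"
  assumes nonper: "\<And>t n. zpow F t x = x + of_int n \<Longrightarrow> t = 0"
    and fin: "finite E" "finite Z"
    and loc: "\<And>s t n. s \<notin> E \<Longrightarrow> t \<notin> E \<Longrightarrow> zpow F s x < zpow F t x + of_int n \<Longrightarrow> \<psi> s \<noteq> \<psi> t \<Longrightarrow>
      \<exists>z\<in>Z. \<exists>m. zpow F s x \<le> z + of_int m \<and> z + of_int m < zpow F t x + of_int n"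
    and B: "\<And>t. \<bar>\<psi> t\<bar> \<le> B"
    and q: "0 < q" "i = q \<or> i = - q" and y: "y = zpow F i x + of_int m" "x < y"
    and ret: "\<And>s n. \<bar>s\<bar> < q \<Longrightarrow> \<not> (x < zpow F s x + of_int n \<and> zpow F s x + of_int n < y)"
  shows "\<bar>\<Sum>t\<in>{0..<q}. \<psi> t - \<psi> (t - q)\<bar> \<le> 2 * B * real (2 * card E + card Z)"
proof -
  \<comment> \<open>\<open>\<tau> t\<close> is the iterate carrying \<open>[x, y)\<close> to the arc
    between the orbit points of times \<open>t\<close> and \<open>t - q\<close>. If \<open>y\<close>
    comes from time \<open>- q\<close>, this is \<open>t\<close>; if it comes from time
    \<open>q\<close>, it is \<open>t - q\<close>.\<close>
  define \<tau> where "\<tau> = (\<lambda>t. if i = - q then t else t - q)"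
  define bad where "bad = {t \<in> {0..<q}. \<psi> t \<noteq> \<psi> (t - q)}"
  define cut where "cut = {t \<in> {0..<q}. \<exists>z\<in>Z. \<exists>m. zpow F (\<tau> t) x \<le> z + of_int m \<and> z + of_int m < zpow F (\<tau> t) y}"
  have sub: "bad \<subseteq> E \<union> (\<lambda>t. t + q) ` E \<union> cut"
  proof
    fix t assume t: "t \<in> bad"
    have \<tau>: "\<tau> t = t \<and> \<tau> t + i = t - q \<or> \<tau> t = t - q \<and> \<tau> t + i = t" using q by (auto simp: \<tau>_def)
    have y': "zpow F (\<tau> t) y = zpow F (\<tau> t + i) x + of_int m" unfolding y zpow_int zadd ..
    have less: "zpow F (\<tau> t) x < zpow F (\<tau> t) y" using y(2) by (simp add: zpow_less)
    have ne: "\<psi> (\<tau> t) \<noteq> \<psi> (\<tau> t + i)" using t \<tau> by (auto simp: bad_def)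
    show "t \<in> E \<union> (\<lambda>t. t + q) ` E \<union> cut"
    proof (cases "\<tau> t \<in> E \<or> \<tau> t + i \<in> E")
      case True
      then have "t \<in> E \<or> t - q \<in> E" using \<tau> by auto
      then show ?thesis by (force simp: image_iff)
    next
      case False
      then have "\<exists>z\<in>Z. \<exists>n. zpow F (\<tau> t) x \<le> z + of_int n \<and> z + of_int n < zpow F (\<tau> t) y"
        using loc[of "\<tau> t" "\<tau> t + i" m] less ne unfolding y' by blast
      then have "t \<in> cut" using t unfolding cut_def bad_def by blast
      then show ?thesis by blast
    qed
  qed
  have cut_card: "card cut \<le> card Z"
  proof -
    have "\<forall>t\<in>cut. \<exists>z\<in>Z. \<exists>m. zpow F (\<tau> t) x \<le> z + of_int m \<and> z + of_int m < zpow F (\<tau> t) y"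
      by (auto simp: cut_def)
    then obtain c where c: "\<And>t. t \<in> cut \<Longrightarrow> c t \<in> Z \<and>
      (\<exists>m. zpow F (\<tau> t) x \<le> c t + of_int m \<and> c t + of_int m < zpow F (\<tau> t) y)" by metis
    have "inj_on c cut"
    proof (rule inj_onI)
      fix s t assume st: "s \<in> cut" "t \<in> cut" "c s = c t"
      obtain n where n: "zpow F (\<tau> s) x \<le> c s + of_int n" "c s + of_int n < zpow F (\<tau> s) y" using c st by blast
      obtain n' where n': "zpow F (\<tau> t) x \<le> c s + of_int n'" "c s + of_int n' < zpow F (\<tau> t) y" using c st by metis
      have "\<bar>\<tau> s - \<tau> t\<bar> < q" using st by (auto simp: \<tau>_def cut_def)
      then have "\<tau> s = \<tau> t"
        by (rule return_arcs_disjoint[of x q y "\<tau> s" "\<tau> t" "c s" n n', rotated 2])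
           (fact n n' nonper ret)+
      then show "s = t" by (auto simp: \<tau>_def split: if_splits)
    qed
    then show ?thesis using c fin by (intro card_inj_on_le[of c]) auto
  qed
  have fincut: "finite cut" by (rule finite_subset[of _ "{0..<q}"]) (auto simp: cut_def)
  have "card bad \<le> card (E \<union> (\<lambda>t. t + q) ` E \<union> cut)" using sub fin fincut by (intro card_mono) auto
  also have "\<dots> \<le> card E + card ((\<lambda>t. t + q) ` E) + card cut"
    by (meson add_mono card_Un_le order_refl order_trans)
  also have "\<dots> \<le> 2 * card E + card Z" using card_image_le[OF fin(1), of "\<lambda>t. t + q"] cut_card by simp
  finally have cb: "card bad \<le> 2 * card E + card Z" .
  have "(\<Sum>t\<in>{0..<q}. \<psi> t - \<psi> (t - q)) = (\<Sum>t\<in>bad. \<psi> t - \<psi> (t - q))"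
    by (rule sum.mono_neutral_right) (auto simp: bad_def)
  also have "\<bar>\<dots>\<bar> \<le> (\<Sum>t\<in>bad. \<bar>\<psi> t - \<psi> (t - q)\<bar>)" by (rule sum_abs)
  also have "\<dots> \<le> (\<Sum>t\<in>bad. 2 * B)"
  proof (rule sum_mono)
    fix t show "\<bar>\<psi> t - \<psi> (t - q)\<bar> \<le> 2 * B" using B[of t] B[of "t - q"] by linarith
  qed
  also have "\<dots> = 2 * B * card bad" by simp
  also have "\<dots> \<le> 2 * B * real (2 * card E + card Z)"
  proof (rule mult_left_mono)
    show "real (card bad) \<le> real (2 * card E + card Z)" using cb by (simp only: of_nat_le_iff)
    show "0 \<le> 2 * B" using B[of 0] by linarith
  qed
  finally show ?thesis .
qed

text \<open>The sum over a return time telescopes to \<open>h q + h (- q) - 2 * h 0\<close>. The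
  inequality keeps it above \<open>- V\<close>, while \<open>decay\<close> pushes both
  \<open>h q\<close> and \<open>h (- q)\<close> below \<open>h 0 - V - 1\<close> once
  \<open>q\<close> is large.\<close>

lemma denjoy_contradiction:
  fixes h :: "int \<Rightarrow> real" and E :: "int set" and Z :: "real set"
  assumes nonper: "\<And>t n. zpow F t x = x + of_int n \<Longrightarrow> t = 0"
    and acc: "\<And>e. 0 < e \<Longrightarrow> \<exists>t n. x < zpow F t x + of_int n \<and> zpow F t x + of_int n < x + e"
    and fin: "finite E" "finite Z"
    and loc: "\<And>s t n. s \<notin> E \<Longrightarrow> t \<notin> E \<Longrightarrow> zpow F s x < zpow F t x + of_int n \<Longrightarrow>
      h (s + 1) - h s \<noteq> h (t + 1) - h t \<Longrightarrow>
      \<exists>z\<in>Z. \<exists>m. zpow F s x \<le> z + of_int m \<and> z + of_int m < zpow F t x + of_int n"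
    and B: "\<And>t. \<bar>h (t + 1) - h t\<bar> \<le> B"
    and decay: "\<And>v. finite {t. v \<le> h t}"
  shows False
proof -
  define V where "V = 2 * B * real (2 * card E + card Z)"
  have "0 \<le> B" using B[of 0] by linarith
  then have V: "0 \<le> V" by (simp add: V_def)
  have "finite (abs ` {t. h 0 - V - 1 \<le> h t})" using decay by simp
  then obtain N where N: "\<And>t. h 0 - V - 1 \<le> h t \<Longrightarrow> \<bar>t\<bar> \<le> N"
    by (metis (mono_tags, lifting) Max_ge image_eqI mem_Collect_eq)
  have N0: "0 \<le> N" using N[of 0] V by simp
  \<comment> \<open>The distances at which the times up to \<open>N\<close> return to the right of
    \<open>x\<close>. Time 0 would contribute 0 and is left out; its translates of \<open>x\<close>
    are excluded by \<open>e \<le> 1\<close> instead.\<close>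
  define D where "D = (\<lambda>t. frac (zpow F t x - x)) ` ({-N..N} - {0})"
  have finD: "finite D" by (simp add: D_def)
  have frac_pos: "0 < frac (zpow F t x - x)" if "t \<noteq> 0" for t
  proof (rule ccontr)
    assume "\<not> 0 < frac (zpow F t x - x)"
    then have "zpow F t x - x \<in> \<int>" using frac_ge_0[of "zpow F t x - x"] by (simp add: frac_eq_0_iff order_less_le)
    then obtain n where "zpow F t x - x = of_int n" by (auto elim: Ints_cases)
    then show False using nonper[of t n] that by simp
  qed
  define e where "e = Min (insert 1 D)"
  have e: "0 < e" "e \<le> 1" unfolding e_def using finD frac_pos by (auto simp: D_def)
  have far: "N < \<bar>t\<bar>" if "x < zpow F t x + of_int n" "zpow F t x + of_int n < x + e" for t n
  proof (rule ccontr)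
    assume t: "\<not> N < \<bar>t\<bar>"
    show False
    proof (cases "t = 0")
      case True
      then have "0 < real_of_int n" "real_of_int n < 1" using that e by auto
      then show False by auto
    next
      case False
      have "frac (zpow F t x - x) \<in> D" unfolding D_def using t False by (intro imageI) auto
      then have "e \<le> frac (zpow F t x - x)" unfolding e_def using finD by simp
      moreover have "frac (zpow F t x - x) = zpow F t x + of_int n - x"
        using that e by (subst frac_unique_iff) auto
      ultimately show False using that by simp
    qed
  qed
  define G where "G = (\<lambda>t. \<exists>n. x < zpow F t x + of_int n \<and> zpow F t x + of_int n < x + e)"
  \<comment> \<open>Among the returns within \<open>e\<close> one with least
    \<open>\<bar>i\<bar>\<close> is taken: nothing earlier falls between \<open>x\<close> and
    \<open>y\<close>, and \<open>e\<close> forces its time beyond \<open>N\<close>. The sign of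
    \<open>i\<close> is not controlled, hence the two cases in
    \<open>denjoy_inequality\<close>.\<close>
  obtain t0 where "G t0" using acc[OF e(1)] by (auto simp: G_def)
  then obtain i where i: "G i" "\<And>s. G s \<Longrightarrow> nat \<bar>i\<bar> \<le> nat \<bar>s\<bar>"
    using ex_has_least_nat[of G t0 "\<lambda>t. nat \<bar>t\<bar>"] by blast
  obtain m where m: "x < zpow F i x + of_int m" "zpow F i x + of_int m < x + e" using i(1) by (auto simp: G_def)
  define y where "y = zpow F i x + of_int m"
  define q where "q = \<bar>i\<bar>"
  have qN: "N < q" using far[OF m] by (simp add: q_def)
  have ret: "\<not> (x < zpow F s x + of_int n \<and> zpow F s x + of_int n < y)" if s: "\<bar>s\<bar> < q" for s n
  proof
    assume "x < zpow F s x + of_int n \<and> zpow F s x + of_int n < y"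
    then have "G s" using m by (auto simp: G_def y_def intro!: exI[of _ n])
    then show False using i(2)[of s] s by (simp add: q_def)
  qed
  have "\<bar>\<Sum>t\<in>{0..<q}. (h (t + 1) - h t) - (h (t - q + 1) - h (t - q))\<bar> \<le> V"
    unfolding V_def
    by (rule denjoy_inequality[where \<psi> = "\<lambda>t. h (t + 1) - h t", OF nonper fin loc B _ _ y_def _ ret])
       (use qN N0 m in \<open>auto simp: q_def y_def\<close>)
  moreover have "(\<Sum>t\<in>{0..<q}. (h (t + 1) - h t) - (h (t - q + 1) - h (t - q))) = (h q - h 0) - (h 0 - h (- q))"
    using sum_telescope_int[of h 0 "nat q"] sum_telescope_int[of h "-q" "nat q"] qN N0
    by (simp add: sum_subtractf sum.distrib algebra_simps)
  moreover have "h q < h 0 - V - 1" "h (- q) < h 0 - V - 1" using N[of q] N[of "-q"] qN N0 by force+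
  ultimately show False using V by linarith
qed

end

section \<open>Diffeomorphisms preserving the Cantor set\<close>

text \<open>Periodicity is asked of differences so that the lemma covers both \<open>F\<close>,
  which grows by 1 per period, and the periodic function \<open>ln (F' x)\<close>. The interval
  \<open>[-1, 2]\<close> holds the fractional part of \<open>x\<close> together with any point at
  distance below 1 from it.\<close>

lemma periodic_uniform:
  fixes h :: "real \<Rightarrow> real"
  assumes cont: "continuous_on UNIV h"
    and per: "\<And>x y n. h (x + of_int n) - h (y + of_int n) = h x - h y" and e: "0 < e"
  obtains r where "0 < r" "\<And>x y. \<bar>x - y\<bar> < r \<Longrightarrow> \<bar>h x - h y\<bar> < e"
proof -
  have "uniformly_continuous_on {-1..2} h"
    by (rule compact_uniformly_continuous) (auto intro: continuous_on_subset[OF cont])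
  then obtain r where r: "0 < r" "\<And>x y. x \<in> {-1..2} \<Longrightarrow> y \<in> {-1..2} \<Longrightarrow> \<bar>x - y\<bar> < r \<Longrightarrow> \<bar>h x - h y\<bar> < e"
    using e unfolding uniformly_continuous_on_def dist_real_def by (metis abs_minus_commute)
  have "\<bar>h x - h y\<bar> < e" if xy: "\<bar>x - y\<bar> < min r 1" for x y
  proof -
    have "frac x \<in> {-1..2}" using frac_ge_0[of x] frac_lt_1[of x] by (simp del: frac_ge_0)
    moreover have "x - 1 < y" "y < x + 1" using xy unfolding abs_less_iff by auto
    then have "y - of_int \<lfloor>x\<rfloor> \<in> {-1..2}" by (simp only: atLeastAtMost_iff) linarith
    ultimately have "\<bar>h (frac x) - h (y - of_int \<lfloor>x\<rfloor>)\<bar> < e" using xy by (intro r(2)) (auto simp: frac_def)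
    moreover have "h (frac x) - h (y - of_int \<lfloor>x\<rfloor>) = h x - h y"
      using per[of x "- \<lfloor>x\<rfloor>" y] by (simp add: frac_def)
    ultimately show ?thesis by simp
  qed
  then show ?thesis using that[of "min r 1"] r(1) by auto
qed

lemma nbrs_lessD: "nbrs A x y \<Longrightarrow> x < y \<Longrightarrow> z \<in> A \<Longrightarrow> x < z \<Longrightarrow> z < y \<Longrightarrow> False"
  by (auto simp: nbrs_def)

section \<open>Combinatorial lengths and cylinders\<close>

context ifs
begin

text \<open>The combinatorial length of a gap: its length in the affine model.\<close>
definition ell :: "(nat \<Rightarrow> nat \<Rightarrow> real) \<Rightarrow> real \<Rightarrow> real \<Rightarrow> real" where
  "ell u x y = (THE v. \<exists>w i j. coded w i j x y \<and> v = rhow w * u i j)"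

lemma ell_eq: "coded w i j x y \<Longrightarrow> ell u x y = rhow w * u i j"
  unfolding ell_def using coded_unique by (intro the_equality) blast+

definition cyl :: "nat list \<Rightarrow> real set" where "cyl w = foldr g w ` C"

lemma cyl_subset: "set w \<subseteq> {..<k} \<Longrightarrow> cyl w \<subseteq> C"
  using G_C by (auto simp: cyl_def)

lemma cyl_cover: "x \<in> C \<Longrightarrow> \<exists>w. length w = n \<and> set w \<subseteq> {..<k} \<and> x \<in> cyl w"
proof (induction n arbitrary: x)
  case (Suc n)
  obtain j y where j: "j < k" "y \<in> C" "x = g j y" using C_branch[OF Suc.prems] by metis
  obtain w where "length w = n" "set w \<subseteq> {..<k}" "y \<in> cyl w" using Suc.IH[OF j(2)] by blast
  then have "length (j # w) = Suc n" "set (j # w) \<subseteq> {..<k}" "x \<in> cyl (j # w)"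
    using j by (auto simp: cyl_def)
  then show ?case by blast
qed (simp add: cyl_def)

text \<open>A point of \<open>C\<close> between two points of one branch belongs to that branch, by
  disjointness of the intervals. Reversing branches exchange the two bounds, so the induction step
  meets both orders.\<close>

lemma cyl_between:
  "set w \<subseteq> {..<k} \<Longrightarrow> p \<in> cyl w \<Longrightarrow> q \<in> cyl w \<Longrightarrow> z \<in> C \<Longrightarrow> p \<le> z \<Longrightarrow> z \<le> q \<Longrightarrow> z \<in> cyl w"
proof (induction w arbitrary: p q z)
  case Nil
  then show ?case by (simp add: cyl_def)
next
  case (Cons j w)
  have j: "j < k" and w: "set w \<subseteq> {..<k}" using Cons.prems by auto
  obtain p' q' where pq: "p' \<in> cyl w" "p = g j p'" "q' \<in> cyl w" "q = g j q'"
    using Cons.prems by (auto simp: cyl_def)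
  then have C: "p' \<in> C" "q' \<in> C" using cyl_subset[OF w] by auto
  have "z \<in> {a j..b j}"
    using Cons.prems(5,6) pq g_in[OF j C_in[OF C(1)]] g_in[OF j C_in[OF C(2)]] by auto
  then obtain z' where z': "z' \<in> C" "z = g j z'" using C_branch_at[OF Cons.prems(4) j] by blast
  have "p' \<le> z' \<and> z' \<le> q' \<or> q' \<le> z' \<and> z' \<le> p'"
    using Cons.prems(5,6) unfolding pq z' g_le_iff[OF j C_in[OF C(1)] C_in[OF z'(1)]]
     g_le_iff[OF j C_in[OF z'(1)] C_in[OF C(2)]] by (cases "\<sigma> j") auto
  then have "z' \<in> cyl w" using Cons.IH[OF w] pq z' by blast
  then show ?case using z' by (auto simp: cyl_def)
qed

lemma cyl_bounds:
  assumes "set w \<subseteq> {..<k}"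
  shows "Inf (cyl w) \<in> cyl w" "Sup (cyl w) \<in> cyl w"
    "x \<in> cyl w \<Longrightarrow> Inf (cyl w) \<le> x" "x \<in> cyl w \<Longrightarrow> x \<le> Sup (cyl w)"
proof -
  have "1-lipschitz_on C (foldr g w)"
  proof (rule lipschitz_onI)
    fix x y assume "x \<in> C" "y \<in> C"
    then have "\<bar>foldr g w x - foldr g w y\<bar> \<le> \<theta> ^ length w * \<bar>x - y\<bar>"
      using G_contraction[OF assms] C_in by blast
    also have "\<dots> \<le> 1 * \<bar>x - y\<bar>" using \<theta> by (intro mult_right_mono power_le_one) auto
    finally show "dist (foldr g w x) (foldr g w y) \<le> 1 * dist x y" by (simp add: dist_real_def)
  qed simp
  then have "compact (cyl w)" unfolding cyl_def
    using compact_C by (intro compact_continuous_image lipschitz_on_continuous_on)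
  moreover have "cyl w \<noteq> {}" using C_ne by (simp add: cyl_def)
  ultimately have c: "closed (cyl w)" "cyl w \<noteq> {}" "bdd_below (cyl w)" "bdd_above (cyl w)"
    by (auto simp: compact_imp_closed compact_imp_bounded bounded_imp_bdd_below bounded_imp_bdd_above)
  show "Inf (cyl w) \<in> cyl w" "Sup (cyl w) \<in> cyl w"
    using closed_contains_Inf[OF c(2,3,1)] closed_contains_Sup[OF c(2,4,1)] by auto
  show "x \<in> cyl w \<Longrightarrow> Inf (cyl w) \<le> x" "x \<in> cyl w \<Longrightarrow> x \<le> Sup (cyl w)"
    using c cInf_lower cSup_upper by blast+
qed

lemma small_power: assumes "0 < e" obtains n where "\<theta> ^ n * (d - c) < e"
proof -
  have "0 < e / (d - c)" using assms cd by simp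
  then obtain n where "\<theta> ^ n < e / (d - c)" using real_arch_pow_inv[of _ \<theta>] \<theta> by blast
  then show ?thesis using that cd by (simp add: pos_less_divide_eq)
qed

lemma cyl_diam: assumes "set w \<subseteq> {..<k}" "x \<in> cyl w" "y \<in> cyl w" "n \<le> length w"
  shows "\<bar>x - y\<bar> \<le> \<theta> ^ n * (d - c)"
proof -
  obtain x' y' where xy: "x' \<in> C" "y' \<in> C" "x = foldr g w x'" "y = foldr g w y'"
    using assms by (auto simp: cyl_def)
  have "\<bar>x - y\<bar> \<le> \<theta> ^ length w * \<bar>x' - y'\<bar>" unfolding xy using G_contraction assms(1) C_in xy by blast
  also have "\<dots> \<le> \<theta> ^ n * (d - c)"
    using \<theta> assms(4) C_in[OF xy(1)] C_in[OF xy(2)] by (intro mult_mono power_decreasing) auto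
  finally show ?thesis .
qed

text \<open>A small cylinder around \<open>x\<close> contains the images of both ends of a primary
  gap, and at most one of them equals \<open>x\<close>.\<close>

lemma C_perfect: assumes "x \<in> C" "0 < e" obtains y where "y \<in> C" "y \<noteq> x" "\<bar>y - x\<bar> < e"
proof -
  obtain n where n: "\<theta> ^ n * (d - c) < e" using small_power[OF assms(2)] .
  obtain w where w: "length w = n" "set w \<subseteq> {..<k}" "x \<in> cyl w" using cyl_cover[OF assms(1)] by blast
  obtain i j p q where "coded [] i j p q" using primary_gap_exists .
  then have pq: "p \<in> C" "q \<in> C" "p \<noteq> q" using coded_C by blast+
  have "foldr g w p \<noteq> foldr g w q" using G_eq_iff[OF w(2)] C_in pq by blast
  then obtain p' where p': "p' \<in> C" "foldr g w p' \<noteq> x" using pq by metis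
  then have "foldr g w p' \<in> cyl w" by (simp add: cyl_def)
  then show ?thesis using that[of "foldr g w p'"] p' cyl_subset[OF w(2)] cyl_diam[OF w(2) _ w(3)] w(1) n
    by (metis order_le_less_trans order_refl subsetD)
qed

text \<open>Confines the ends of primary gaps to at most \<open>2 * k\<close> points, as the count
  of long gaps requires.\<close>

lemma primary_end: assumes "coded [] i j x y" shows "y \<in> {g j (Inf C), g j (Sup C)}"
proof -
  have ij: "i < k" "j < k" "i \<noteq> j" using assms by (auto simp: coded_def)
  show ?thesis
  proof (cases "b i < a j")
    case True
    then show ?thesis using primary_ends(2)[OF assms True] by auto
  next
    case False
    then have "b j < a i" using disj[OF ij] by simp
    then show ?thesis using primary_ends(1)[OF coded_sym[OF assms]] by auto
  qed
qed

lemma rhow_le: "set w \<subseteq> {..<k} \<Longrightarrow> rhow w \<le> \<theta> ^ length w"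
proof (induction w)
  case (Cons j w)
  have j: "j < k" and w: "set w \<subseteq> {..<k}" using Cons.prems by auto
  have "1 * rho j \<le> exp \<delta> * rho j" using \<delta>_pos rho_pos[OF j] by (intro mult_right_mono) auto
  then have "rho j \<le> \<theta>" using \<theta>(3)[OF j] by linarith
  then show ?case using Cons.IH[OF w] rho_pos[OF j] rhow_pos[OF w] \<theta> by (auto intro!: mult_mono)
qed simp

end

text \<open>The lift of an orientation-preserving diffeomorphism with minimal set \<open>C\<close>,
  minimality being expressed by \<open>dense\<close> and \<open>nonper\<close>. The assumption
  \<open>rigid\<close> is the conclusion of \<open>rigidity_constants\<close> for the present
  \<open>C\<close>.\<close>

locale cantor_diffeo = ifs + circle_homeo F for F :: "real \<Rightarrow> real" +
  fixes F' :: "real \<Rightarrow> real" and u :: "nat \<Rightarrow> nat \<Rightarrow> real" and \<eta> :: real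
  assumes c0: "0 \<le> c" and d1: "d < 1"
    and der: "\<And>x. (F has_real_derivative F' x) (at x)"
    and contF': "continuous_on UNIV F'" and F'_pos: "\<And>x. 0 < F' x"
    and invariant: "F ` {x. frac x \<in> C} = {x. frac x \<in> C}"
    and \<eta>: "0 < \<eta>"
    and upos: "\<And>i j. i < k \<Longrightarrow> j < k \<Longrightarrow> i \<noteq> j \<Longrightarrow> 0 < u i j"
    and rigid: "\<And>w s i1 j1 x1 y1 i2 j2 x2 y2 w1 I1 J1 X1 Y1 w2 I2 J2 X2 Y2 m.
      coded w i1 j1 x1 y1 \<Longrightarrow> coded (w @ s) i2 j2 x2 y2 \<Longrightarrow> length s \<le> 1 \<Longrightarrow>
      coded w1 I1 J1 X1 Y1 \<Longrightarrow> coded w2 I2 J2 X2 Y2 \<Longrightarrow>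
      \<bar>ln \<bar>X1 - Y1\<bar> - ln \<bar>x1 - y1\<bar> - m\<bar> \<le> \<eta> \<Longrightarrow> \<bar>ln \<bar>X2 - Y2\<bar> - ln \<bar>x2 - y2\<bar> - m\<bar> \<le> \<eta> \<Longrightarrow>
      \<bar>X1 - X2\<bar> \<le> exp (m + \<eta>) * \<bar>x1 - x2\<bar> \<Longrightarrow>
      ln (rhow w1 * u I1 J1) - ln (rhow w * u i1 j1) = ln (rhow w2 * u I2 J2) - ln (rhow (w @ s) * u i2 j2)"
    and dense: "\<And>x y e. frac x \<in> C \<Longrightarrow> frac y \<in> C \<Longrightarrow> 0 < e \<Longrightarrow> \<exists>t n. \<bar>zpow F t x + of_int n - y\<bar> < e"
    and nonper: "\<And>x t n. frac x \<in> C \<Longrightarrow> zpow F t x = x + of_int n \<Longrightarrow> t = 0"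
begin

definition A :: "real set" where "A = {x. frac x \<in> C}"

text \<open>The only gaps of the lift \<open>A\<close> with ends in different unit intervals are the translates of
  the outer gap, from the maximum of \<open>C\<close> to its minimum plus 1; their weight is irrelevant.\<close>
definition W :: "real \<Rightarrow> real \<Rightarrow> real" where
  "W x y = (if \<lfloor>x\<rfloor> = \<lfloor>y\<rfloor> then ell u (frac x) (frac y) else 1)"

definition \<phi> :: "real \<Rightarrow> real \<Rightarrow> real" where
  "\<phi> x y = ln (W (F x) (F y)) - ln (W x y)"

lemma A_int [simp]: "x + of_int n \<in> A \<longleftrightarrow> x \<in> A" "x - of_int n \<in> A \<longleftrightarrow> x \<in> A"
  using frac_add_of_int_right[of x "-n"] by (simp_all add: A_def)

lemma C_01: "x \<in> C \<Longrightarrow> 0 \<le> x \<and> x < 1"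
  using C_in[of x] c0 d1 by auto

lemma C_floor [simp]: "x \<in> C \<Longrightarrow> \<lfloor>x\<rfloor> = 0" "x \<in> C \<Longrightarrow> frac x = x"
  using C_01[of x] by (auto simp: frac_eq floor_eq_iff)

lemma C_A: "x \<in> C \<Longrightarrow> x \<in> A"
  by (simp add: A_def)

lemma A_C: "x \<in> A \<Longrightarrow> 0 \<le> x \<Longrightarrow> x < 1 \<Longrightarrow> x \<in> C"
  by (metis A_def frac_eq mem_Collect_eq)

lemma F_less: "F x < F y \<longleftrightarrow> x < y"
  using monoF by (simp add: strict_mono_less)

lemma F_A: "F x \<in> A \<longleftrightarrow> x \<in> A"
  using invariant bijF unfolding A_def[symmetric] by (metis bij_is_inj image_eqI inj_image_mem_iff)

lemma zpow_A: "zpow F t x \<in> A \<longleftrightarrow> x \<in> A"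
proof (induction t rule: int_induct[where k = 0])
  case (step1 t)
  then show ?case using zSuc F_A by simp
next
  case (step2 t)
  then show ?case using zSuc[of "t - 1" x] F_A[of "zpow F (t - 1) x"] by simp
qed simp

lemma nbrs_zpow: assumes "nbrs A x y" shows "nbrs A (zpow F t x) (zpow F t y)"
  unfolding nbrs_def
proof (intro conjI ballI notI)
  show "zpow F t x \<in> A" "zpow F t y \<in> A" using assms zpow_A by (auto simp: nbrs_def)
  show "zpow F t x = zpow F t y \<Longrightarrow> False" using assms zpow_less by (metis nbrs_def less_irrefl linorder_neqE)
next
  fix z assume z: "z \<in> A" "min (zpow F t x) (zpow F t y) < z \<and> z < max (zpow F t x) (zpow F t y)"
  have "zpow F (- t) z \<in> A" using z zpow_A by simp
  moreover have "min x y < zpow F (- t) z \<and> zpow F (- t) z < max x y"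
    using z(2) zpow_inv_less(1)[of z t x] zpow_inv_less(1)[of z t y] zpow_inv_less(2)[of t x z] zpow_inv_less(2)[of t y z]
    by (auto simp: min_less_iff_disj less_max_iff_disj)
  ultimately show False using assms by (auto simp: nbrs_def)
qed

lemma nbrs_F: "nbrs A x y \<Longrightarrow> nbrs A (F x) (F y)"
  using nbrs_zpow[of x y 1] zSuc[of 0] by simp

lemma nbrs_C_A: assumes "nbrs C x y" shows "nbrs A x y"
proof -
  have "z \<in> C" if "z \<in> A" "min x y < z" "z < max x y" for z
    using assms C_01[of x] C_01[of y] that by (intro A_C) (auto simp: nbrs_def)
  then show ?thesis using assms C_A unfolding nbrs_def by blast
qed

lemma nbrs_frac: assumes "nbrs A x y" "\<lfloor>x\<rfloor> = \<lfloor>y\<rfloor>" shows "nbrs C (frac x) (frac y)"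
proof -
  have "\<not> (min (frac x) (frac y) < z \<and> z < max (frac x) (frac y))" if "z \<in> C" for z
  proof
    assume z: "min (frac x) (frac y) < z \<and> z < max (frac x) (frac y)"
    have "z + of_int \<lfloor>x\<rfloor> \<in> A" using C_A[OF that] by simp
    moreover have "min x y < z + of_int \<lfloor>x\<rfloor> \<and> z + of_int \<lfloor>x\<rfloor> < max x y"
      using z assms(2) by (auto simp: frac_def min_def max_def split: if_splits)
    ultimately show False using assms(1) by (auto simp: nbrs_def)
  qed
  moreover have "frac x \<noteq> frac y" using assms by (auto simp: frac_def nbrs_def)
  ultimately show ?thesis using assms(1) by (auto simp: nbrs_def A_def)
qed

text \<open>Between points of \<open>A\<close> in different unit intervals lies an outer gap, whose
  length is at least \<open>1 - (d - c)\<close>.\<close>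

lemma floor_close: assumes "x \<in> A" "y \<in> A" "\<bar>x - y\<bar> < 1 - (d - c)" shows "\<lfloor>x\<rfloor> = \<lfloor>y\<rfloor>"
proof -
  have *: "\<not> \<lfloor>x\<rfloor> < \<lfloor>y\<rfloor>" if "x \<in> A" "y \<in> A" "\<bar>x - y\<bar> < 1 - (d - c)" for x y
  proof
    assume "\<lfloor>x\<rfloor> < \<lfloor>y\<rfloor>"
    then have "\<lfloor>x\<rfloor> + 1 \<le> \<lfloor>y\<rfloor>" by simp
    then have "real_of_int \<lfloor>x\<rfloor> + 1 \<le> real_of_int \<lfloor>y\<rfloor>" by linarith
    moreover have "frac x \<in> {c..d}" "frac y \<in> {c..d}" using that C_in by (auto simp: A_def)
    ultimately show False using that(3) by (auto simp: frac_def abs_if split: if_splits)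
  qed
  show ?thesis using *[of x y] *[of y x] assms by (simp add: abs_minus_commute)
qed

lemma W_int [simp]: "W (x + of_int n) (y + of_int n) = W x y"
  by (simp add: W_def)

lemma \<phi>_int: "\<phi> (x + of_int n) (y + of_int n) = \<phi> x y"
  by (simp add: \<phi>_def F_int)

lemma W_pos: assumes "nbrs A x y" shows "0 < W x y"
proof (cases "\<lfloor>x\<rfloor> = \<lfloor>y\<rfloor>")
  case True
  obtain w i j where c: "coded w i j (frac x) (frac y)" using nbrs_coded[OF nbrs_frac[OF assms True]] by blast
  then have "i < k" "j < k" "i \<noteq> j" "set w \<subseteq> {..<k}" by (auto simp: coded_def)
  then show ?thesis using True ell_eq[OF c, of u] upos[of i j] rhow_pos[of w] by (simp add: W_def)
qed (simp add: W_def)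

lemma F'_int: "F' (x + of_int n) = F' x"
proof -
  have "((\<lambda>x. F (x + of_int n)) has_real_derivative F' (x + of_int n)) (at x)"
    using der[of "x + of_int n"] by (simp add: DERIV_shift)
  then have "((\<lambda>x. F x + of_int n) has_real_derivative F' (x + of_int n)) (at x)"
    by (simp add: F_int)
  moreover have "((\<lambda>x. F x + of_int n) has_real_derivative F' x) (at x)"
    using der[of x] by (auto intro!: derivative_eq_intros)
  ultimately show ?thesis by (rule DERIV_unique)
qed

lemma F_mvt:
  assumes "x \<noteq> y"
  obtains \<xi> where "min x y < \<xi>" "\<xi> < max x y" "\<bar>F x - F y\<bar> = F' \<xi> * \<bar>x - y\<bar>"
proof -
  have *: "\<exists>\<xi>. x < \<xi> \<and> \<xi> < y \<and> \<bar>F x - F y\<bar> = F' \<xi> * \<bar>x - y\<bar>" if xy: "x < y" for x y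
  proof -
    obtain \<xi> where "x < \<xi>" "\<xi> < y" "F y - F x = (y - x) * F' \<xi>" using MVT2[OF xy der] by blast
    then show ?thesis using xy F'_pos[of \<xi>] F_less[of x y] by (intro exI[of _ \<xi>]) (auto simp: mult.commute)
  qed
  consider "x < y" | "y < x" using assms by linarith
  then show ?thesis
  proof cases
    case 1
    then show ?thesis using *[OF 1] that by auto
  next
    case 2
    then show ?thesis using *[OF 2] that by (auto simp: abs_minus_commute)
  qed
qed

text \<open>Uniform continuity of \<open>F\<close> and of \<open>ln (F' x)\<close>, combined with
  the decay of cylinder diameters. With \<open>floor_close\<close>, the first property keeps the
  image of a deep cylinder inside one unit interval; the second makes \<open>F\<close> affine on it
  up to a factor \<open>exp \<eta>\<close>, with the derivative read off at any of its points
  \<open>p\<close>.\<close>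

lemma deep_scale:
  obtains n0 where "\<And>w x y. set w \<subseteq> {..<k} \<Longrightarrow> n0 \<le> length w \<Longrightarrow> x \<in> cyl w \<Longrightarrow> y \<in> cyl w \<Longrightarrow> \<bar>F x - F y\<bar> < 1 - (d - c)"
    "\<And>w x y p. set w \<subseteq> {..<k} \<Longrightarrow> n0 \<le> length w \<Longrightarrow> x \<in> cyl w \<Longrightarrow> y \<in> cyl w \<Longrightarrow> p \<in> cyl w \<Longrightarrow> x \<noteq> y \<Longrightarrow>
      \<bar>ln \<bar>F x - F y\<bar> - ln \<bar>x - y\<bar> - ln (F' p)\<bar> \<le> \<eta>"
proof -
  have "0 < 1 - (d - c)" using c0 d1 by simp
  moreover have "continuous_on UNIV F" using der by (meson DERIV_continuous_on has_field_derivative_at_within)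
  ultimately obtain r1 where r1: "0 < r1" "\<And>x y. \<bar>x - y\<bar> < r1 \<Longrightarrow> \<bar>F x - F y\<bar> < 1 - (d - c)"
    using periodic_uniform[of F "1 - (d - c)"] F_int by (metis add_diff_cancel_right)
  have "continuous_on UNIV (\<lambda>x. ln (F' x))" using contF' F'_pos
    by (intro continuous_on_ln) (auto simp: less_imp_neq[symmetric])
  then obtain r2 where r2: "0 < r2" "\<And>x y. \<bar>x - y\<bar> < r2 \<Longrightarrow> \<bar>ln (F' x) - ln (F' y)\<bar> < \<eta>"
    using periodic_uniform[of "\<lambda>x. ln (F' x)" \<eta>] F'_int \<eta> by metis
  obtain n0 where n0: "\<theta> ^ n0 * (d - c) < min r1 r2" using small_power[of "min r1 r2"] r1(1) r2(1) by auto
  show ?thesis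
  proof (rule that[of n0])
    fix w x y assume w: "set w \<subseteq> {..<k}" "n0 \<le> length w" "x \<in> cyl w" "y \<in> cyl w"
    show "\<bar>F x - F y\<bar> < 1 - (d - c)" using cyl_diam[OF w(1,3,4,2)] n0 by (intro r1(2)) simp
    fix p assume p: "p \<in> cyl w" "x \<noteq> y"
    obtain \<xi> where \<xi>: "min x y < \<xi>" "\<xi> < max x y" "\<bar>F x - F y\<bar> = F' \<xi> * \<bar>x - y\<bar>" using F_mvt[OF p(2)] .
    have "\<bar>\<xi> - p\<bar> < r2"
      using \<xi>(1,2) cyl_diam[OF w(1,3) p(1) w(2)] cyl_diam[OF w(1,4) p(1) w(2)] n0
      by (auto simp: abs_if min_def max_def split: if_splits)
    then have "\<bar>ln (F' \<xi>) - ln (F' p)\<bar> < \<eta>" by (rule r2(2))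
    moreover have "ln \<bar>F x - F y\<bar> = ln (F' \<xi>) + ln \<bar>x - y\<bar>"
      unfolding \<xi>(3) using F'_pos[of \<xi>] p(2) by (intro ln_mult_pos) auto
    ultimately show "\<bar>ln \<bar>F x - F y\<bar> - ln \<bar>x - y\<bar> - ln (F' p)\<bar> \<le> \<eta>" by simp
  qed
qed

lemma coded_cyl: "coded (w @ s) i j x y \<Longrightarrow> x \<in> cyl w \<and> y \<in> cyl w"
proof -
  assume "coded (w @ s) i j x y"
  then obtain x0 y0 where "x0 \<in> C" "y0 \<in> C" "x = foldr g w (foldr g s x0)" "y = foldr g w (foldr g s y0)"
    "set s \<subseteq> {..<k}" by (auto simp: coded_def nbrs_def)
  then show ?thesis using G_C by (auto simp: cyl_def)
qed

lemma W_coded: assumes "coded w i j x y" shows "W x y = rhow w * u i j"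
  using coded_C[OF assms] ell_eq[OF assms] by (simp add: W_def)

text \<open>Every word has a reference gap, the image of one fixed primary gap. Extending the word
  letter by letter leaves \<open>\<phi>\<close> of the reference gap unchanged, and at the full word
  it equals \<open>\<phi>\<close> of the given gap, which has the same code word.\<close>

lemma \<phi>_locally_constant:
  obtains n0 \<Phi> where "\<And>w s i j x y. length w = n0 \<Longrightarrow> coded (w @ s) i j x y \<Longrightarrow> \<phi> x y = \<Phi> w"
proof -
  obtain n0 where
    n0: "\<And>w x y. set w \<subseteq> {..<k} \<Longrightarrow> n0 \<le> length w \<Longrightarrow> x \<in> cyl w \<Longrightarrow> y \<in> cyl w \<Longrightarrow> \<bar>F x - F y\<bar> < 1 - (d - c)"
    "\<And>w x y p. set w \<subseteq> {..<k} \<Longrightarrow> n0 \<le> length w \<Longrightarrow> x \<in> cyl w \<Longrightarrow> y \<in> cyl w \<Longrightarrow> p \<in> cyl w \<Longrightarrow> x \<noteq> y \<Longrightarrow>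
      \<bar>ln \<bar>F x - F y\<bar> - ln \<bar>x - y\<bar> - ln (F' p)\<bar> \<le> \<eta>"
    by (rule deep_scale) blast
  \<comment> \<open>Both gaps lie in the cylinder of \<open>w\<close>, so the single value
    \<open>m = ln (F' x1)\<close> serves for the two of them.\<close>
  have step: "\<phi> x1 y1 = \<phi> x2 y2"
    if w: "n0 \<le> length w" and cod: "coded w i1 j1 x1 y1" "coded (w @ s) i2 j2 x2 y2" "length s \<le> 1"
    for w s i1 j1 x1 y1 i2 j2 x2 y2
  proof -
    have sw: "set w \<subseteq> {..<k}" using cod(1) by (simp add: coded_def)
    have cy: "x1 \<in> cyl w" "y1 \<in> cyl w" "x2 \<in> cyl w" "y2 \<in> cyl w"
      using coded_cyl[of w "[]" i1 j1 x1 y1] coded_cyl[OF cod(2)] cod(1) by auto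
    have nA: "nbrs A (F x1) (F y1)" "nbrs A (F x2) (F y2)"
      using coded_nbrs[OF cod(1)] coded_nbrs[OF cod(2)] nbrs_C_A nbrs_F by auto
    then have inA: "F x1 \<in> A" "F y1 \<in> A" "F x2 \<in> A" "F y2 \<in> A" by (auto simp: nbrs_def)
    have fl: "\<lfloor>F y1\<rfloor> = \<lfloor>F x1\<rfloor>" "\<lfloor>F x2\<rfloor> = \<lfloor>F x1\<rfloor>" "\<lfloor>F y2\<rfloor> = \<lfloor>F x1\<rfloor>"
      using floor_close inA n0(1)[OF sw w] cy by metis+
    obtain w1 I1 J1 where c1: "coded w1 I1 J1 (frac (F x1)) (frac (F y1))"
      using nbrs_coded nbrs_frac nA(1) fl by metis
    obtain w2 I2 J2 where c2: "coded w2 I2 J2 (frac (F x2)) (frac (F y2))"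
      using nbrs_coded nbrs_frac nA(2) fl by metis
    have ne: "x1 \<noteq> y1" "x2 \<noteq> y2" using coded_C cod by blast+
    have fr: "frac (F x1) - frac (F y1) = F x1 - F y1" "frac (F x2) - frac (F y2) = F x2 - F y2"
      "frac (F x1) - frac (F x2) = F x1 - F x2" using fl by (auto simp: frac_def)
    have far: "\<bar>F x1 - F x2\<bar> \<le> exp (ln (F' x1) + \<eta>) * \<bar>x1 - x2\<bar>"
    proof (cases "x1 = x2")
      case False
      have "F x1 \<noteq> F x2" using False bijF by (simp add: bij_is_inj inj_eq)
      moreover have "exp (ln \<bar>F x1 - F x2\<bar>) \<le> exp ((ln (F' x1) + \<eta>) + ln \<bar>x1 - x2\<bar>)"
        using n0(2)[OF sw w cy(1,3,1) False] by simp
      ultimately show ?thesis using False by (simp add: exp_add)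
    qed simp
    have "ln (rhow w1 * u I1 J1) - ln (rhow w * u i1 j1) = ln (rhow w2 * u I2 J2) - ln (rhow (w @ s) * u i2 j2)"
      using n0(2)[OF sw w cy(1,2,1) ne(1)] n0(2)[OF sw w cy(3,4,1) ne(2)] far
      by (intro rigid[OF cod c1 c2, where m = "ln (F' x1)"]) (simp_all only: fr)
    moreover have "W (F x1) (F y1) = rhow w1 * u I1 J1" "W (F x2) (F y2) = rhow w2 * u I2 J2"
      using fl ell_eq[OF c1] ell_eq[OF c2] by (simp_all add: W_def)
    moreover have "W x1 y1 = rhow w * u i1 j1" "W x2 y2 = rhow (w @ s) * u i2 j2"
      using cod W_coded by auto
    ultimately show ?thesis by (simp add: \<phi>_def)
  qed
  obtain i0 j0 x0 y0 where 0: "coded [] i0 j0 x0 y0" using primary_gap_exists .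
  define \<Phi> where "\<Phi> w = \<phi> (foldr g w x0) (foldr g w y0)" for w
  have ref: "coded w i0 j0 (foldr g w x0) (foldr g w y0)" if "set w \<subseteq> {..<k}" for w
    using coded_append[OF that 0] by simp
  have "\<phi> x y = \<Phi> w" if w: "length w = n0" and cod: "coded (w @ s) i j x y" for w s i j x y
  proof -
    have sets: "set w \<subseteq> {..<k}" "set s \<subseteq> {..<k}" using cod by (auto simp: coded_def)
    have *: "set s \<subseteq> {..<k} \<Longrightarrow> \<Phi> (w @ s) = \<Phi> w" for s
    proof (induction s rule: rev_induct)
      case (snoc m s)
      have "\<Phi> (w @ s) = \<Phi> ((w @ s) @ [m])" unfolding \<Phi>_def
        using snoc.prems sets w by (intro step[OF _ ref ref, of "w @ s" "[m]"]) auto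
      then show ?case using snoc by simp
    qed simp
    have "\<phi> (foldr g (w @ s) x0) (foldr g (w @ s) y0) = \<phi> x y"
      using sets w cod by (intro step[of "w @ s" i0 j0 _ _ "[]" i j] ref) auto
    then show ?thesis using *[OF sets(2)] by (simp add: \<Phi>_def)
  qed
  then show ?thesis using that by blast
qed

text \<open>The minimum of the cylinder lies to the left of the right end, hence not beyond the
  neighbour \<open>l\<close> of that end. So \<open>l\<close> is caught between two points of the
  cylinder and belongs to it by convexity.\<close>

lemma left_gap_in_cyl:
  assumes n: "nbrs A l r" "l < r" and w: "set w \<subseteq> {..<k}" "frac r \<in> cyl w" "frac r \<noteq> Inf (cyl w)"
  obtains s i j where "coded (w @ s) i j (frac l) (frac r)" "\<lfloor>l\<rfloor> = \<lfloor>r\<rfloor>"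
proof -
  define m where "m = Inf (cyl w)"
  have m: "m \<in> cyl w" "m < frac r" using cyl_bounds[OF w(1)] w by (auto simp: m_def order_less_le)
  have mC: "m \<in> C" using m cyl_subset[OF w(1)] by auto
  then have "m + of_int \<lfloor>r\<rfloor> \<in> A" using C_A by simp
  moreover have "m + of_int \<lfloor>r\<rfloor> < r" using m by (simp add: frac_def)
  ultimately have ml: "m + of_int \<lfloor>r\<rfloor> \<le> l" using nbrs_lessD[OF n] by (meson linorder_not_le)
  have "0 \<le> m" using C_01 mC by blast
  then have fl: "\<lfloor>l\<rfloor> = \<lfloor>r\<rfloor>" using ml n(2) by (auto simp: floor_eq_iff) (use floor_correct[of r] in linarith)
  have nC: "nbrs C (frac l) (frac r)" using nbrs_frac[OF n(1) fl] .
  have "m \<le> frac l" "frac l \<le> frac r" using ml n(2) fl by (auto simp: frac_def)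
  then have "frac l \<in> cyl w" using cyl_between[OF w(1) m(1) w(2)] nC by (simp add: nbrs_def)
  then obtain l' r' where lr: "l' \<in> C" "r' \<in> C" "frac l = foldr g w l'" "frac r = foldr g w r'"
    using w(2) by (auto simp: cyl_def)
  then have "nbrs C l' r'" using nbrs_G[OF w(1)] nC by simp
  then obtain s i j where "coded s i j l' r'" using nbrs_coded by blast
  then have "coded (w @ s) i j (frac l) (frac r)" using coded_append[OF w(1)] lr by simp
  then show ?thesis using that fl by blast
qed

lemma frac_orbit_inj: assumes "x \<in> A" shows "inj (\<lambda>t. frac (zpow F t x))"
proof (rule injI)
  fix s t assume "frac (zpow F s x) = frac (zpow F t x)"
  then have "zpow F s x = zpow F t x + of_int (\<lfloor>zpow F s x\<rfloor> - \<lfloor>zpow F t x\<rfloor>)" by (simp add: frac_def)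
  then have "zpow F (- t) (zpow F s x) = zpow F (- t) (zpow F t x) + of_int (\<lfloor>zpow F s x\<rfloor> - \<lfloor>zpow F t x\<rfloor>)"
    using zpow_int by metis
  then have "zpow F (- t + s) x = x + of_int (\<lfloor>zpow F s x\<rfloor> - \<lfloor>zpow F t x\<rfloor>)" unfolding zadd[symmetric] by simp
  then have "- t + s = 0" using nonper assms unfolding A_def by blast
  then show "s = t" by simp
qed

text \<open>Combinatorial length decays geometrically in the length of the code, so long gaps have
  short codes. Gaps are recorded by the fractional part of their right end, since that is what tells
  the times of an orbit apart.\<close>

lemma finite_long_gaps:
  assumes v: "0 < v"
  shows "\<exists>R. finite R \<and> (\<forall>l r. nbrs A l r \<longrightarrow> l < r \<longrightarrow> v \<le> W l r \<longrightarrow> frac r \<in> R)"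
proof -
  define U where "U = Max ((\<lambda>(i,j). u i j) ` ({..<k} \<times> {..<k}))"
  have U: "u i j \<le> U" if "i < k" "j < k" for i j unfolding U_def
    using that by (intro Max_ge) (auto intro!: image_eqI[of _ _ "(i,j)"])
  have Up: "0 < U" using upos[of 0 1] U[of 0 1] k_ge by auto
  obtain n where n: "\<theta> ^ n < v / U" using real_arch_pow_inv[of "v / U" \<theta>] \<theta> v Up by auto
  define L where "L = {w. set w \<subseteq> {..<k} \<and> length w \<le> n}"
  have finL: "finite L" unfolding L_def by (rule finite_lists_length_le) simp
  \<comment> \<open>\<open>Inf C\<close> is the right end of the outer gap modulo 1, whose weight 1
    may reach \<open>v\<close>.\<close>
  define R where "R = insert (Inf C) ((\<lambda>(w, j, z). foldr g w (g j z)) ` (L \<times> {..<k} \<times> {Inf C, Sup C}))"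
  have "finite R" unfolding R_def using finL by auto
  moreover have "frac r \<in> R" if lr: "nbrs A l r" "l < r" "v \<le> W l r" for l r
  proof (cases "\<lfloor>l\<rfloor> = \<lfloor>r\<rfloor>")
    case True
    obtain w i j where cod: "coded w i j (frac l) (frac r)" using nbrs_coded[OF nbrs_frac[OF lr(1) True]] by blast
    have h: "set w \<subseteq> {..<k}" "i < k" "j < k" "i \<noteq> j" using cod by (auto simp: coded_def)
    have "v \<le> rhow w * u i j" using lr(3) True ell_eq[OF cod, of u] by (simp add: W_def)
    also have "\<dots> \<le> \<theta> ^ length w * U"
      using rhow_le[OF h(1)] U h upos[OF h(2-4)] \<theta> by (intro mult_mono) auto
    finally have "v / U \<le> \<theta> ^ length w" using Up by (simp add: pos_divide_le_eq)
    then have "\<theta> ^ n < \<theta> ^ length w" using n by linarith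
    then have "length w \<le> n" using \<theta> by (metis less_imp_le linorder_not_le power_decreasing)
    then have wL: "w \<in> L" using h by (simp add: L_def)
    obtain x0 y0 where "nbrs C x0 y0" "x0 \<in> {a i..b i}" "y0 \<in> {a j..b j}" and y0: "frac r = foldr g w y0"
      using cod by (auto simp: coded_def)
    then have "coded [] i j x0 y0" using h by (auto simp: coded_def)
    then obtain z where z: "z \<in> {Inf C, Sup C}" "y0 = g j z" using primary_end by blast
    show ?thesis unfolding R_def y0 z(2)
      using wL h z by (intro insertI2 image_eqI[of _ _ "(w, j, z)"]) auto
  next
    case False
    then have "\<lfloor>l\<rfloor> < \<lfloor>r\<rfloor>" using lr(2) floor_mono[of l r] by simp
    then have "l < of_int \<lfloor>r\<rfloor>" using floor_less_iff by blast
    moreover have "0 \<le> Inf C" using C_01 Inf_C(1) by blast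
    ultimately have "l < Inf C + of_int \<lfloor>r\<rfloor>" by linarith
    moreover have "Inf C + of_int \<lfloor>r\<rfloor> \<in> A" using C_A[OF Inf_C(1)] by simp
    ultimately have "\<not> Inf C + of_int \<lfloor>r\<rfloor> < r" using lr(1,2) by (auto simp: nbrs_def)
    moreover have "Inf C \<le> frac r" using lr(1) Inf_C(2) by (auto simp: nbrs_def A_def)
    ultimately show ?thesis by (simp add: R_def frac_def)
  qed
  ultimately show ?thesis by blast
qed

lemma no_cantor_diffeo: False
proof -
  obtain i0 j0 x0 y0 where cod: "coded [] i0 j0 x0 y0" using primary_gap_exists .
  define l where "l = min x0 y0"
  define r where "r = max x0 y0"
  have nC: "nbrs C l r" "l < r" using coded_nbrs[OF cod] nbrs_sym by (auto simp: l_def r_def nbrs_def min_def max_def)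
  have nA: "nbrs A l r" using nbrs_C_A[OF nC(1)] .
  have rC: "r \<in> C" and rA: "r \<in> A" using nC nA by (auto simp: nbrs_def)
  define lt where "lt t = zpow F t l" for t
  define rt where "rt t = zpow F t r" for t
  have nt: "nbrs A (lt t) (rt t)" "lt t < rt t" for t
    unfolding lt_def rt_def using nbrs_zpow[OF nA] zpow_less nC by auto
  define h where "h t = ln (W (lt t) (rt t))" for t
  have h_diff: "h (t + 1) - h t = \<phi> (lt t) (rt t)" for t
    by (simp add: h_def \<phi>_def lt_def rt_def zSuc)
  obtain n0 \<Phi> where \<Phi>: "\<And>w s i j x y. length w = n0 \<Longrightarrow> coded (w @ s) i j x y \<Longrightarrow> \<phi> x y = \<Phi> w"
    by (rule \<phi>_locally_constant) blast
  define Ws where "Ws = {w. set w \<subseteq> {..<k} \<and> length w = n0}"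
  have finW: "finite Ws" unfolding Ws_def by (rule finite_lists_length_eq) simp
  have inj: "inj (\<lambda>t. frac (rt t))" unfolding rt_def using frac_orbit_inj[OF rA] .
  have finpre: "finite {t. frac (rt t) \<in> R}" if "finite R" for R
    using finite_vimageI[OF that inj] by (simp add: vimage_def)
  \<comment> \<open>Exceptional times: the right end is the leftmost point of a cylinder, so the gap
    may protrude from it and escape \<open>\<Phi>\<close>. They are finitely many because the orbit
    of \<open>r\<close> is injective modulo 1.\<close>
  define E where "E = {t. frac (rt t) \<in> (\<lambda>w. Inf (cyl w)) ` Ws}"
  have finE: "finite E" unfolding E_def using finW by (intro finpre) simp
  \<comment> \<open>Cut points: if two right ends lie in different cylinders of generation
    \<open>n0\<close>, the largest point of the cylinder containing the left one separates
    them.\<close>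
  define Z where "Z = (\<lambda>w. Sup (cyl w)) ` Ws"
  have finZ: "finite Z" using finW by (simp add: Z_def)
  have rtC: "frac (rt t) \<in> C" for t using nt(1)[of t] by (simp add: nbrs_def A_def)
  have const: "h (t + 1) - h t = \<Phi> w" if tw: "t \<notin> E" "w \<in> Ws" "frac (rt t) \<in> cyl w" for t w
  proof -
    have w: "set w \<subseteq> {..<k}" "length w = n0" "frac (rt t) \<noteq> Inf (cyl w)" using tw by (auto simp: Ws_def E_def)
    obtain s i j where "coded (w @ s) i j (frac (lt t)) (frac (rt t))" and fl: "\<lfloor>lt t\<rfloor> = \<lfloor>rt t\<rfloor>"
      using left_gap_in_cyl[OF nt w(1) tw(3) w(3)] .
    then have "\<phi> (frac (lt t)) (frac (rt t)) = \<Phi> w" using \<Phi> w by blast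
    then show ?thesis unfolding h_diff
      using \<phi>_int[of "frac (lt t)" "\<lfloor>lt t\<rfloor>" "frac (rt t)"] fl by (simp add: frac_def)
  qed
  have cover: "\<exists>w\<in>Ws. frac (rt t) \<in> cyl w" for t using cyl_cover[OF rtC[of t], of n0] by (auto simp: Ws_def)
  have loc: "\<exists>z\<in>Z. \<exists>m. rt s \<le> z + of_int m \<and> z + of_int m < rt t + of_int n"
    if st: "s \<notin> E" "t \<notin> E" "rt s < rt t + of_int n" "h (s + 1) - h s \<noteq> h (t + 1) - h t" for s t n
  proof -
    obtain w where w: "w \<in> Ws" "frac (rt s) \<in> cyl w" using cover by blast
    have sw: "set w \<subseteq> {..<k}" using w by (simp add: Ws_def)
    define M where "M = Sup (cyl w)"
    have M: "M \<in> cyl w" "frac (rt s) \<le> M" using cyl_bounds[OF sw] w by (auto simp: M_def)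
    have M1: "M < 1" using M(1) cyl_subset[OF sw] C_01 by blast
    have "M + of_int \<lfloor>rt s\<rfloor> < rt t + of_int n"
    proof (rule ccontr)
      assume "\<not> M + of_int \<lfloor>rt s\<rfloor> < rt t + of_int n"
      define z where "z = rt t + of_int (n - \<lfloor>rt s\<rfloor>)"
      have z: "z \<le> M" "frac (rt s) < z" using \<open>\<not> M + _ < _\<close> st(3) by (auto simp: z_def frac_def)
      then have z01: "0 \<le> z" "z < 1" using M1 frac_ge_0[of "rt s"] by linarith+
      have "frac z = frac (rt t)" unfolding z_def by (rule frac_add_of_int_right)
      then have zt: "z = frac (rt t)" using z01 by (metis frac_eq)
      have "z \<in> cyl w" using cyl_between[OF sw w(2) M(1)] z rtC zt by auto
      then show False using const[OF st(1) w] const[OF st(2) w(1)] zt st(4) by simp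
    qed
    moreover have "rt s \<le> M + of_int \<lfloor>rt s\<rfloor>" using M(2) by (simp add: frac_def)
    moreover have "M \<in> Z" using w by (simp add: M_def Z_def)
    ultimately show ?thesis by blast
  qed
  have "range (\<lambda>t. h (t + 1) - h t) \<subseteq> \<Phi> ` Ws \<union> (\<lambda>t. h (t + 1) - h t) ` E"
    using const cover by blast
  then have "finite (range (\<lambda>t. h (t + 1) - h t))" using finW finE by (meson finite_Un finite_imageI finite_subset)
  then have "bounded (range (\<lambda>t. h (t + 1) - h t))" by (rule finite_imp_bounded)
  then obtain B where B: "\<And>t. \<bar>h (t + 1) - h t\<bar> \<le> B" by (auto simp: bounded_iff)
  have decay: "finite {t. v \<le> h t}" for v
  proof -
    obtain R where R: "finite R" "\<And>l r. nbrs A l r \<Longrightarrow> l < r \<Longrightarrow> exp v \<le> W l r \<Longrightarrow> frac r \<in> R"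
      using finite_long_gaps[of "exp v"] by auto
    have "frac (rt t) \<in> R" if "v \<le> h t" for t
      using R(2)[OF nt] that W_pos[OF nt(1)] unfolding h_def by (simp add: ln_ge_iff)
    then show ?thesis using finpre[OF R(1)] by (elim finite_subset[rotated]) auto
  qed
  have acc: "\<exists>t n. r < zpow F t r + of_int n \<and> zpow F t r + of_int n < r + e" if e: "0 < e" for e
  proof -
    \<comment> \<open>Points of \<open>C\<close> near \<open>r\<close> can only lie on its right:
      the bound \<open>r - l\<close> rules out everything across the gap. Approximating
      \<open>y\<close> by the orbit of \<open>r\<close> more closely than \<open>y - r\<close> keeps
      the return on that side.\<close>
    obtain y where y: "y \<in> C" "y \<noteq> r" "\<bar>y - r\<bar> < min e (r - l)" using C_perfect[OF rC, of "min e (r - l)"] e nC by auto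
    have "r < y" using y nC by (force simp: nbrs_def)
    then have ye: "0 < min (y - r) (r + e - y)" using y by auto
    obtain t n where "\<bar>zpow F t r + of_int n - y\<bar> < min (y - r) (r + e - y)"
      using dense[of r y, OF _ _ ye] rC y by auto
    then show ?thesis by (intro exI[of _ t] exI[of _ n]) auto
  qed
  show False
    by (rule denjoy_contradiction[OF nonper acc finE finZ loc[unfolded rt_def] B decay])
       (use rC in \<open>auto simp: rt_def\<close>)
qed

end

section \<open>Minimal sets of circle diffeomorphisms\<close>

lemma nonvanishing_sign:
  fixes h :: "real \<Rightarrow> real"
  assumes "continuous_on UNIV h" "\<And>x. h x \<noteq> 0"
  shows "(\<forall>x. 0 < h x) \<or> (\<forall>x. h x < 0)"
proof (rule ccontr)
  assume "\<not> ?thesis"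
  then obtain x y where "h x \<le> 0" "0 \<le> h y" by (meson not_less)
  moreover have "connected (range h)" using assms(1) by (intro connected_continuous_image) auto
  ultimately have "0 \<in> range h" using connectedD_interval[of "range h" "h x" "h y" 0] by auto
  then show False using assms(2) by (metis imageE)
qed

context ifs
begin

lemma infinite_C: "infinite C"
proof
  assume fin: "finite C"
  obtain x where x: "x \<in> C" using C_ne by blast
  obtain e where e: "0 < e" "\<forall>y\<in>C. y \<noteq> x \<longrightarrow> e \<le> dist x y" using finite_set_avoid[OF fin, of x] by blast
  obtain y where "y \<in> C" "y \<noteq> x" "\<bar>y - x\<bar> < e" using C_perfect[OF x e(1)] .
  then show False using e(2) by (force simp: dist_real_def abs_minus_commute)
qed

end

text \<open>The degree \<open>e\<close> of the lift stays a parameter until the reversing case has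
  been refuted.\<close>

locale circle_lift =
  fixes f F :: "real \<Rightarrow> real" and e :: real and C :: "real set"
  assumes F_bij: "bij F" and e: "e = 1 \<or> e = - 1" and F_e: "\<And>x. F (x + 1) = F x + e"
    and f: "\<And>x. x \<in> {0..<1} \<Longrightarrow> f x = frac (F x)"
    and C01: "C \<subseteq> {0..<1}" and fC: "f ` C = C"
    and orbit_dense: "\<And>x y r. x \<in> C \<Longrightarrow> y \<in> C \<Longrightarrow> 0 < r \<Longrightarrow> \<exists>z\<in>circle_orbit f x. circ_dist z y < r"
    and C_inf: "infinite C"
begin

abbreviation finv :: "real \<Rightarrow> real" where "finv \<equiv> the_inv_into {0..<1} f"

lemma F_add_int: "F (x + of_int n) = F x + e * of_int n"
proof (induction n arbitrary: x rule: int_induct[where k = 0])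
  case (step1 n)
  then show ?case using F_e[of "x + of_int n"] by (simp add: algebra_simps)
next
  case (step2 n)
  then show ?case using F_e[of "x + of_int (n - 1)"] by (simp add: algebra_simps)
qed simp

lemma e_int: "e * of_int n = of_int (if e = 1 then n else - n)"
  using e by auto

lemma frac_F_frac: "frac (F (frac y)) = frac (F y)"
proof -
  have "F (frac y) = F y + e * of_int (- \<lfloor>y\<rfloor>)" using F_add_int[of y "- \<lfloor>y\<rfloor>"] by (simp add: frac_def)
  then show ?thesis unfolding e_int by (simp only: frac_add_of_int_right)
qed

lemma frac_in: "frac y \<in> {0..<1::real}"
  using frac_lt_1 by auto

lemma f_frac: "f (frac y) = frac (F y)"
  using f[OF frac_in] frac_F_frac by simp

lemma f_inj: "inj_on f {0..<1}"
proof (rule inj_onI)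
  fix x y assume xy: "x \<in> {0..<1::real}" "y \<in> {0..<1::real}" "f x = f y"
  then have "frac (F x) = frac (F y)" using f by simp
  then have "F x = F y + of_int (\<lfloor>F x\<rfloor> - \<lfloor>F y\<rfloor>)" by (simp add: frac_def)
  moreover have "\<exists>n. F y + of_int m = F (y + of_int n)" for m
    using F_add_int[of y] e_int by (cases "e = 1") (auto intro: exI[of _ m] exI[of _ "- m"])
  ultimately obtain n where "F x = F (y + of_int n)" by metis
  then have xn: "x = y + of_int n" using F_bij by (simp add: bij_is_inj inj_eq)
  then have "-1 < real_of_int n" "real_of_int n < 1" using xy by auto
  then have "n = 0" by linarith
  then show "x = y" using xn by simp
qed

lemma finv_frac: "finv (frac y) = frac (inv F y)"
proof (rule the_inv_into_f_eq[OF f_inj])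
  show "f (frac (inv F y)) = frac y" using f_frac F_bij by (simp add: bij_is_surj surj_f_inv_f)
qed (rule frac_in)

lemma f_pow: "(f ^^ n) (frac x) = frac ((F ^^ n) x)"
  by (induction n) (simp_all add: f_frac)

lemma finv_pow: "(finv ^^ n) (frac x) = frac ((inv F ^^ n) x)"
  by (induction n) (simp_all add: finv_frac)

lemma orbit_zpow: assumes "z \<in> circle_orbit f (frac x)" shows "\<exists>t. z = frac (zpow F t x)"
proof -
  have "frac ((F ^^ n) x) = frac (zpow F (int n) x)" for n by (simp add: zpow_def)
  moreover have "frac ((inv F ^^ n) x) = frac (zpow F (- int n) x)" for n by (cases "n = 0") (simp_all add: zpow_def)
  ultimately show ?thesis using assms unfolding circle_orbit_def f_pow finv_pow by blast
qed

text \<open>A periodic point would have a finite two-sided orbit, which stays at positive distance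
  from some point of the infinite set \<open>C\<close>.\<close>

lemma no_periodic: assumes x: "x \<in> C" and n: "0 < n" shows "(f ^^ n) x \<noteq> x"
proof
  assume per: "(f ^^ n) x = x"
  have fx: "frac x = x" using x C01 by (intro frac_eq_id) auto
  have "finv (f (frac y)) = frac y" for y using the_inv_into_f_f[OF f_inj] frac_in by blast
  then have step: "finv (f y) = y" if "y \<in> {0..<1}" for y using that by (metis frac_eq_id)
  have "(finv ^^ m) ((f ^^ m) x) = x" for m
  proof (induction m)
    case (Suc m)
    have "(f ^^ m) x \<in> {0..<1}" using f_pow[of m x] frac_in unfolding fx by simp
    then have "finv (f ((f ^^ m) x)) = (f ^^ m) x" by (rule step)
    then show ?case using Suc unfolding funpow_Suc_right[of m finv] by simp
  qed simp
  from this[of n] have per': "(finv ^^ n) x = x" using per by simp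
  define Orb where "Orb = (\<lambda>i. (f ^^ i) x) ` {..<n} \<union> (\<lambda>i. (finv ^^ i) x) ` {..<n}"
  have "(f ^^ m) x \<in> Orb" "(finv ^^ m) x \<in> Orb" for m
    using funpow_mod_eq[OF per, of m] funpow_mod_eq[OF per', of m] n unfolding Orb_def by (metis UnI1 UnI2 imageI lessThan_iff mod_less_divisor)+
  then have sub: "circle_orbit f x \<subseteq> Orb" unfolding circle_orbit_def by auto
  have fin: "finite Orb" by (simp add: Orb_def)
  have Orb01: "Orb \<subseteq> {0..<1}"
    unfolding Orb_def using f_pow[of _ x] finv_pow[of _ x] frac_in unfolding fx by auto
  obtain y where y: "y \<in> C" "y \<notin> Orb" using C_inf fin by (meson finite_subset subsetI)
  have pos: "0 < circ_dist z y" if "z \<in> Orb" for z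
  proof (rule ccontr)
    assume "\<not> 0 < circ_dist z y"
    then have "z - y = of_int (round (z - y))" by (simp add: circ_dist_def)
    moreover have "-1 < z - y" "z - y < 1" using Orb01 C01 that y by fastforce+
    ultimately have "round (z - y) = 0" by linarith
    then have "z = y" using \<open>z - y = _\<close> by simp
    then show False using that y by simp
  qed
  define r where "r = Min (insert 1 ((\<lambda>z. circ_dist z y) ` Orb))"
  have "0 < r" unfolding r_def using fin pos by auto
  then obtain z where z: "z \<in> circle_orbit f x" "circ_dist z y < r" using orbit_dense[OF x y(1)] by blast
  then have "r \<le> circ_dist z y" unfolding r_def using fin sub by (intro Min_le) auto
  then show False using z by simp
qed

lemma A_image: "F ` {x. frac x \<in> C} = {x. frac x \<in> C}"
proof
  show "F ` {x. frac x \<in> C} \<subseteq> {x. frac x \<in> C}" using fC by (auto simp flip: f_frac)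
  show "{x. frac x \<in> C} \<subseteq> F ` {x. frac x \<in> C}"
  proof
    fix y assume "y \<in> {x. frac x \<in> C}"
    then obtain z where z: "z \<in> C" "frac y = f z" using fC by (metis imageE mem_Collect_eq)
    have fz: "frac z = z" using z C01 by (intro frac_eq_id) auto
    define x where "x = inv F y"
    have Fx: "F x = y" using F_bij by (simp add: x_def bij_is_surj surj_f_inv_f)
    have "f (frac x) = f (frac z)" using f_frac[of x] Fx z fz by simp
    then have "frac x = z" using f_inj frac_in fz by (metis inj_onD)
    then show "y \<in> F ` {x. frac x \<in> C}" using Fx z by blast
  qed
qed

text \<open>The points of the lifted set nearest to a fixed point of \<open>F\<close> are exchanged by \<open>F\<close>.\<close>
lemma not_reversing:
  assumes F_cont: "continuous_on UNIV F" and anti: "\<And>x y. x < y \<Longrightarrow> F y < F x"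
    and A_closed: "closed {x. frac x \<in> C}"
  shows False
proof -
  define A where "A = {x. frac x \<in> C}"
  define m where "m = \<bar>F 0\<bar> + 1"
  have "0 < m" by (simp add: m_def)
  then have "F m \<le> F 0" "F 0 \<le> F (- m)" using anti[of 0 m] anti[of "-m" 0] by auto
  then have "F m - m \<le> 0" "0 \<le> F (- m) - - m" by (auto simp: m_def)
  moreover have "continuous_on {-m..m} (\<lambda>x. F x - x)"
    by (intro continuous_intros continuous_on_subset[OF F_cont]) auto
  ultimately have "\<exists>x\<ge>-m. x \<le> m \<and> F x - x = 0" by (intro IVT2') (auto simp: m_def)
  then obtain p where p: "F p = p" by auto
  have le: "F y \<le> F x" if "x \<le> y" for x y using anti[of x y] that by (cases "x = y") auto
  have FA: "F x \<in> A \<longleftrightarrow> x \<in> A" for x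
    using A_image F_bij unfolding A_def[symmetric] by (metis bij_is_inj image_eqI inj_image_mem_iff)
  obtain x0 where x0: "x0 \<in> C" using C_inf by fastforce
  then have x0A: "x0 + of_int n \<in> A" for n using C01 by (auto simp: A_def)
  define X where "X = A \<inter> {..p}"
  define Y where "Y = A \<inter> {p..}"
  have "x0 + of_int (- \<lceil>x0 - p\<rceil>) \<le> p" by linarith
  then have "x0 + of_int (- \<lceil>x0 - p\<rceil>) \<in> X" using x0A unfolding X_def by blast
  then have "X \<noteq> {}" by blast
  moreover have "bdd_above X" by (auto simp: X_def intro: bdd_aboveI[of _ p])
  moreover have "closed X" using A_closed by (auto simp: X_def A_def)
  ultimately have SX: "Sup X \<in> X" "\<And>z. z \<in> X \<Longrightarrow> z \<le> Sup X"
    using closed_contains_Sup[of X] cSup_upper[of _ X] by auto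
  have "p \<le> x0 + of_int \<lceil>p - x0\<rceil>" by linarith
  then have "x0 + of_int \<lceil>p - x0\<rceil> \<in> Y" using x0A unfolding Y_def by blast
  then have "Y \<noteq> {}" by blast
  moreover have "bdd_below Y" by (auto simp: Y_def intro: bdd_belowI[of _ p])
  moreover have "closed Y" using A_closed by (auto simp: Y_def A_def)
  ultimately have IY: "Inf Y \<in> Y" "\<And>z. z \<in> Y \<Longrightarrow> Inf Y \<le> z"
    using closed_contains_Inf[of Y] cInf_lower[of _ Y] by auto
  have X_Y: "F x \<in> Y" if "x \<in> X" for x using that le[of x p] FA p by (auto simp: X_def Y_def)
  have Y_X: "F x \<in> X" if "x \<in> Y" for x using that le[of p x] FA p by (auto simp: X_def Y_def)
  have invX: "inv F y \<in> X" if "y \<in> Y" for y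
  proof -
    have Fy: "F (inv F y) = y" using F_bij by (simp add: bij_is_surj surj_f_inv_f)
    have "inv F y \<le> p" using anti[of p "inv F y"] Fy p that by (force simp: Y_def)
    then show ?thesis using FA[of "inv F y"] Fy that by (auto simp: X_def Y_def)
  qed
  have invY: "inv F y \<in> Y" if "y \<in> X" for y
  proof -
    have Fy: "F (inv F y) = y" using F_bij by (simp add: bij_is_surj surj_f_inv_f)
    have "p \<le> inv F y" using anti[of "inv F y" p] Fy p that by (force simp: X_def)
    then show ?thesis using FA[of "inv F y"] Fy that by (auto simp: X_def Y_def)
  qed
  have Finv: "F (inv F y) = y" for y using F_bij by (simp add: bij_is_surj surj_f_inv_f)
  \<comment> \<open>\<open>F\<close> and its inverse exchange the two half-lines at \<open>p\<close>
    and preserve \<open>A\<close>. Being decreasing, \<open>F\<close> swaps the points of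
    \<open>A\<close> next to \<open>p\<close>, so that \<open>f ^^ 2\<close> has a fixed point in
    \<open>C\<close>.\<close>
  have 1: "F (Sup X) = Inf Y"
    using IY(2)[OF X_Y[OF SX(1)]] le[OF SX(2)[OF invX[OF IY(1)]]] Finv[of "Inf Y"] by simp
  have 2: "F (Inf Y) = Sup X"
    using SX(2)[OF Y_X[OF IY(1)]] le[OF IY(2)[OF invY[OF SX(1)]]] Finv[of "Sup X"] by simp
  have "frac (Sup X) \<in> C" using SX(1) by (simp add: X_def A_def)
  moreover have "(f ^^ 2) (frac (Sup X)) = frac (Sup X)"
    using f_pow[of 2 "Sup X"] 1 2 by (simp add: numeral_2_eq_2)
  ultimately show False using no_periodic[of "frac (Sup X)" 2] by simp
qed

lemma zpow_not_periodic:
  assumes "strict_mono F" "e = 1" "frac x \<in> C" "zpow F t x = x + of_int n"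
  shows "t = 0"
proof (rule ccontr)
  assume t: "t \<noteq> 0"
  interpret circle_homeo F using F_bij F_e assms by unfold_locales auto
  have pos: False if "0 < t" "zpow F t x = x + of_int n" for t n
  proof -
    have "(f ^^ nat t) (frac x) = frac (zpow F t x)" using that(1) by (simp add: f_pow zpow_def)
    also have "\<dots> = frac x" unfolding that(2) by simp
    finally show False using no_periodic[OF assms(3), of "nat t"] that(1) by simp
  qed
  have "zpow F (- t) x + of_int n = x"
    using zpow_int[of "-t" x n] zadd[of "-t" t x] assms(4) by simp
  then have "zpow F (- t) x = x + of_int (- n)" by simp
  then show False using pos[of t n] pos[of "-t" "-n"] assms(4) t by (cases "0 < t") auto
qed

lemma zpow_dense:
  assumes "frac x \<in> C" "frac y \<in> C" "0 < r"
  shows "\<exists>t n. \<bar>zpow F t x + of_int n - y\<bar> < r"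
proof -
  obtain z where z: "z \<in> circle_orbit f (frac x)" "circ_dist z (frac y) < r"
    using orbit_dense assms by blast
  obtain t where "z = frac (zpow F t x)" using orbit_zpow z(1) by blast
  then have "z - frac y - of_int (round (z - frac y)) =
      zpow F t x + of_int (- \<lfloor>zpow F t x\<rfloor> + \<lfloor>y\<rfloor> - round (z - frac y)) - y" by (simp add: frac_def)
  then show ?thesis using z(2) unfolding circ_dist_def by metis
qed

end

section \<open>From a minimal set on the circle to the lifted setting\<close>

context interval_config
begin

lemma nearly_affine_not_minimal:
  fixes \<sigma> :: "nat \<Rightarrow> bool" and \<theta> :: real
  assumes \<theta>: "0 < \<theta>" "\<theta> < 1" and c0: "0 \<le> c" and d1: "d < 1"
  obtains \<delta>0 where "0 < \<delta>0"
    "\<And>g C \<delta> f. ifs k a b c d \<sigma> g C \<delta> \<theta> \<Longrightarrow> \<delta> \<le> \<delta>0 \<Longrightarrow> C1_circle_diffeo f \<Longrightarrow> circle_minimal_set f C \<Longrightarrow> False"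
proof -
  obtain u \<delta>0 \<eta> where u: "0 < \<delta>0" "0 < \<eta>"
    "\<And>i j. i < k \<Longrightarrow> j < k \<Longrightarrow> i \<noteq> j \<Longrightarrow> 0 < u i j"
    and rig: "\<And>g C \<delta> w s i1 j1 x1 y1 i2 j2 x2 y2 w1 I1 J1 X1 Y1 w2 I2 J2 X2 Y2 m.
      ifs k a b c d \<sigma> g C \<delta> \<theta> \<Longrightarrow> \<delta> \<le> \<delta>0 \<Longrightarrow>
      ifs.coded k a b g C w i1 j1 x1 y1 \<Longrightarrow> ifs.coded k a b g C (w @ s) i2 j2 x2 y2 \<Longrightarrow> length s \<le> 1 \<Longrightarrow>
      ifs.coded k a b g C w1 I1 J1 X1 Y1 \<Longrightarrow> ifs.coded k a b g C w2 I2 J2 X2 Y2 \<Longrightarrow>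
      \<bar>ln \<bar>X1 - Y1\<bar> - ln \<bar>x1 - y1\<bar> - m\<bar> \<le> \<eta> \<Longrightarrow> \<bar>ln \<bar>X2 - Y2\<bar> - ln \<bar>x2 - y2\<bar> - m\<bar> \<le> \<eta> \<Longrightarrow>
      \<bar>X1 - X2\<bar> \<le> exp (m + \<eta>) * \<bar>x1 - x2\<bar> \<Longrightarrow>
      ln (rhow w1 * u I1 J1) - ln (rhow w * u i1 j1) = ln (rhow w2 * u I2 J2) - ln (rhow (w @ s) * u i2 j2)"
    by (rule rigidity_constants[OF \<theta>, of \<sigma>]) blast
  show ?thesis
  proof (rule that[OF u(1)])
    fix g C \<delta> f
    assume ifs: "ifs k a b c d \<sigma> g C \<delta> \<theta>" and \<delta>: "\<delta> \<le> \<delta>0"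
      and f: "C1_circle_diffeo f" and minimal: "circle_minimal_set f C"
    interpret ifs k a b c d \<sigma> g C \<delta> \<theta> by (rule ifs)
    obtain F F' e where F0: "\<forall>x. (F has_real_derivative F' x) (at x)" "continuous_on UNIV F'" "\<forall>x. F' x \<noteq> 0"
      "e \<in> {-1, 1::real}" "\<forall>x. F (x + 1) = F x + e" "\<forall>x\<in>{0..<1}. f x = frac (F x)"
      using f unfolding C1_circle_diffeo_def by blast
    then have F: "\<And>x. (F has_real_derivative F' x) (at x)" "continuous_on UNIV F'" "\<And>x. F' x \<noteq> 0"
      "e \<in> {-1, 1::real}" "\<And>x. F (x + 1) = F x + e" "\<And>x. x \<in> {0..<1} \<Longrightarrow> f x = frac (F x)"
      by blast+
    have K: "C \<subseteq> {0..<1}" "closed {x. frac x \<in> C}" "f ` C = C"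
      "\<And>x y e. x \<in> C \<Longrightarrow> y \<in> C \<Longrightarrow> 0 < e \<Longrightarrow> \<exists>z\<in>circle_orbit f x. circ_dist z y < e"
      using minimal unfolding circle_minimal_set_def by auto
    have F_cont: "continuous_on UNIV F" using F(1) by (meson DERIV_continuous_on has_field_derivative_at_within)
    have mvt: "\<exists>z. F y - F x = (y - x) * F' z" if "x < y" for x y using MVT2[OF that F(1)] by blast
    \<comment> \<open>The values at the integers are unbounded in both directions for either sign of
      \<open>e\<close>, which makes \<open>F\<close> onto by the intermediate value theorem.\<close>
    have F_int: "F (of_int n) = F 0 + e * of_int n" for n
    proof (induction n rule: int_induct[where k = 0])
      case (step1 n)
      then show ?case using F(5)[of "of_int n"] by (simp add: algebra_simps)
    next
      case (step2 n)
      then show ?case using F(5)[of "of_int (n - 1)"] by (simp add: algebra_simps)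
    qed simp
    have "surj F"
    proof -
      have "y \<in> range F" for y
      proof -
        define n where "n = \<lceil>\<bar>y - F 0\<bar>\<rceil>"
        have n: "\<bar>y - F 0\<bar> \<le> of_int n" by (simp add: n_def)
        have conn: "connected (range F)" using F_cont by (intro connected_continuous_image) auto
        have "F 0 + of_int m = F (of_int (if e = 1 then m else - m))" for m using F_int F(4) by auto
        then have "F 0 + of_int m \<in> range F" for m by blast
        from this[of n] this[of "- n"] have "F 0 - of_int n \<in> range F" "F 0 + of_int n \<in> range F" by simp_all
        then show ?thesis by (rule connectedD_interval[OF conn]) (use n in linarith)+
      qed
      then show ?thesis by auto
    qed
    have inj: "inj F"
    proof (rule linorder_injI)
      fix x y :: real assume "x < y"
      then show "F x \<noteq> F y" using mvt[of x y] F(3) by fastforce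
    qed
    have bij: "bij F" using inj \<open>surj F\<close> by (simp add: bij_def)
    interpret circle_lift f F e C
      using bij F(4,5,6) K(1,3,4) infinite_C by unfold_locales auto
    from nonvanishing_sign[OF F(2,3)] show False
    proof
      assume neg: "\<forall>x. F' x < 0"
      have anti: "F y < F x" if "x < y" for x y
        using mvt[OF that] neg that by (metis diff_gt_0_iff_gt diff_less_0_iff_less mult_pos_neg)
      then show False using not_reversing[OF F_cont anti] K(2) by blast
    next
      assume pos: "\<forall>x. 0 < F' x"
      have mono: "strict_mono F"
      proof (rule strict_monoI)
        fix x y :: real assume xy: "x < y"
        then show "F x < F y" using mvt[OF xy] pos by (metis diff_gt_0_iff_gt mult_pos_pos)
      qed
      then have "F 0 < F (0 + 1)" by (simp add: strict_mono_less)
      then have e1: "e = 1" using F(4) F(5)[of 0] by auto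
      interpret cantor_diffeo k a b c d \<sigma> g C \<delta> \<theta> F F' u \<eta>
      proof unfold_locales
        show "F (x + 1) = F x + 1" for x using F(5) e1 by simp
        show "0 < F' x" for x using pos by simp
        show "F ` {x. frac x \<in> C} = {x. frac x \<in> C}" by (rule A_image)
        show "\<exists>t n. \<bar>zpow F t x + of_int n - y\<bar> < r" if "frac x \<in> C" "frac y \<in> C" "0 < r" for x y r
          using zpow_dense[OF that] .
        show "t = 0" if "frac x \<in> C" "zpow F t x = x + of_int n" for x t n
          using zpow_not_periodic[OF mono e1 that] .
      qed (use bij mono c0 d1 F u rig[OF ifs \<delta>] in \<open>simp_all\<close>)
      show False by (rule no_cantor_diffeo)
    qed
  qed
qed

end

section \<open>Expanding maps with small nonlinearity\<close>

lemma inj_continuous_strict_mono: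
  fixes h :: "real \<Rightarrow> real"
  assumes cont: "continuous_on {p..q} h" and inj: "inj_on h {p..q}" and less: "h p < h q"
    and xy: "p \<le> x" "x < y" "y \<le> q"
  shows "h x < h y"
proof -
  have base: "h p < h z \<and> h z < h q" if "p < z" "z < q" for z
    using continuous_inj_imp_mono[OF that cont inj] less by auto
  show ?thesis
  proof (cases "p = x")
    case True
    then show ?thesis using base[of y] xy less by (cases "y = q") auto
  next
    case False
    then have x: "p < x" "x < q" using xy by auto
    show ?thesis
    proof (cases "y = q")
      case True
      then show ?thesis using base[OF x] by simp
    next
      case False
      have "continuous_on {p..y} h" "inj_on h {p..y}"
        using continuous_on_subset[OF cont] inj_on_subset[OF inj] xy by auto
      then have "h p < h x \<and> h x < h y \<or> h y < h x \<and> h x < h p"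
        using continuous_inj_imp_mono[OF x(1) xy(2)] by blast
      then show ?thesis using base[OF x] by auto
    qed
  qed
qed

text \<open>A sum of \<open>min \<epsilon> (K \<beta>\<^sup>n)\<close> is small with \<open>\<epsilon>\<close>: bound finitely many terms by
  \<open>\<epsilon>\<close> and the rest by the tail of the geometric series.\<close>
lemma truncated_geometric_small:
  fixes K \<beta> \<delta> :: real
  assumes K: "0 < K" and \<beta>: "0 < \<beta>" "\<beta> < 1" and \<delta>: "0 < \<delta>"
  obtains \<epsilon>0 where "0 < \<epsilon>0" "\<And>\<epsilon> N. 0 < \<epsilon> \<Longrightarrow> \<epsilon> \<le> \<epsilon>0 \<Longrightarrow> (\<Sum>n<N. min \<epsilon> (K * \<beta> ^ n)) \<le> \<delta>"
proof -
  have "0 < \<delta> * (1 - \<beta>) / (2 * K)" using K \<beta> \<delta> by simp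
  then obtain m where "\<beta> ^ m < \<delta> * (1 - \<beta>) / (2 * K)" using real_arch_pow_inv[of _ \<beta>] \<beta> by blast
  then have m: "K * \<beta> ^ m / (1 - \<beta>) \<le> \<delta> / 2" using K \<beta> by (simp add: field_simps)
  have key: "(\<Sum>n<N. min \<epsilon> (K * \<beta> ^ n)) \<le> real m * \<epsilon> + K * \<beta> ^ m / (1 - \<beta>)" if \<epsilon>: "0 < \<epsilon>" for \<epsilon> N
  proof -
    have head: "(\<Sum>n<m. min \<epsilon> (K * \<beta> ^ n)) \<le> real m * \<epsilon>"
      using sum_bounded_above[of "{..<m}" "\<lambda>n. min \<epsilon> (K * \<beta> ^ n)" \<epsilon>] by simp
    have nonneg: "0 \<le> K * \<beta> ^ n / (1 - \<beta>)" for n using K \<beta> by simp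
    show ?thesis
    proof (cases "m \<le> N")
      case True
      then have "(\<Sum>n<N. min \<epsilon> (K * \<beta> ^ n)) + K * \<beta> ^ N / (1 - \<beta>) \<le> real m * \<epsilon> + K * \<beta> ^ m / (1 - \<beta>)"
      proof (induction N rule: dec_induct)
        case base
        then show ?case using head by simp
      next
        case (step N)
        have "K * \<beta> ^ N + K * \<beta> ^ Suc N / (1 - \<beta>) = K * \<beta> ^ N / (1 - \<beta>)" using \<beta> by (simp add: field_simps)
        then show ?case using step.IH by (simp add: min_def)
      qed
      then show ?thesis using nonneg[of N] by linarith
    next
      case False
      have "(\<Sum>n<N. min \<epsilon> (K * \<beta> ^ n)) \<le> (\<Sum>n<m. min \<epsilon> (K * \<beta> ^ n))"
        using False K \<beta> \<epsilon> by (intro sum_mono2) auto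
      then show ?thesis using head nonneg[of m] by linarith
    qed
  qed
  define \<epsilon>0 where "\<epsilon>0 = \<delta> / (2 * (real m + 1))"
  show ?thesis
  proof (rule that[of \<epsilon>0])
    show "0 < \<epsilon>0" using \<delta> by (simp add: \<epsilon>0_def)
    fix \<epsilon> N assume \<epsilon>: "0 < \<epsilon>" "\<epsilon> \<le> \<epsilon>0"
    have "real m * \<epsilon> \<le> (real m + 1) * \<epsilon>0" using \<epsilon> by (intro mult_mono) auto
    also have "\<dots> = \<delta> / 2" by (simp add: \<epsilon>0_def field_simps)
    finally show "(\<Sum>n<N. min \<epsilon> (K * \<beta> ^ n)) \<le> \<delta>" using key[OF \<epsilon>(1), of N] m by linarith
  qed
qed

section \<open>Inverse branches of an expanding map and their distortion\<close>

locale expanding_map = interval_config +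
  fixes S S' :: "real \<Rightarrow> real" and M \<epsilon> \<alpha> \<theta> :: real
  assumes derS: "\<And>j x. j < k \<Longrightarrow> x \<in> {a j..b j} \<Longrightarrow> (S has_real_derivative S' x) (at x within {a j..b j})"
    and img: "\<And>j. j < k \<Longrightarrow> S ` {a j..b j} = {c..d}"
    and expand: "\<And>j x. j < k \<Longrightarrow> x \<in> {a j..b j} \<Longrightarrow> 1 < \<bar>S' x\<bar>"
    and nonlin: "\<And>j x y. j < k \<Longrightarrow> x \<in> {a j..b j} \<Longrightarrow> y \<in> {a j..b j} \<Longrightarrow> \<bar>ln \<bar>S' x\<bar> - ln \<bar>S' y\<bar>\<bar> \<le> \<epsilon>"
    and hoelder: "\<And>j x y. j < k \<Longrightarrow> x \<in> {a j..b j} \<Longrightarrow> y \<in> {a j..b j} \<Longrightarrow> \<bar>ln \<bar>S' x\<bar> - ln \<bar>S' y\<bar>\<bar> \<le> M * \<bar>x - y\<bar> powr \<alpha>"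
    and M: "0 < M" and \<alpha>: "0 < \<alpha>" and \<theta>: "0 < \<theta>" "\<theta> < 1" "\<And>j. j < k \<Longrightarrow> exp \<epsilon> * rho j \<le> \<theta>"
begin

definition g :: "nat \<Rightarrow> real \<Rightarrow> real" where "g j = the_inv_into {a j..b j} S"

text \<open>Restricting the function to \<open>{..<k}\<close> makes it one of finitely many, which
  permits a minimum over all orientation patterns.\<close>

definition \<sigma> :: "nat \<Rightarrow> bool" where "\<sigma> = (\<lambda>j\<in>{..<k}. S (a j) < S (b j))"

lemma S_mvt:
  assumes j: "j < k" and xy: "x \<in> {a j..b j}" "y \<in> {a j..b j}" "x \<noteq> y"
  obtains \<xi> where "\<xi> \<in> {a j..b j}" "min x y \<le> \<xi>" "\<xi> \<le> max x y" "\<bar>S x - S y\<bar> = \<bar>S' \<xi>\<bar> * \<bar>x - y\<bar>"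
proof -
  have *: "\<exists>\<xi>. x < \<xi> \<and> \<xi> < y \<and> \<bar>S x - S y\<bar> = \<bar>S' \<xi>\<bar> * \<bar>x - y\<bar>"
    if h: "x \<in> {a j..b j}" "y \<in> {a j..b j}" "x < y" for x y
  proof -
    have "(S has_derivative (\<lambda>t. S' z * t)) (at z within {x..y})" if "x \<le> z" "z \<le> y" for z
    proof -
      have "(S has_real_derivative S' z) (at z within {x..y})"
        using that h by (intro has_field_derivative_subset[OF derS[OF j]]) auto
      then show ?thesis by (simp add: has_field_derivative_def)
    qed
    then obtain \<xi> where "\<xi> \<in> {x<..<y}" "S y - S x = S' \<xi> * (y - x)"
      using mvt_simple[OF h(3), of S "\<lambda>z t. S' z * t"] by blast
    moreover from this(2) have "\<bar>S x - S y\<bar> = \<bar>S' \<xi>\<bar> * \<bar>x - y\<bar>"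
      by (metis abs_minus_commute abs_mult)
    ultimately show ?thesis by auto
  qed
  consider "x < y" | "y < x" using xy(3) by linarith
  then show ?thesis
  proof cases
    case 1
    then obtain \<xi> where "x < \<xi>" "\<xi> < y" "\<bar>S x - S y\<bar> = \<bar>S' \<xi>\<bar> * \<bar>x - y\<bar>" using * xy by blast
    then show ?thesis using that[of \<xi>] xy by auto
  next
    case 2
    then obtain \<xi> where "y < \<xi>" "\<xi> < x" "\<bar>S y - S x\<bar> = \<bar>S' \<xi>\<bar> * \<bar>y - x\<bar>" using * xy by blast
    then show ?thesis using that[of \<xi>] xy by (auto simp: abs_minus_commute)
  qed
qed

lemma S_inj: assumes j: "j < k" shows "inj_on S {a j..b j}"
proof (rule inj_onI, rule ccontr)
  fix x y assume xy: "x \<in> {a j..b j}" "y \<in> {a j..b j}" "S x = S y" "x \<noteq> y"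
  obtain \<xi> where "\<xi> \<in> {a j..b j}" "\<bar>S x - S y\<bar> = \<bar>S' \<xi>\<bar> * \<bar>x - y\<bar>" using S_mvt[OF j xy(1,2,4)] by metis
  then show False using expand[OF j, of \<xi>] xy by auto
qed

lemma S_cont: "j < k \<Longrightarrow> continuous_on {a j..b j} S"
  using derS by (meson DERIV_continuous_on)

lemma S_less:
  assumes j: "j < k" and xy: "x \<in> {a j..b j}" "y \<in> {a j..b j}" "x < y"
  shows "if \<sigma> j then S x < S y else S y < S x"
proof (cases "\<sigma> j")
  case True
  then have "S (a j) < S (b j)" using j by (simp add: \<sigma>_def)
  then show ?thesis using True inj_continuous_strict_mono[OF S_cont[OF j] S_inj[OF j]] xy by auto
next
  case False
  have "S (a j) \<noteq> S (b j)" using inj_onD[OF S_inj[OF j], of "a j" "b j"] ab[OF j] by auto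
  then have "- S (a j) < - S (b j)" using False j by (simp add: \<sigma>_def)
  moreover have "continuous_on {a j..b j} (\<lambda>x. - S x)" by (intro continuous_intros S_cont[OF j])
  moreover have "inj_on (\<lambda>x. - S x) {a j..b j}" using S_inj[OF j] by (auto simp: inj_on_def)
  ultimately have "- S x < - S y" using inj_continuous_strict_mono[of "a j" "b j" "\<lambda>x. - S x" x y] xy by auto
  then show ?thesis using False by simp
qed

lemma S_in: "j < k \<Longrightarrow> x \<in> {a j..b j} \<Longrightarrow> S x \<in> {c..d}"
  using img by blast

lemma S_ends: assumes j: "j < k"
  shows "S (if \<sigma> j then a j else b j) = c" "S (if \<sigma> j then b j else a j) = d"
proof -
  have abj: "a j \<in> {a j..b j}" "b j \<in> {a j..b j}" using ab[OF j] by auto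
  have le: "S (if \<sigma> j then a j else b j) \<le> S x" "S x \<le> S (if \<sigma> j then b j else a j)" if x: "x \<in> {a j..b j}" for x
    using S_less[OF j abj(1) x] S_less[OF j x abj(2)] x
    by (cases "\<sigma> j"; cases "x = a j"; cases "x = b j"; auto)+
  have "c \<in> S ` {a j..b j}" "d \<in> S ` {a j..b j}" using img[OF j] cd by auto
  then obtain x y where "x \<in> {a j..b j}" "S x = c" "y \<in> {a j..b j}" "S y = d" by auto
  moreover have "S (if \<sigma> j then a j else b j) \<in> {c..d}" "S (if \<sigma> j then b j else a j) \<in> {c..d}"
    using S_in[OF j] abj by auto
  ultimately show "S (if \<sigma> j then a j else b j) = c" "S (if \<sigma> j then b j else a j) = d"
    using le[of x] le[of y] by auto
qed

lemma g_in_I: assumes "j < k" "y \<in> {c..d}" shows "g j y \<in> {a j..b j}"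
  unfolding g_def by (rule the_inv_into_into[OF S_inj[OF assms(1)]]) (use img assms in auto)

lemma S_g: assumes "j < k" "y \<in> {c..d}" shows "S (g j y) = y"
  unfolding g_def by (rule f_the_inv_into_f[OF S_inj[OF assms(1)]]) (use img assms in auto)

lemma g_S: assumes "j < k" "x \<in> {a j..b j}" shows "g j (S x) = x"
  unfolding g_def by (rule the_inv_into_f_f[OF S_inj]) (use assms in auto)

lemma g_ratio:
  assumes j: "j < k" and xy: "x \<in> {c..d}" "y \<in> {c..d}" "x \<noteq> y"
  obtains \<xi> where "\<xi> \<in> {a j..b j}" "min (g j x) (g j y) \<le> \<xi>" "\<xi> \<le> max (g j x) (g j y)"
    "\<bar>x - y\<bar> = \<bar>S' \<xi>\<bar> * \<bar>g j x - g j y\<bar>" "g j x \<noteq> g j y"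
proof -
  have ne: "g j x \<noteq> g j y" using S_g[OF j xy(1)] S_g[OF j xy(2)] xy(3) by auto
  show ?thesis
    using S_mvt[OF j g_in_I[OF j xy(1)] g_in_I[OF j xy(2)] ne] that ne S_g[OF j xy(1)] S_g[OF j xy(2)] by metis
qed

text \<open>A rate uniform in \<open>S\<close> comes from the mean value over a whole interval:
  somewhere the slope has absolute value \<open>1 / rho j\<close>, and small nonlinearity spreads
  this to all points up to a factor \<open>exp \<epsilon>\<close>.\<close>

lemma S'_lower: assumes j: "j < k" and x: "x \<in> {a j..b j}" shows "1 \<le> \<theta> * \<bar>S' x\<bar>"
proof -
  have "a j \<in> {a j..b j}" "b j \<in> {a j..b j}" "a j \<noteq> b j" using ab[OF j] by auto
  then obtain \<xi> where \<xi>: "\<xi> \<in> {a j..b j}" "\<bar>S (a j) - S (b j)\<bar> = \<bar>S' \<xi>\<bar> * \<bar>a j - b j\<bar>"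
    using S_mvt[OF j] by metis
  have "\<bar>S (a j) - S (b j)\<bar> = d - c" using S_ends[OF j] cd by (cases "\<sigma> j") auto
  then have "1 = rho j * \<bar>S' \<xi>\<bar>" using \<xi>(2) ab[OF j] cd by (simp add: rho_def field_simps)
  also have "\<dots> \<le> rho j * (exp \<epsilon> * \<bar>S' x\<bar>)"
  proof (rule mult_left_mono)
    have "exp (ln \<bar>S' \<xi>\<bar>) \<le> exp (\<epsilon> + ln \<bar>S' x\<bar>)" using nonlin[OF j \<xi>(1) x] by simp
    then show "\<bar>S' \<xi>\<bar> \<le> exp \<epsilon> * \<bar>S' x\<bar>" using expand[OF j x] expand[OF j \<xi>(1)] by (simp add: exp_add)
    show "0 \<le> rho j" using rho_pos[OF j] by simp
  qed
  also have "\<dots> \<le> \<theta> * \<bar>S' x\<bar>" using mult_right_mono[OF \<theta>(3)[OF j], of "\<bar>S' x\<bar>"] by (simp add: algebra_simps)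
  finally show ?thesis .
qed

lemma g_contracts: assumes j: "j < k" and xy: "x \<in> {c..d}" "y \<in> {c..d}"
  shows "\<bar>g j x - g j y\<bar> \<le> \<theta> * \<bar>x - y\<bar>"
proof (cases "x = y")
  case False
  obtain \<xi> where \<xi>: "\<xi> \<in> {a j..b j}" "\<bar>x - y\<bar> = \<bar>S' \<xi>\<bar> * \<bar>g j x - g j y\<bar>" using g_ratio[OF j xy False] by metis
  have "1 * \<bar>g j x - g j y\<bar> \<le> (\<theta> * \<bar>S' \<xi>\<bar>) * \<bar>g j x - g j y\<bar>"
    using S'_lower[OF j \<xi>(1)] by (intro mult_right_mono) auto
  then show ?thesis unfolding \<xi>(2) by (simp add: mult.assoc)
qed simp

lemma foldr_g_in: "set w \<subseteq> {..<k} \<Longrightarrow> x \<in> {c..d} \<Longrightarrow> foldr g w x \<in> {c..d}"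
proof (induction w)
  case (Cons j w)
  then show ?case using g_in_I[of j "foldr g w x"] ca[of j] bd[of j] by auto
qed simp

lemma foldr_g_contracts: "set w \<subseteq> {..<k} \<Longrightarrow> x \<in> {c..d} \<Longrightarrow> y \<in> {c..d} \<Longrightarrow>
  \<bar>foldr g w x - foldr g w y\<bar> \<le> \<theta> ^ length w * (d - c)"
proof (induction w)
  case (Cons j w)
  have "\<bar>g j (foldr g w x) - g j (foldr g w y)\<bar> \<le> \<theta> * \<bar>foldr g w x - foldr g w y\<bar>"
    using Cons.prems by (intro g_contracts foldr_g_in) auto
  also have "\<dots> \<le> \<theta> * (\<theta> ^ length w * (d - c))"
    using Cons \<theta>(1) by (intro mult_left_mono) auto
  finally show ?case by simp
qed auto

text \<open>Prefixing a letter adds the variation of \<open>ln \<bar>S'\<bar>\<close> between two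
  mean value points at distance at most \<open>\<theta> ^ length w * (d - c)\<close>. It obeys the
  nonlinearity bound and the Hoelder bound at once, hence the minimum, with
  \<open>n = length w\<close>. Distinctness of the images is carried along so that the logarithms
  are meaningful.\<close>

lemma distortion_bound:
  assumes "set w \<subseteq> {..<k}" "{x, y, u, v} \<subseteq> {c..d}" "x \<noteq> y" "u \<noteq> v"
  shows "foldr g w x \<noteq> foldr g w y \<and> foldr g w u \<noteq> foldr g w v \<and>
    \<bar>logscale g w x y - logscale g w u v\<bar> \<le> (\<Sum>n<length w. min \<epsilon> (M * (d - c) powr \<alpha> * (\<theta> powr \<alpha>) ^ n))"
  using assms(1)
proof (induction w)
  case Nil
  then show ?case using assms by (simp add: logscale_def)
next
  case (Cons j w)
  have j: "j < k" and w: "set w \<subseteq> {..<k}" using Cons.prems by auto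
  define X where "X = foldr g w x"
  define Y where "Y = foldr g w y"
  define U where "U = foldr g w u"
  define V where "V = foldr g w v"
  note defs = X_def Y_def U_def V_def
  have IH: "X \<noteq> Y" "U \<noteq> V"
    "\<bar>logscale g w x y - logscale g w u v\<bar> \<le> (\<Sum>n<length w. min \<epsilon> (M * (d - c) powr \<alpha> * (\<theta> powr \<alpha>) ^ n))"
    using Cons.IH[OF w] by (auto simp: defs)
  have L: "X \<in> {c..d}" "Y \<in> {c..d}" "U \<in> {c..d}" "V \<in> {c..d}" using foldr_g_in[OF w] assms(2) by (auto simp: defs)
  obtain \<xi> where \<xi>: "\<xi> \<in> {a j..b j}" "min (g j X) (g j Y) \<le> \<xi>" "\<xi> \<le> max (g j X) (g j Y)"
    "\<bar>X - Y\<bar> = \<bar>S' \<xi>\<bar> * \<bar>g j X - g j Y\<bar>" "g j X \<noteq> g j Y" using g_ratio[OF j L(1,2) IH(1)] .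
  obtain \<zeta> where \<zeta>: "\<zeta> \<in> {a j..b j}" "min (g j U) (g j V) \<le> \<zeta>" "\<zeta> \<le> max (g j U) (g j V)"
    "\<bar>U - V\<bar> = \<bar>S' \<zeta>\<bar> * \<bar>g j U - g j V\<bar>" "g j U \<noteq> g j V" using g_ratio[OF j L(3,4) IH(2)] .
  define t where "t = \<theta> ^ length w * (d - c)"
  have close: "\<bar>g j p - g j q\<bar> \<le> t" if "p \<in> {X, Y}" "q \<in> {U, V}" for p q
  proof -
    have pq: "p \<in> {c..d}" "q \<in> {c..d}" using that L by auto
    have "\<bar>g j p - g j q\<bar> \<le> \<theta> * \<bar>p - q\<bar>" by (rule g_contracts[OF j pq])
    also have "\<dots> \<le> 1 * \<bar>p - q\<bar>" using \<theta> by (intro mult_right_mono) auto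
    also have "\<bar>p - q\<bar> \<le> t" unfolding t_def using that foldr_g_contracts[OF w] assms(2) by (auto simp: defs)
    finally show ?thesis by simp
  qed
  have dist: "\<bar>\<xi> - \<zeta>\<bar> \<le> t"
    using \<xi>(2,3) \<zeta>(2,3) close[of X U] close[of X V] close[of Y U] close[of Y V]
    by (auto simp: abs_le_iff min_def max_def split: if_splits)
  have t0: "0 < t" using \<theta> cd by (simp add: t_def)
  have "\<bar>\<xi> - \<zeta>\<bar> powr \<alpha> \<le> t powr \<alpha>" using dist \<alpha> by (intro powr_mono2) auto
  also have "t powr \<alpha> = (d - c) powr \<alpha> * (\<theta> powr \<alpha>) ^ length w"
    using \<theta> cd by (simp add: t_def powr_mult powr_power powr_realpow[symmetric] powr_powr mult.commute)
  finally have "M * \<bar>\<xi> - \<zeta>\<bar> powr \<alpha> \<le> M * (d - c) powr \<alpha> * (\<theta> powr \<alpha>) ^ length w"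
    using M by (simp add: mult.assoc)
  then have step: "\<bar>ln \<bar>S' \<xi>\<bar> - ln \<bar>S' \<zeta>\<bar>\<bar> \<le> min \<epsilon> (M * (d - c) powr \<alpha> * (\<theta> powr \<alpha>) ^ length w)"
    using nonlin[OF j \<xi>(1) \<zeta>(1)] hoelder[OF j \<xi>(1) \<zeta>(1)] by simp
  have "ln \<bar>X - Y\<bar> = ln \<bar>S' \<xi>\<bar> + ln \<bar>g j X - g j Y\<bar>"
    unfolding \<xi>(4) using expand[OF j \<xi>(1)] \<xi>(5) by (intro ln_mult_pos) auto
  then have "logscale g (j # w) x y = logscale g w x y - ln \<bar>S' \<xi>\<bar>" by (simp add: logscale_def defs)
  moreover have "ln \<bar>U - V\<bar> = ln \<bar>S' \<zeta>\<bar> + ln \<bar>g j U - g j V\<bar>"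
    unfolding \<zeta>(4) using expand[OF j \<zeta>(1)] \<zeta>(5) by (intro ln_mult_pos) auto
  then have "logscale g (j # w) u v = logscale g w u v - ln \<bar>S' \<zeta>\<bar>" by (simp add: logscale_def defs)
  ultimately have "\<bar>logscale g (j # w) x y - logscale g (j # w) u v\<bar>
      \<le> (\<Sum>n<length w. min \<epsilon> (M * (d - c) powr \<alpha> * (\<theta> powr \<alpha>) ^ n)) + min \<epsilon> (M * (d - c) powr \<alpha> * (\<theta> powr \<alpha>) ^ length w)"
    using IH(3) step by linarith
  then show ?case using \<xi>(5) \<zeta>(5) by (simp add: defs)
qed

lemma cantor_set_branch:
  assumes "x \<in> cantor_set k a b S"
  obtains j where "j < k" "x \<in> {a j..b j}" "S x \<in> cantor_set k a b S"
proof -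
  obtain j where j: "j < k" "x \<in> {a j..b j}" using assms by (auto simp: cantor_set_def interval_family_def)
  have n: "(S ^^ n) x \<in> interval_family k a b" if "1 \<le> n" for n using assms that by (auto simp: cantor_set_def)
  have "(S ^^ n) (S x) \<in> interval_family k a b" for n
    using n[of "Suc n"] by (simp add: funpow_swap1)
  then have "S x \<in> cantor_set k a b S" using n[of 1] by (simp add: cantor_set_def)
  then show ?thesis using that j by blast
qed

lemma cantor_set_pullback:
  assumes "S x \<in> cantor_set k a b S" "j < k" "x \<in> {a j..b j}"
  shows "x \<in> cantor_set k a b S"
proof -
  have "(S ^^ n) x \<in> interval_family k a b" if n1: "1 \<le> n" for n
  proof -
    obtain m where m: "n = Suc m" using n1 by (cases n) auto
    have "(S ^^ m) (S x) \<in> interval_family k a b"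
      using assms(1) by (cases "m = 0") (auto simp: cantor_set_def)
    then show ?thesis unfolding m by (simp add: funpow_swap1)
  qed
  then show ?thesis using assms by (auto simp: cantor_set_def interval_family_def)
qed

lemma cantor_set_sub: "cantor_set k a b S \<subseteq> {c..d}"
  using ca bd by (force simp: cantor_set_def interval_family_def)

lemma ifs_of_expanding:
  assumes sum: "\<And>N. (\<Sum>n<N. min \<epsilon> (M * (d - c) powr \<alpha> * (\<theta> powr \<alpha>) ^ n)) \<le> \<delta>"
    and closed: "closed (cantor_set k a b S)" and ne: "cantor_set k a b S \<noteq> {}"
    and \<delta>: "0 < \<delta>" "\<And>j. j < k \<Longrightarrow> exp \<delta> * rho j \<le> \<theta>"
  shows "ifs k a b c d \<sigma> g (cantor_set k a b S) \<delta> \<theta>"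
proof unfold_locales
  fix j x y assume j: "j < k" and xy: "x \<in> {c..d}" "y \<in> {c..d}" "x < y"
  show "if \<sigma> j then g j x < g j y else g j y < g j x"
    using S_less[OF j g_in_I[OF j xy(1)] g_in_I[OF j xy(2)]] S_less[OF j g_in_I[OF j xy(2)] g_in_I[OF j xy(1)]]
      S_g[OF j xy(1)] S_g[OF j xy(2)] xy(3)
    by (cases "g j x" "g j y" rule: linorder_cases) (auto split: if_splits)
next
  fix j assume j: "j < k"
  show "g j c = (if \<sigma> j then a j else b j)" "g j d = (if \<sigma> j then b j else a j)"
    using g_S[OF j, of "if \<sigma> j then a j else b j"] g_S[OF j, of "if \<sigma> j then b j else a j"]
      S_ends[OF j] ab[OF j] by auto
next
  fix x
  show "x \<in> cantor_set k a b S \<longleftrightarrow> (\<exists>j<k. \<exists>y\<in>cantor_set k a b S. x = g j y)"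
  proof
    assume "x \<in> cantor_set k a b S"
    then obtain j where j: "j < k" "x \<in> {a j..b j}" "S x \<in> cantor_set k a b S" using cantor_set_branch by blast
    then show "\<exists>j<k. \<exists>y\<in>cantor_set k a b S. x = g j y" using g_S[OF j(1,2)] by metis
  next
    assume "\<exists>j<k. \<exists>y\<in>cantor_set k a b S. x = g j y"
    then obtain j y where j: "j < k" "y \<in> cantor_set k a b S" "x = g j y" by blast
    have y: "y \<in> {c..d}" using j cantor_set_sub by blast
    show "x \<in> cantor_set k a b S"
      using cantor_set_pullback[of x j] S_g[OF j(1) y] g_in_I[OF j(1) y] j by simp
  qed
next
  fix w x y u v assume "set w \<subseteq> {..<k}" "{x, y, u, v} \<subseteq> {c..d}" "x \<noteq> y" "u \<noteq> (v :: real)"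
  from distortion_bound[OF this] show "\<bar>logscale g w x y - logscale g w u v\<bar> \<le> \<delta>"
    using sum[of "length w"] by linarith
qed (use closed ne \<delta> cantor_set_sub \<theta> in auto)

end

text \<open>The supremum of an unbounded set of reals is unspecified, so the bound on the
  nonlinearity says something about single points only once the set is known to be bounded above;
  the Hoelder condition supplies this.\<close>

lemma in_A_nonlinearity:
  assumes A: "nonlinearity k a b S' < \<epsilon>"
    and H: "\<forall>j<k. \<forall>x\<in>{a j..b j}. \<forall>y\<in>{a j..b j}. \<bar>ln (\<bar>S' x\<bar> / \<bar>S' y\<bar>)\<bar> \<le> M * \<bar>x - y\<bar> powr \<alpha>"
    and M: "0 < M" and \<alpha>: "0 < \<alpha>"
    and j: "j < k" and xy: "x \<in> {a j..b j}" "y \<in> {a j..b j}"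
  shows "ln (\<bar>S' x\<bar> / \<bar>S' y\<bar>) \<le> \<epsilon>"
proof -
  let ?B = "\<lambda>j. {ln (\<bar>S' x\<bar> / \<bar>S' y\<bar>) | x y. x \<in> {a j..b j} \<and> y \<in> {a j..b j}}"
  have "bdd_above (?B j)"
  proof (rule bdd_aboveI)
    fix z assume "z \<in> ?B j"
    then obtain x y where z: "z = ln (\<bar>S' x\<bar> / \<bar>S' y\<bar>)" "x \<in> {a j..b j}" "y \<in> {a j..b j}" by blast
    have "z \<le> M * \<bar>x - y\<bar> powr \<alpha>" using H j z by (metis abs_le_D1)
    also have "\<dots> \<le> M * \<bar>b j - a j\<bar> powr \<alpha>"
      using z M \<alpha> by (intro mult_left_mono powr_mono2) auto
    finally show "z \<le> M * \<bar>b j - a j\<bar> powr \<alpha>" .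
  qed
  then have "ln (\<bar>S' x\<bar> / \<bar>S' y\<bar>) \<le> Sup (?B j)" using xy by (intro cSup_upper) blast+
  also have "\<dots> \<le> nonlinearity k a b S'" unfolding nonlinearity_def using j by (intro Max_ge) auto
  finally show ?thesis using A by simp
qed

lemma (in interval_config) expanding_of_in_A:
  assumes A: "in_A k a b c d M \<epsilon> \<alpha> S" and M: "0 < M" and \<alpha>: "0 < \<alpha>"
    and \<theta>: "0 < \<theta>" "\<theta> < 1" "\<And>j. j < k \<Longrightarrow> exp \<epsilon> * rho j \<le> \<theta>"
  obtains S' where "expanding_map k a b c d S S' M \<epsilon> \<alpha> \<theta>"
proof -
  obtain S' where S': "\<forall>j<k. \<forall>x\<in>{a j..b j}. (S has_real_derivative S' x) (at x within {a j..b j})"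
    "\<forall>j<k. S ` {a j..b j} = {c..d}" "\<forall>x\<in>interval_family k a b. \<bar>S' x\<bar> > 1"
    "nonlinearity k a b S' < \<epsilon>"
    "\<forall>j<k. \<forall>x\<in>{a j..b j}. \<forall>y\<in>{a j..b j}. \<bar>ln (\<bar>S' x\<bar> / \<bar>S' y\<bar>)\<bar> \<le> M * \<bar>x - y\<bar> powr \<alpha>"
    using A unfolding in_A_def by blast
  have ex: "1 < \<bar>S' x\<bar>" if "j < k" "x \<in> {a j..b j}" for j x
    using S'(3) that by (auto simp: interval_family_def)
  have ln: "ln (\<bar>S' x\<bar> / \<bar>S' y\<bar>) = ln \<bar>S' x\<bar> - ln \<bar>S' y\<bar>"
    if "j < k" "x \<in> {a j..b j}" "y \<in> {a j..b j}" for j x y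
    using ex[OF that(1,2)] ex[OF that(1,3)] by (intro ln_divide_pos) auto
  show ?thesis
  proof (rule that[of S'], unfold_locales)
    fix j x y assume j: "j < k" and xy: "x \<in> {a j..b j}" "y \<in> {a j..b j}"
    show "\<bar>ln \<bar>S' x\<bar> - ln \<bar>S' y\<bar>\<bar> \<le> \<epsilon>"
      using in_A_nonlinearity[OF S'(4,5) M \<alpha> j xy] in_A_nonlinearity[OF S'(4,5) M \<alpha> j xy(2,1)] ln[OF j xy] ln[OF j xy(2,1)]
      by linarith
    show "\<bar>ln \<bar>S' x\<bar> - ln \<bar>S' y\<bar>\<bar> \<le> M * \<bar>x - y\<bar> powr \<alpha>"
      using S'(5) j xy ln[OF j xy] by metis
  qed (use S' ex M \<alpha> \<theta> in auto)
qed

section \<open>Choice of \<epsilon> and conclusion\<close>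

lemma (in interval_config) not_minimal_constants:
  assumes c0: "0 \<le> c" and d1: "d < 1" and M: "0 < M" and \<alpha>: "0 < \<alpha>"
  shows "\<exists>\<epsilon>>0. \<forall>S. in_A k a b c d M \<epsilon> \<alpha> S \<longrightarrow>
           \<not> (\<exists>f. C1_circle_diffeo f \<and> circle_minimal_set f (cantor_set k a b S))"
proof -
  obtain r s where rs: "0 < r" "s < 1" "0 < s" "\<And>j. j < k \<Longrightarrow> r \<le> rho j" "\<And>j. j < k \<Longrightarrow> rho j \<le> s"
    by (rule rho_bounds) blast
  \<comment> \<open>A rate strictly between the largest ratio bound \<open>s\<close> and 1 leaves
    room for distortion. With the square root, \<open>exp t * s \<le> \<theta>\<close> holds for all
    \<open>t\<close> up to \<open>- ln \<theta>\<close>, which is \<open>\<delta>1\<close>.\<close>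
  define \<theta> where "\<theta> = sqrt s"
  have \<theta>: "0 < \<theta>" "\<theta> < 1" "\<theta> * \<theta> = s" using rs by (auto simp: \<theta>_def)
  define \<delta>1 where "\<delta>1 = - ln \<theta>"
  have \<delta>1: "0 < \<delta>1" using \<theta> by (simp add: \<delta>1_def ln_less_zero)
  have small: "exp t * rho j \<le> \<theta>" if "t \<le> \<delta>1" "j < k" for t j
  proof -
    have "exp t * rho j \<le> exp \<delta>1 * s" using that rs(5)[OF that(2)] rho_pos[OF that(2)] by (intro mult_mono) auto
    also have "\<dots> = \<theta>" using \<theta> by (simp add: \<delta>1_def exp_minus flip: \<theta>(3))
    finally show ?thesis .
  qed
  define \<Sigma> where "\<Sigma> = ({..<k} \<rightarrow>\<^sub>E (UNIV :: bool set))"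
  have fin: "finite \<Sigma>" unfolding \<Sigma>_def by (rule finite_PiE) auto
  have "\<forall>\<sigma>. \<exists>\<delta>0>0. \<forall>g C \<delta> f. ifs k a b c d \<sigma> g C \<delta> \<theta> \<longrightarrow> \<delta> \<le> \<delta>0 \<longrightarrow> C1_circle_diffeo f \<longrightarrow> \<not> circle_minimal_set f C"
  proof
    fix \<sigma> :: "nat \<Rightarrow> bool"
    obtain \<delta>0 where "0 < \<delta>0"
      "\<And>g C \<delta> f. ifs k a b c d \<sigma> g C \<delta> \<theta> \<Longrightarrow> \<delta> \<le> \<delta>0 \<Longrightarrow> C1_circle_diffeo f \<Longrightarrow> circle_minimal_set f C \<Longrightarrow> False"
      by (rule nearly_affine_not_minimal[OF \<theta>(1,2) c0 d1, of \<sigma>]) blast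
    then show "\<exists>\<delta>0>0. \<forall>g C \<delta> f. ifs k a b c d \<sigma> g C \<delta> \<theta> \<longrightarrow> \<delta> \<le> \<delta>0 \<longrightarrow> C1_circle_diffeo f \<longrightarrow> \<not> circle_minimal_set f C"
      by blast
  qed
  then obtain D where D: "\<And>\<sigma>. 0 < D \<sigma>"
    "\<And>\<sigma> g C \<delta> f. ifs k a b c d \<sigma> g C \<delta> \<theta> \<Longrightarrow> \<delta> \<le> D \<sigma> \<Longrightarrow> C1_circle_diffeo f \<Longrightarrow> circle_minimal_set f C \<Longrightarrow> False"
    by metis
  \<comment> \<open>The orientation pattern of \<open>S\<close> is not known when \<epsilon> is
    chosen, so the least threshold over the finite set \<open>\<Sigma>\<close> is used.\<close>
  define \<delta> where "\<delta> = Min (insert \<delta>1 (D ` \<Sigma>))"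
  have \<delta>: "0 < \<delta>" "\<delta> \<le> \<delta>1" "\<And>\<sigma>. \<sigma> \<in> \<Sigma> \<Longrightarrow> \<delta> \<le> D \<sigma>"
    unfolding \<delta>_def using fin D(1) \<delta>1 by auto
  have "0 < M * (d - c) powr \<alpha>" "0 < \<theta> powr \<alpha>" "\<theta> powr \<alpha> < 1"
    using M cd \<theta> \<alpha> by (auto simp: powr01_less_one)
  then obtain \<epsilon>0 where \<epsilon>0: "0 < \<epsilon>0"
    "\<And>\<epsilon> N. 0 < \<epsilon> \<Longrightarrow> \<epsilon> \<le> \<epsilon>0 \<Longrightarrow> (\<Sum>n<N. min \<epsilon> (M * (d - c) powr \<alpha> * (\<theta> powr \<alpha>) ^ n)) \<le> \<delta>"
    using truncated_geometric_small[of "M * (d - c) powr \<alpha>" "\<theta> powr \<alpha>" \<delta>] \<delta>(1) by metis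
  \<comment> \<open>\<open>\<epsilon>0\<close> controls the accumulated distortion,
    \<open>\<delta>1\<close> the contraction rate that \<open>expanding_map\<close> requires of
    single branches.\<close>
  define \<epsilon> where "\<epsilon> = min \<epsilon>0 \<delta>1"
  have \<epsilon>: "0 < \<epsilon>" "\<epsilon> \<le> \<epsilon>0" "\<epsilon> \<le> \<delta>1" using \<epsilon>0 \<delta>1 by (auto simp: \<epsilon>_def)
  have "False" if A: "in_A k a b c d M \<epsilon> \<alpha> S" and f: "C1_circle_diffeo f"
      and m: "circle_minimal_set f (cantor_set k a b S)" for S f
  proof -
    obtain S' where "expanding_map k a b c d S S' M \<epsilon> \<alpha> \<theta>"
      using expanding_of_in_A[OF A M \<alpha> \<theta>(1,2) small[OF \<epsilon>(3)]] by blast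
    then interpret expanding_map k a b c d S S' M \<epsilon> \<alpha> \<theta> .
    \<comment> \<open>Closedness is taken from the minimal set and brought down from the lift by
      intersecting with \<open>[c, d]\<close>, where \<open>frac\<close> is the identity.\<close>
    have "closed {x. frac x \<in> cantor_set k a b S}" and ne: "cantor_set k a b S \<noteq> {}"
      using m by (auto simp: circle_minimal_set_def)
    moreover have "cantor_set k a b S = {x. frac x \<in> cantor_set k a b S} \<inter> {c..d}"
    proof -
      have "frac x = x" if "x \<in> {c..d}" for x using that c0 d1 by (intro frac_eq_id) auto
      then show ?thesis using cantor_set_sub by auto
    qed
    ultimately have closed: "closed (cantor_set k a b S)" by (metis closed_Int closed_atLeastAtMost)
    have "ifs k a b c d \<sigma> g (cantor_set k a b S) \<delta> \<theta>"
      by (rule ifs_of_expanding[OF \<epsilon>0(2)[OF \<epsilon>(1,2)] closed ne \<delta>(1) small[OF \<delta>(2)]])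
    moreover have "\<sigma> \<in> \<Sigma>" by (auto simp: \<Sigma>_def \<sigma>_def)
    ultimately show False using D(2) \<delta>(3) f m by blast
  qed
  then show ?thesis using \<epsilon>(1) by blast
qed

theorem theorem1:
  fixes k :: nat and a b :: "nat \<Rightarrow> real" and c d :: real
  assumes "k \<ge> 2"
    and "\<forall>j<k. 0 \<le> a j \<and> a j \<le> b j \<and> b j < 1"
    and "\<forall>i<k. \<forall>j<k. i \<noteq> j \<longrightarrow> {a i..b i} \<inter> {a j..b j} = {}"
    and "0 \<le> c" and "c \<le> d" and "d < 1"
    and "\<forall>j<k. {a j..b j} \<subseteq> {c..d}"
  shows "\<forall>M>0. \<forall>\<alpha>>0. \<exists>\<epsilon>>0. \<forall>S. in_A k a b c d M \<epsilon> \<alpha> S \<longrightarrow>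
           \<not> (\<exists>f. C1_circle_diffeo f \<and> circle_minimal_set f (cantor_set k a b S))"
proof (intro allI impI)
  fix M \<alpha> :: real assume M: "0 < M" and \<alpha>: "0 < \<alpha>"
  have I_sub: "c \<le> a j" "b j \<le> d" if "j < k" for j
    using assms(2,7) that by (auto simp: atLeastatMost_subset_iff)
  have disj: "b i < a j \<or> b j < a i" if "i < k" "j < k" "i \<noteq> j" for i j
  proof (rule ccontr)
    assume "\<not> ?thesis"
    then have "max (a i) (a j) \<in> {a i..b i} \<inter> {a j..b j}" using assms(2) that by auto
    then show False using assms(3) that by blast
  qed
  have k01: "0 < k" "1 < k" using assms(1) by auto
  have "a 0 \<le> b 0" "a 1 \<le> b 1" using assms(2) k01 by auto
  \<comment> \<open>Two disjoint nonempty intervals do not fit into a single point.\<close>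
  then have cd: "c < d"
    using disj[OF k01] I_sub[OF k01(1)] I_sub[OF k01(2)] by auto
  show "\<exists>\<epsilon>>0. \<forall>S. in_A k a b c d M \<epsilon> \<alpha> S \<longrightarrow>
           \<not> (\<exists>f. C1_circle_diffeo f \<and> circle_minimal_set f (cantor_set k a b S))"
  proof (cases "\<forall>j<k. a j < b j")
    case True
    interpret interval_config k a b c d
      using assms(1) cd True I_sub disj by unfold_locales auto
    show ?thesis using not_minimal_constants assms(4,6) M \<alpha> by blast
  next
    case False
    \<comment> \<open>A one-point interval cannot be mapped onto \<open>[c, d]\<close>, so the class
      is empty and any positive value serves, here 1.\<close>
    then obtain j where j: "j < k" "a j = b j" using assms(2) by fastforce
    have "\<not> in_A k a b c d M 1 \<alpha> S" for S
    proof
      assume "in_A k a b c d M 1 \<alpha> S"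
      then have "S ` {a j..b j} = {c..d}" using j(1) unfolding in_A_def by blast
      then have eq: "{c..d} = {S (a j)}" using j(2) by simp
      have "c \<in> {c..d}" "d \<in> {c..d}" using cd by auto
      then show False unfolding eq using cd by simp
    qed
    then show ?thesis by (intro exI[of _ 1]) auto
  qed
qed

end
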